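(* Let $n\in\mathbb N$ and let $q_1,\dots,q_n$ be fixed monomials in the noncommutative indeterminates $X_1,\dots,X_m$. For $\mathbf t=(t_1,\dots,t_n)\in\mathbb C^n$ let $V_{\mathbf t}=\sum_{j=1}^n t_jq_j$ and $|\mathbf t|=\max_{1\le j\le n}|t_j|$. For all $c>0$ there exists $\eta>0$ such that, if $|\mathbf t|\le\eta$ and $V_{\mathbf t}$ is $c$-convex, then there exist $F^0(V_{\mathbf t})=F^0(t_1,\dots,t_n)$ and $F^1(V_{\mathbf t})=F^1(t_1,\dots,t_n)$ (not depending on $N$) such that, as $N\to\infty$, $$\log Z^N_{V_{\mathbf t}}=N^2F^0(V_{\mathbf t})+F^1(V_{\mathbf t})+o(1).$$
   Context: $m\ge 1$ is a fixed integer. $\mathcal H_N(\mathbb C)$ is the set of $N\times N$ Hermitian matrices, $\mathrm{Tr}$ is the non-normalized trace. $\mu^N$ is the law of $m$ independent $N\times N$ GUE matrices, i.e. the probability measure on $\mathcal H_N(\mathbb C)^m$ with density proportional to $\exp(-\frac N2\mathrm{Tr}\sum_{i=1}^mA_i^2)$ with respect to Lebesgue measure $\prod_{i}\prod_j d(A_i)_{jj}\prod_{j<k}d\Re e(A_i)_{jk}\,d\Im m(A_i)_{jk}$. For a polynomial $V$, $Z^N_V=\int e^{-N\mathrm{Tr}(V(\mathbf A))}\,d\mu^N(\mathbf A)$. For $c>0$, $V$ is called $c$-convex if for every $N\in\mathbb N$ the function $\mathbf A\in\mathcal H_N(\mathbb C)^m\mapsto\mathrm{Tr}\big(V(\mathbf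 A)+\frac12\sum_{i=1}^mA_i^2\big)$ is real-valued and has Hessian (in the real entries of $\mathbf A$) bounded below by $cI$. *)

theory Defs
  imports
    "HOL-Analysis.Analysis"
    "HOL-Library.Poly_Mapping"
    "HOL-Library.Landau_Symbols"
    "Jordan_Normal_Form.Matrix"
begin

text \<open>A monomial in the noncommutative indeterminates \<open>X\<^sub>0, \<dots>, X\<^sub>m\<^sub>-\<^sub>1\<close> is the word of its letters
  (the empty word is the monomial 1). A noncommutative polynomial is a finitely supported
  family of coefficients indexed by words.\<close>

type_synonym nc_monomial = "nat list"
type_synonym nc_poly = "nc_monomial \<Rightarrow>\<^sub>0 complex"

definition eval_monomial :: "nat \<Rightarrow> (nat \<Rightarrow> complex mat) \<Rightarrow> nc_monomial \<Rightarrow> complex mat" where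
  "eval_monomial N A w = foldr (\<lambda>i M. A i * M) w (1\<^sub>m N)"

definition eval_poly :: "nat \<Rightarrow> (nat \<Rightarrow> complex mat) \<Rightarrow> nc_poly \<Rightarrow> complex mat" where
  "eval_poly N A P = Matrix.mat N N (\<lambda>jk.
     \<Sum>w\<in>Poly_Mapping.keys P. Poly_Mapping.lookup P w * (eval_monomial N A w $$ jk))"

definition Tr :: "complex mat \<Rightarrow> complex" where
  "Tr M = (\<Sum>j<dim_row M. M $$ (j, j))"

definition sum_squares :: "nat \<Rightarrow> nc_poly" where
  "sum_squares m = (\<Sum>i<m. Poly_Mapping.single [i, i] 1)"

definition half_sum_squares :: "nat \<Rightarrow> nc_poly" where
  "half_sum_squares m = (\<Sum>i<m. Poly_Mapping.single [i, i] (1 / 2))"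

definition hermitian_mats :: "nat \<Rightarrow> complex mat set" where
  "hermitian_mats N =
     {M \<in> carrier_mat N N. \<forall>j<N. \<forall>k<N. M $$ (k, j) = cnj (M $$ (j, k))}"

text \<open>The space of \<open>m\<close>-tuples of Hermitian matrices is parametrised by the real entries: for
  \<open>j < k\<close>, coordinate \<open>(i, j, k)\<close> is the real part and coordinate \<open>(i, k, j)\<close> the imaginary
  part of the \<open>(j, k)\<close> entry of the \<open>i\<close>-th matrix, and coordinate \<open>(i, j, j)\<close> is
  its \<open>j\<close>-th diagonal entry.\<close>

definition coords :: "nat \<Rightarrow> nat \<Rightarrow> (nat \<times> nat \<times> nat) set" where
  "coords m N = {..<m} \<times> {..<N} \<times> {..<N}"

definition herm :: "nat \<Rightarrow> (nat \<times> nat \<times> nat \<Rightarrow> real) \<Rightarrow> nat \<Rightarrow> complex mat" where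
  "herm N x i = Matrix.mat N N (\<lambda>(j, k).
     if j = k then complex_of_real (x (i, j, j))
     else if j < k then Complex (x (i, j, k)) (x (i, k, j))
     else Complex (x (i, k, j)) (- x (i, j, k)))"

lemma bij_betw_herm:
  "bij_betw (\<lambda>x. \<lambda>i\<in>{..<m}. herm N x i)
     (coords m N \<rightarrow>\<^sub>E UNIV) ({..<m} \<rightarrow>\<^sub>E hermitian_mats N)"
proof (rule bij_betwI[where g = "\<lambda>A. \<lambda>(i, j, k)\<in>coords m N.
    if j \<le> k then Re (A i $$ (j, k)) else Im (A i $$ (k, j))"])
  show "(\<lambda>x. \<lambda>i\<in>{..<m}. herm N x i) \<in>
      (coords m N \<rightarrow>\<^sub>E UNIV) \<rightarrow> ({..<m} \<rightarrow>\<^sub>E hermitian_mats N)"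
    by (auto simp: hermitian_mats_def herm_def complex_eq_iff)
next
  fix x :: "nat \<times> nat \<times> nat \<Rightarrow> real"
  assume x: "x \<in> coords m N \<rightarrow>\<^sub>E UNIV"
  show "(\<lambda>(i, j, k)\<in>coords m N. if j \<le> k then Re ((\<lambda>i\<in>{..<m}. herm N x i) i $$ (j, k))
      else Im ((\<lambda>i\<in>{..<m}. herm N x i) i $$ (k, j))) = x" (is "restrict ?g _ = x")
  proof
    fix p
    show "restrict ?g (coords m N) p = x p"
    proof (cases "p \<in> coords m N")
      case True
      then show ?thesis by (auto simp: coords_def herm_def)
    next
      case False
      then show ?thesis by (simp only: restrict_apply PiE_arb[OF x False] if_False)
    qed
  qed
next
  fix A :: "nat \<Rightarrow> complex mat"
  assume A: "A \<in> {..<m} \<rightarrow>\<^sub>E hermitian_mats N"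
  show "(\<lambda>i\<in>{..<m}. herm N (\<lambda>(i, j, k)\<in>coords m N.
      if j \<le> k then Re (A i $$ (j, k)) else Im (A i $$ (k, j))) i) = A"
  proof
    fix i
    show "(\<lambda>i\<in>{..<m}. herm N (\<lambda>(i, j, k)\<in>coords m N.
        if j \<le> k then Re (A i $$ (j, k)) else Im (A i $$ (k, j))) i) i = A i"
    proof (cases "i < m")
      case True
      with A have H: "A i \<in> hermitian_mats N" by auto
      then have carrier: "A i \<in> carrier_mat N N"
        unfolding hermitian_mats_def by blast
      have c: "A i $$ (k, j) = cnj (A i $$ (j, k))" if "j < N" "k < N" for j k
        using H that unfolding hermitian_mats_def by blast
      have d: "Im (A i $$ (j, j)) = 0" if "j < N" for j
        using arg_cong[OF c[OF that that], of Im] by simp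
      show ?thesis
      proof (rule eq_matI)
        fix j k assume "j < dim_row (A i)" "k < dim_col (A i)"
        with carrier have jk: "j < N" "k < N" by auto
        let ?x = "\<lambda>(i, j, k)\<in>coords m N.
            if j \<le> k then Re (A i $$ (j, k)) else Im (A i $$ (k, j))"
        have x: "?x (i, a, b) = (if a \<le> b then Re (A i $$ (a, b)) else Im (A i $$ (b, a)))"
          if "a < N" "b < N" for a b
          using True that by (simp add: coords_def)
        have "herm N ?x i $$ (j, k) = A i $$ (j, k)"
        proof (cases j k rule: linorder_cases)
          case less
          then show ?thesis
            using jk by (simp add: herm_def x complex_eq_iff del: restrict_apply)
        next
          case equal
          then show ?thesis
            using jk d[OF jk(1)] by (simp add: herm_def x complex_eq_iff del: restrict_apply)
        next
          case greater
          then show ?thesis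
            using jk
            by (subst c[OF jk(2) jk(1)])
              (simp add: herm_def x complex_eq_iff del: restrict_apply)
        qed
        with True show "(\<lambda>i\<in>{..<m}. herm N ?x i) i $$ (j, k) = A i $$ (j, k)"
          by simp
      qed (use carrier True in \<open>auto simp: herm_def\<close>)
    qed (use A in \<open>auto simp: PiE_def extensional_def\<close>)
  qed
qed (simp add: restrict_PiE_iff)

definition gue_weight :: "nat \<Rightarrow> nat \<Rightarrow> (nat \<times> nat \<times> nat \<Rightarrow> real) \<Rightarrow> real" where
  "gue_weight m N x = exp (- (real N / 2) * Re (Tr (eval_poly N (herm N x) (sum_squares m))))"

text \<open>The law of \<open>m\<close> independent GUE matrices, in the coordinates above.\<close>

definition gue :: "nat \<Rightarrow> nat \<Rightarrow> (nat \<times> nat \<times> nat \<Rightarrow> real) measure" where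
  "gue m N = (let L = (\<Pi>\<^sub>M p\<in>coords m N. lborel) in
     density L (\<lambda>x. ennreal (gue_weight m N x / (LINT y|L. gue_weight m N y))))"

definition partition_function :: "nat \<Rightarrow> nat \<Rightarrow> nc_poly \<Rightarrow> complex" where
  "partition_function m N V =
     (LINT x|gue m N. exp (- of_nat N * Tr (eval_poly N (herm N x) V)))"

definition partial_deriv :: "'i \<Rightarrow> (('i \<Rightarrow> real) \<Rightarrow> real) \<Rightarrow> ('i \<Rightarrow> real) \<Rightarrow> real" where
  "partial_deriv p f x = deriv (\<lambda>s. f (x(p := s))) (x p)"

definition hessian_bounded_below ::
    "'i set \<Rightarrow> real \<Rightarrow> (('i \<Rightarrow> real) \<Rightarrow> real) \<Rightarrow> bool" where
  "hessian_bounded_below I c f \<longleftrightarrow>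
     (\<forall>x v. (\<Sum>p\<in>I. \<Sum>r\<in>I. v p * partial_deriv p (partial_deriv r f) x * v r)
            \<ge> c * (\<Sum>p\<in>I. (v p)\<^sup>2))"

definition c_convex :: "nat \<Rightarrow> real \<Rightarrow> nc_poly \<Rightarrow> bool" where
  "c_convex m c V \<longleftrightarrow> (\<forall>N.
     let f = (\<lambda>x. Tr (eval_poly N (herm N x) (V + half_sum_squares m)))
     in (\<forall>x. f x \<in> \<real>) \<and> hessian_bounded_below (coords m N) c (\<lambda>x. Re (f x)))"

definition potential :: "nat \<Rightarrow> (nat \<Rightarrow> nc_monomial) \<Rightarrow> (nat \<Rightarrow> complex) \<Rightarrow> nc_poly" where
  "potential n q t = (\<Sum>j = 1..n. Poly_Mapping.single (q j) (t j))"

text \<open>The element 0 only serves the case \<open>n = 0\<close>, where it makes the maximum 0.\<close>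

definition max_norm :: "nat \<Rightarrow> (nat \<Rightarrow> complex) \<Rightarrow> real" where
  "max_norm n t = Max (insert 0 ((\<lambda>j. cmod (t j)) ` {1..n}))"

end

theory Submission
  imports Defs "HOL-Probability.Distributions" "HOL-Real_Asymp.Real_Asymp"
begin

text \<open>Let \<open>E\<^sub>N\<close> be the expectation under the Gibbs measure with potential \<open>V\<close> and let \<open>\<phi>\<^sub>N\<close> map a
  list of words to the expectation of the product of their normalized traces. Integration by
  parts gives an exact loop equation \<open>\<phi>\<^sub>N = T \<phi>\<^sub>N + N\<^sup>-\<^sup>2 S \<phi>\<^sub>N\<close> in which, because products of traces are
  kept as unknowns, \<open>T\<close> and \<open>S\<close> are linear and independent of \<open>N\<close>. For small coefficients \<open>T\<close> is a
  contraction in a weighted sup norm, so as soon as \<open>\<phi>\<^sub>N\<close> is bounded by \<open>R\<close> to the total length for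
  lengths up to \<open>N\<close>, it has a limit \<open>\<phi>\<^sub>\<infinity>\<close> and \<open>N\<^sup>2 (\<phi>\<^sub>N - \<phi>\<^sub>\<infinity>)\<close> converges as well; no concentration
  of traces is needed. The a priori bound is where convexity enters: by Prekopa-Leindler linear
  functionals of the matrices have Gaussian tails at scale \<open>N\<^sup>-\<^sup>1\<^sup>/\<^sup>2\<close> around their means, the means are
  scalar matrices by symmetry and bounded by integration by parts, and a union bound over a net
  of \<open>C\<^sup>N\<close> vectors controls the operator norms. Finally \<open>- log Z\<close> is the integral over \<open>s \<in> [0, 1]\<close> of
  the expectation of \<open>N Tr V\<close> under the potential \<open>s V\<close>, which is \<open>c\<close>-convex again (with \<open>min c 1\<close>).\<close>

text \<open>The moment bound cannot reach all words: a sum over the net is affordable for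
  \<open>N\<close>-th powers of linear functionals, and these control only products of total length
  at most \<open>N\<close> with a radius independent of \<open>N\<close>. Hence the loop equation is
  not inverted on a Banach space of all forests. It is iterated finitely often, about
  \<open>N / (2 * d)\<close> times where \<open>d\<close> bounds the degree of the potential, since
  every use may lengthen words by \<open>d\<close>; what remains is exponentially small in
  \<open>N / d\<close> and stays bounded after multiplication by \<open>N\<^sup>2\<close>. The
  operator \<open>S\<close> sums over positions in the other words, which costs a factor 8 in the
  base of the weight. It acts once in the equation of \<phi> and once in that of the correction;
  this produces the bases \<open>R\<close>, \<open>8 * R\<close>, \<open>64 * R\<close>, and the
  coefficients must be small with respect to the last one. The threshold for the coefficients has to
  be fixed before them, so \<open>R\<close> depends on \<open>m\<close> and the convexity constant
  alone. All bounds are uniform in the interpolation parameter, so that dominated convergence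
  applies to the integral over it.\<close>

section \<open>The Prekopa-Leindler inequality\<close>

text \<open>One-dimensional Brunn-Minkowski: \<open>A\<close> shifted by a point of \<open>B\<close>
  near its infimum and \<open>B\<close> shifted by a point of \<open>A\<close> near its supremum
  give, after halving, two subsets of \<open>C\<close> that meet in at most one point.
  \<open>C\<close> is any Borel set containing the midpoints, because the set of midpoints itself
  need not be Borel.\<close>

lemma emeasure_midpoint_set_ge:
  fixes A B C :: "real set"
  assumes meas: "A \<in> sets borel" "B \<in> sets borel" "C \<in> sets borel"
    and ne: "A \<noteq> {}" "B \<noteq> {}" and bdd: "bounded A" "bounded B"
    and mid: "\<And>x y. x \<in> A \<Longrightarrow> y \<in> B \<Longrightarrow> (x + y) / 2 \<in> C"
  shows "emeasure lborel A + emeasure lborel B \<le> 2 * emeasure lborel C"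
proof (rule ennreal_le_epsilon)
  fix e :: real assume e: "0 < e"
  have bA: "bdd_above A" and bB: "bdd_below B"
    using bdd by (auto simp: bounded_imp_bdd_above bounded_imp_bdd_below)
  \<comment> \<open>Supremum and infimum need not be attained; cutting at \<open>a\<close> and
    \<open>b\<close> loses a piece of length at most \<open>e/2\<close> from each set.\<close>
  obtain a where a: "a \<in> A" "Sup A - e/2 < a"
    using less_cSupE[of "Sup A - e/2" A] ne e by auto
  obtain b where b: "b \<in> B" "b < Inf B + e/2"
    using cInf_lessD[of B "Inf B + e/2"] ne e by auto
  define A1 where "A1 = A \<inter> {..a}"
  define B1 where "B1 = B \<inter> {b..}"
  have mA1[measurable]: "A1 \<in> sets borel" "B1 \<in> sets borel" using meas by (auto simp: A1_def B1_def)
  have "A \<subseteq> A1 \<union> {a<..Sup A}" using bA by (auto simp: A1_def cSup_upper)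
  then have "emeasure lborel A \<le> emeasure lborel (A1 \<union> {a<..Sup A})"
    by (intro emeasure_mono) auto
  also have "\<dots> \<le> emeasure lborel A1 + emeasure lborel {a<..Sup A}"
    by (intro emeasure_subadditive) auto
  also have "\<dots> \<le> emeasure lborel A1 + ennreal (e/2)"
    using a bA cSup_upper[OF a(1) bA] by (intro add_mono) (auto intro!: ennreal_leI)
  finally have A: "emeasure lborel A \<le> emeasure lborel A1 + ennreal (e/2)" .
  have "B \<subseteq> B1 \<union> {Inf B..<b}" using bB by (auto simp: B1_def cInf_lower)
  then have "emeasure lborel B \<le> emeasure lborel (B1 \<union> {Inf B..<b})"
    by (intro emeasure_mono) auto
  also have "\<dots> \<le> emeasure lborel B1 + emeasure lborel {Inf B..<b}"
    by (intro emeasure_subadditive) auto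
  also have "\<dots> \<le> emeasure lborel B1 + ennreal (e/2)"
    using b cInf_lower[OF b(1) bB] by (intro add_mono) (auto intro!: ennreal_leI)
  finally have B: "emeasure lborel B \<le> emeasure lborel B1 + ennreal (e/2)" .
  have scale: "emeasure lborel S = 2 * emeasure lborel ((\<lambda>x. d + 2 * x) -` S)"
    if [measurable]: "S \<in> sets borel" for S and d :: real
  proof -
    have "emeasure lborel S = emeasure (density (distr lborel borel (\<lambda>x. d + 2 * x)) (\<lambda>_. 2)) S"
      using lborel_real_affine[of 2 d] by simp
    also have "\<dots> = 2 * emeasure (distr lborel borel (\<lambda>x. d + 2 * x)) S"
      by (subst emeasure_density) (auto simp: nn_integral_cmult)
    also have "\<dots> = 2 * emeasure lborel ((\<lambda>x. d + 2 * x) -` S)"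
      by (subst emeasure_distr) auto
    finally show ?thesis .
  qed
  \<comment> \<open>\<open>A2\<close> and \<open>B2\<close> are the half-size copies
    \<open>(A1 + b) / 2\<close> and \<open>(a + B1) / 2\<close>; without their only possible common
    point \<open>(a + b) / 2\<close> they are disjoint.\<close>
  define A2 where "A2 = (\<lambda>x. - b + 2 * x) -` A1 - {(a+b)/2}"
  define B2 where "B2 = (\<lambda>x. - a + 2 * x) -` B1"
  have mA2[measurable]: "(\<lambda>x. - b + 2 * x) -` A1 \<in> sets lborel" "B2 \<in> sets borel"
    unfolding B2_def using measurable_sets[of "\<lambda>x. - b + 2 * x :: real" borel borel A1]
      measurable_sets[of "\<lambda>x. - a + 2 * x :: real" borel borel B1] by auto
  then have mA3[measurable]: "A2 \<in> sets borel" by (auto simp: A2_def)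
  have eA: "emeasure lborel A1 = 2 * emeasure lborel A2"
  proof -
    have "emeasure lborel A2 = emeasure lborel ((\<lambda>x. - b + 2 * x) -` A1)"
      unfolding A2_def by (rule emeasure_Diff_null_set[OF _ mA2(1)]) auto
    then show ?thesis by (subst scale[of _ "-b"]) auto
  qed
  have eB: "emeasure lborel B1 = 2 * emeasure lborel B2"
    unfolding B2_def by (subst scale[of _ "-a"]) auto
  have "x \<in> C" if "x \<in> A2 \<union> B2" for x
    using that mid[of "-b + 2*x" b] mid[of a "-a+2*x"] a b by (auto simp: A2_def B2_def A1_def B1_def)
  moreover have "A2 \<inter> B2 = {}" by (auto simp: A2_def B2_def A1_def B1_def)
  ultimately have "emeasure lborel A2 + emeasure lborel B2 \<le> emeasure lborel C"
    using meas by (subst plus_emeasure) (auto intro!: emeasure_mono)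
  then have "2 * (emeasure lborel A2 + emeasure lborel B2) \<le> 2 * emeasure lborel C"
    by (rule mult_left_mono) auto
  then have *: "emeasure lborel A1 + emeasure lborel B1 \<le> 2 * emeasure lborel C"
    by (simp add: eA eB distrib_left)
  have "emeasure lborel A + emeasure lborel B \<le> (emeasure lborel A1 + ennreal (e/2)) + (emeasure lborel B1 + ennreal (e/2))"
    by (intro add_mono A B)
  also have "\<dots> = (emeasure lborel A1 + emeasure lborel B1) + ennreal e"
    using e by (simp add: ac_simps flip: ennreal_plus)
  also have "\<dots> \<le> 2 * emeasure lborel C + ennreal e" by (intro add_mono *) auto
  finally show "emeasure lborel A + emeasure lborel B \<le> 2 * emeasure lborel C + ennreal e" .
qed

lemma nn_integral_layer_cake:
  fixes f :: "real \<Rightarrow> real"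
  assumes [measurable]: "f \<in> borel_measurable borel" and f: "\<And>x. 0 \<le> f x" "\<And>x. f x \<le> 1"
  shows "(\<integral>\<^sup>+x. ennreal (f x) \<partial>lborel) = (\<integral>\<^sup>+s. indicator {0<..<1} s * emeasure lborel {x. s < f x} \<partial>lborel)"
proof -
  have "(\<integral>\<^sup>+x. ennreal (f x) \<partial>lborel) = (\<integral>\<^sup>+x. \<integral>\<^sup>+s. indicator {0<..<1} s * indicator {x. s < f x} x \<partial>lborel \<partial>lborel)"
  proof (rule nn_integral_cong)
    fix x :: real
    have "(\<integral>\<^sup>+s. indicator {0<..<1} s * indicator {x. s < f x} x \<partial>lborel) = (\<integral>\<^sup>+s. indicator {0<..<f x} s \<partial>lborel)"
      using f(2)[of x] by (intro nn_integral_cong) (auto split: split_indicator)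
    also have "\<dots> = ennreal (f x)" using f[of x] by simp
    finally show "ennreal (f x) = (\<integral>\<^sup>+s. indicator {0<..<1} s * indicator {x. s < f x} x \<partial>lborel)" by simp
  qed
  also have "\<dots> = (\<integral>\<^sup>+s. \<integral>\<^sup>+x. indicator {0<..<1} s * indicator {x. s < f x} x \<partial>lborel \<partial>lborel)"
    by (rule lborel_pair.Fubini') (unfold indicator_def, measurable)
  also have "\<dots> = (\<integral>\<^sup>+s. indicator {0<..<1} s * emeasure lborel {x. s < f x} \<partial>lborel)"
    by (intro nn_integral_cong) (subst nn_integral_cmult, auto)
  finally show ?thesis .
qed

text \<open>With both suprema equal to 1, the superlevel sets at all levels below 1 are nonempty, so
  Brunn-Minkowski applies level by level. Integration over the levels gives an inequality for the
  sum of the integrals, which is stronger than the one for their product.\<close>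

lemma prekopa_leindler_normalized:
  fixes f g h :: "real \<Rightarrow> real"
  assumes [measurable]: "f \<in> borel_measurable borel" "g \<in> borel_measurable borel" "h \<in> borel_measurable borel"
    and f: "\<And>x. 0 \<le> f x" "\<And>x. f x \<le> 1" and g: "\<And>x. 0 \<le> g x" "\<And>x. g x \<le> 1"
    and h: "\<And>x. 0 \<le> h x" "\<And>x. h x \<le> 1"
    and supf: "\<And>s. s < 1 \<Longrightarrow> \<exists>x. s < f x" and supg: "\<And>s. s < 1 \<Longrightarrow> \<exists>x. s < g x"
    and bf: "\<And>x. K < \<bar>x\<bar> \<Longrightarrow> f x = 0" and bg: "\<And>x. K < \<bar>x\<bar> \<Longrightarrow> g x = 0"
    and fgh: "\<And>x y. f x * g y \<le> (h ((x + y) / 2))\<^sup>2"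
  shows "(\<integral>\<^sup>+x. ennreal (f x) \<partial>lborel) + (\<integral>\<^sup>+x. ennreal (g x) \<partial>lborel) \<le> 2 * (\<integral>\<^sup>+x. ennreal (h x) \<partial>lborel)"
proof -
  have *: "emeasure lborel {x. s < f x} + emeasure lborel {x. s < g x} \<le> 2 * emeasure lborel {x. s < h x}"
    if s: "0 < s" "s < 1" for s
  proof (rule emeasure_midpoint_set_ge)
    show "bounded {x. s < f x}" "bounded {x. s < g x}" unfolding bounded_iff
      using bf bg s by (auto intro!: exI[of _ K] simp: not_less[symmetric] dest: less_trans[of 0 s])
    show "{x. s < f x} \<noteq> {}" "{x. s < g x} \<noteq> {}" using supf supg s by auto
    fix x y assume "x \<in> {x. s < f x}" "y \<in> {x. s < g x}"
    then have "s * s < f x * g y" using s by (intro mult_strict_mono) auto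
    also note fgh[of x y]
    finally have "s\<^sup>2 < (h ((x + y) / 2))\<^sup>2" by (simp add: power2_eq_square)
    then show "(x + y) / 2 \<in> {x. s < h x}" using power_less_imp_less_base[OF _ h(1)] by auto
  qed auto
  have [measurable]: "(\<lambda>s. emeasure lborel {x. s < f x}) \<in> borel_measurable borel" if [measurable]: "f \<in> borel_measurable borel" for f :: "real \<Rightarrow> real"
    by measurable
  have "(\<integral>\<^sup>+x. ennreal (f x) \<partial>lborel) + (\<integral>\<^sup>+x. ennreal (g x) \<partial>lborel) 
     = (\<integral>\<^sup>+s. indicator {0<..<1} s * emeasure lborel {x. s < f x} + indicator {0<..<1} s * emeasure lborel {x. s < g x} \<partial>lborel)"
    using f g by (subst (1 2) nn_integral_layer_cake) (auto simp: nn_integral_add)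
  also have "\<dots> \<le> (\<integral>\<^sup>+s. 2 * (indicator {0<..<1} s * emeasure lborel {x. s < h x}) \<partial>lborel)"
    using * by (intro nn_integral_mono) (auto split: split_indicator)
  also have "\<dots> = 2 * (\<integral>\<^sup>+x. ennreal (h x) \<partial>lborel)"
    using h by (subst (1) nn_integral_layer_cake) (auto simp: nn_integral_cmult)
  finally show ?thesis .
qed

text \<open>Normalizing the suprema reduces to the inequality for sums; the arithmetic-geometric
  mean inequality brings back the product.\<close>

lemma prekopa_leindler_bounded:
  fixes f g h :: "real \<Rightarrow> real"
  assumes [measurable]: "f \<in> borel_measurable borel" "g \<in> borel_measurable borel" "h \<in> borel_measurable borel"
    and f: "\<And>x. 0 \<le> f x" "\<And>x. f x \<le> M" and g: "\<And>x. 0 \<le> g x" "\<And>x. g x \<le> M"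
    and h: "\<And>x. 0 \<le> h x"
    and bf: "\<And>x. K < \<bar>x\<bar> \<Longrightarrow> f x = 0" and bg: "\<And>x. K < \<bar>x\<bar> \<Longrightarrow> g x = 0"
    and fgh: "\<And>x y. f x * g y \<le> (h ((x + y) / 2))\<^sup>2"
  shows "(\<integral>\<^sup>+x. ennreal (f x) \<partial>lborel) * (\<integral>\<^sup>+x. ennreal (g x) \<partial>lborel) \<le> (\<integral>\<^sup>+x. ennreal (h x) \<partial>lborel)\<^sup>2"
proof (cases "(\<exists>x. f x \<noteq> 0) \<and> (\<exists>x. g x \<noteq> 0)")
  case False
  then have "(\<integral>\<^sup>+x. ennreal (f x) \<partial>lborel) = 0 \<or> (\<integral>\<^sup>+x. ennreal (g x) \<partial>lborel) = 0" by auto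
  then show ?thesis by auto
next
  case True
  define P where "P = Sup (range f)"
  define Q where "Q = Sup (range g)"
  have bdd: "bdd_above (range f)" "bdd_above (range g)" using f g by (auto intro!: bdd_aboveI[of _ M])
  have fP: "f x \<le> P" and gQ: "g x \<le> Q" for x unfolding P_def Q_def using bdd by (auto intro: cSup_upper)
  obtain x0 y0 where "f x0 \<noteq> 0" "g y0 \<noteq> 0" using True by auto
  then have P0: "P > 0" and Q0: "Q > 0" using f(1)[of x0] fP[of x0] g(1)[of y0] gQ[of y0] by auto
  have lP: "\<exists>x. s < f x" if "s < P" for s using less_cSupE[of s "range f"] that by (auto simp: P_def)
  have lQ: "\<exists>x. s < g x" if "s < Q" for s using less_cSupE[of s "range g"] that by (auto simp: Q_def)
  \<comment> \<open>Dividing \<open>f\<close> and \<open>g\<close> by their suprema forces the scale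
    \<open>sqrt (P * Q)\<close> on \<open>h\<close>. Cutting \<open>h'\<close> off at 1 is harmless
    because the product of the scaled \<open>f\<close> and \<open>g\<close> is at most 1.\<close>
  define r where "r = sqrt (P * Q)"
  have r: "r > 0" "r\<^sup>2 = P * Q" using P0 Q0 by (auto simp: r_def)
  define f' where "f' = (\<lambda>x. f x / P)"
  define g' where "g' = (\<lambda>x. g x / Q)"
  define h' where "h' = (\<lambda>x. min 1 (h x / r))"
  have [measurable]: "f' \<in> borel_measurable borel" "g' \<in> borel_measurable borel" "h' \<in> borel_measurable borel"
    by (auto simp: f'_def g'_def h'_def)
  have fl: "(\<integral>\<^sup>+x. ennreal (f x) \<partial>lborel) = P * (\<integral>\<^sup>+x. ennreal (f' x) \<partial>lborel)"
    using P0 f by (subst nn_integral_cmult[symmetric]) (auto simp: f'_def ennreal_mult[symmetric] intro!: nn_integral_cong)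
  have gl: "(\<integral>\<^sup>+x. ennreal (g x) \<partial>lborel) = Q * (\<integral>\<^sup>+x. ennreal (g' x) \<partial>lborel)"
    using Q0 g by (subst nn_integral_cmult[symmetric]) (auto simp: g'_def ennreal_mult[symmetric] intro!: nn_integral_cong)
  have "r * (\<integral>\<^sup>+x. ennreal (h' x) \<partial>lborel) = (\<integral>\<^sup>+x. ennreal (r * h' x) \<partial>lborel)"
    using r h by (subst nn_integral_cmult[symmetric]) (auto simp: h'_def ennreal_mult[symmetric] intro!: nn_integral_cong)
  also have "\<dots> \<le> (\<integral>\<^sup>+x. ennreal (h x) \<partial>lborel)"
    using r by (intro nn_integral_mono ennreal_leI) (auto simp: h'_def min_def field_simps)
  finally have hl: "r * (\<integral>\<^sup>+x. ennreal (h' x) \<partial>lborel) \<le> (\<integral>\<^sup>+x. ennreal (h x) \<partial>lborel)" .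
  have main: "(\<integral>\<^sup>+x. ennreal (f' x) \<partial>lborel) + (\<integral>\<^sup>+x. ennreal (g' x) \<partial>lborel) \<le> 2 * (\<integral>\<^sup>+x. ennreal (h' x) \<partial>lborel)"
  proof (rule prekopa_leindler_normalized[where K=K])
    fix x y
    have "f' x * g' y \<le> 1 * 1" using f g P0 Q0 fP gQ by (intro mult_mono) (auto simp: f'_def g'_def)
    moreover have "f' x * g' y \<le> (h ((x+y)/2) / r)\<^sup>2"
      using fgh[of x y] P0 Q0 by (simp add: f'_def g'_def power_divide r divide_simps)
    ultimately show "f' x * g' y \<le> (h' ((x + y) / 2))\<^sup>2" by (auto simp: h'_def min_def)
  next
    fix s :: real assume s: "s < 1"
    then show "\<exists>x. s < f' x" "\<exists>x. s < g' x" using lP[of "s*P"] lQ[of "s*Q"] P0 Q0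
      by (auto simp: f'_def g'_def field_simps)
  qed (use f g h P0 Q0 fP gQ bf bg r in \<open>auto simp: f'_def g'_def h'_def\<close>)
  have fin: "(\<integral>\<^sup>+x. ennreal (u x) \<partial>lborel) < \<infinity>" if "\<And>x. u x \<le> 1" "\<And>x. K < \<bar>x\<bar> \<Longrightarrow> u x = 0" for u :: "real \<Rightarrow> real"
  proof -
    have "(\<integral>\<^sup>+x. ennreal (u x) \<partial>lborel) \<le> (\<integral>\<^sup>+x. indicator {-K..K} x \<partial>lborel)"
      using that by (intro nn_integral_mono) (auto split: split_indicator intro!: ennreal_leI simp: abs_le_iff not_le[symmetric])
    also have "\<dots> < \<infinity>" by (cases "-K \<le> K") (auto simp: emeasure_lborel_Icc_eq)
    finally show ?thesis .
  qed
  have "(\<integral>\<^sup>+x. ennreal (f' x) \<partial>lborel) < \<infinity>" "(\<integral>\<^sup>+x. ennreal (g' x) \<partial>lborel) < \<infinity>"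
    using fP gQ P0 Q0 bf bg by (intro fin; auto simp: f'_def g'_def)+
  then obtain a b where a: "(\<integral>\<^sup>+x. ennreal (f' x) \<partial>lborel) = ennreal a" "a \<ge> 0"
    and b: "(\<integral>\<^sup>+x. ennreal (g' x) \<partial>lborel) = ennreal b" "b \<ge> 0"
    by (metis ennreal_cases infinity_ennreal_def less_irrefl)
  have "ennreal (a * b) \<le> (\<integral>\<^sup>+x. ennreal (h' x) \<partial>lborel)\<^sup>2"
  proof (cases "\<integral>\<^sup>+x. ennreal (h' x) \<partial>lborel")
    case (real c)
    have "ennreal (a + b) \<le> ennreal (2 * c)" using main a b real by (simp add: ennreal_mult)
    then have "a + b \<le> 2 * c" using real by (simp add: ennreal_le_iff)
    then have "(a + b)\<^sup>2 \<le> (2*c)\<^sup>2" using a b by (intro power_mono) auto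
    moreover have "4 * (a * b) \<le> (a+b)\<^sup>2" using zero_le_power2[of "a-b"] by (simp add: power2_eq_square algebra_simps)
    ultimately have "a * b \<le> c\<^sup>2" by (simp add: power_mult_distrib)
    then show ?thesis using real by (simp add: ennreal_power ennreal_leI)
  qed (simp add: top_power_ennreal)
  then have "ennreal (r\<^sup>2) * ennreal (a * b) \<le> ennreal (r\<^sup>2) * (\<integral>\<^sup>+x. ennreal (h' x) \<partial>lborel)\<^sup>2" by (rule mult_left_mono) auto
  also have "\<dots> = (r * (\<integral>\<^sup>+x. ennreal (h' x) \<partial>lborel))\<^sup>2" using r by (simp add: power_mult_distrib ennreal_power)
  also have "\<dots> \<le> (\<integral>\<^sup>+x. ennreal (h x) \<partial>lborel)\<^sup>2" by (intro power_mono hl) auto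
  finally show ?thesis using a b P0 Q0 unfolding fl gl a b r by (simp add: ennreal_mult ac_simps)
qed

text \<open>Cutting \<open>f\<close> and \<open>g\<close> off at height \<open>n\<close> and outside
  \<open>[-n, n]\<close> keeps the hypothesis when \<open>h\<close> is cut off at height
  \<open>n\<close> as well; monotone convergence removes the cutoff.\<close>

lemma prekopa_leindler_real:
  fixes f g h :: "real \<Rightarrow> ennreal"
  assumes [measurable]: "f \<in> borel_measurable borel" "g \<in> borel_measurable borel" "h \<in> borel_measurable borel"
    and fgh: "\<And>x y. f x * g y \<le> (h ((x + y) / 2))\<^sup>2"
  shows "(\<integral>\<^sup>+x. f x \<partial>lborel) * (\<integral>\<^sup>+x. g x \<partial>lborel) \<le> (\<integral>\<^sup>+x. h x \<partial>lborel)\<^sup>2"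
proof -
  define T where "T = (\<lambda>(n::nat) (u::real \<Rightarrow> ennreal) (x::real). if \<bar>x\<bar> \<le> real n then enn2real (min (u x) n) else 0)"
  have eT: "ennreal (T n u x) = (if \<bar>x\<bar> \<le> n then min (u x) n else 0)" for n u x
  proof -
    have "min (u x) (of_nat n) < top_class.top" by (simp add: min_less_iff_disj of_nat_less_top)
    then show ?thesis by (simp add: T_def)
  qed
  have mT[measurable]: "T n u \<in> borel_measurable borel" if [measurable]: "u \<in> borel_measurable borel" for n u
    unfolding T_def by measurable
  have T0: "0 \<le> T n u x" "T n u x \<le> n" for n u x
    by (auto simp: T_def) (metis enn2real_leI min.cobounded2 of_nat_0_le_iff ennreal_of_nat_eq_real_of_nat)
  have lim: "(\<integral>\<^sup>+x. u x \<partial>lborel) = (SUP n. \<integral>\<^sup>+x. ennreal (T n u x) \<partial>lborel)"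
    if [measurable]: "u \<in> borel_measurable borel" for u :: "real \<Rightarrow> ennreal"
  proof -
    have inc: "incseq (\<lambda>n x. ennreal (T n u x))"
      by (auto simp: incseq_def le_fun_def eT min.coboundedI2 intro: order_trans)
    have "(SUP n. ennreal (T n u x)) = u x" for x
    proof (rule antisym)
      show "(SUP n. ennreal (T n u x)) \<le> u x" by (intro SUP_least) (simp add: eT)
      obtain k :: nat where k: "\<bar>x\<bar> \<le> k" using real_arch_simple by blast
      have "u x = min (u x) (SUP n. of_nat n)" by (simp add: ennreal_SUP_of_nat_eq_top)
      also have "\<dots> = (SUP n. min (u x) (of_nat n))" by (simp add: SUP_inf inf_min[symmetric] inf_SUP)
      also have "\<dots> \<le> (SUP n. ennreal (T n u x))"
      proof (rule SUP_mono)
        fix n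
        show "\<exists>m\<in>UNIV. min (u x) (of_nat n) \<le> ennreal (T m u x)"
          using k by (intro bexI[of _ "max n k"]) (auto simp: eT min.coboundedI2 of_nat_max)
      qed
      finally show "u x \<le> (SUP n. ennreal (T n u x))" .
    qed
    then have "(\<integral>\<^sup>+x. u x \<partial>lborel) = (\<integral>\<^sup>+x. (SUP n. ennreal (T n u x)) \<partial>lborel)" by simp
    also have "\<dots> = (SUP n. \<integral>\<^sup>+x. ennreal (T n u x) \<partial>lborel)"
      by (rule nn_integral_monotone_convergence_SUP[OF inc]) measurable
    finally show ?thesis .
  qed
  have fin: "(\<integral>\<^sup>+x. ennreal (T n f x) \<partial>lborel) * (\<integral>\<^sup>+x. ennreal (T n g x) \<partial>lborel) \<le> (\<integral>\<^sup>+x. h x \<partial>lborel)\<^sup>2" for n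
  proof -
    define h' where "h' = (\<lambda>x. enn2real (min (h x) n))"
    have eh: "ennreal (h' x) = min (h x) n" for x
    proof -
      have "min (h x) (of_nat n) < top_class.top" by (simp add: min_less_iff_disj of_nat_less_top)
      then show ?thesis by (simp add: h'_def)
    qed
    have "(\<integral>\<^sup>+x. ennreal (T n f x) \<partial>lborel) * (\<integral>\<^sup>+x. ennreal (T n g x) \<partial>lborel) \<le> (\<integral>\<^sup>+x. ennreal (h' x) \<partial>lborel)\<^sup>2"
    proof (rule prekopa_leindler_bounded[where M=n and K=n])
      show "h' \<in> borel_measurable borel" by (simp add: h'_def)
      fix x y
      have 1: "ennreal (T n f x * T n g y) \<le> min (f x) n * min (g y) n"
        by (auto simp: ennreal_mult T0 eT)
      have 2: "min (f x) n * min (g y) n \<le> of_nat n * of_nat n" by (intro mult_mono) auto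
      have 3: "min (f x) n * min (g y) n \<le> f x * g y" by (intro mult_mono) auto
      have "min (f x) n * min (g y) n \<le> (min (h ((x+y)/2)) n)\<^sup>2"
      proof (cases "h ((x+y)/2) \<le> of_nat n")
        case True
        then show ?thesis using order_trans[OF 3 fgh[of x y]] by (simp only: min_absorb1)
      next
        case False
        then have "min (h ((x+y)/2)) (of_nat n) = of_nat n" by (intro min_absorb2) simp
        then show ?thesis using 2 by (simp only: power2_eq_square)
      qed
      with 1 have "ennreal (T n f x * T n g y) \<le> (min (h ((x+y)/2)) n)\<^sup>2" by (rule order_trans)
      also have "\<dots> = ennreal ((h' ((x+y)/2))\<^sup>2)" 
        by (subst eh[symmetric], subst ennreal_power) (simp_all add: h'_def)
      finally show "T n f x * T n g y \<le> (h' ((x + y) / 2))\<^sup>2" by (simp add: ennreal_le_iff)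
    qed (use T0 in \<open>auto simp: h'_def\<close>, auto simp: T_def)
    also have "\<dots> \<le> (\<integral>\<^sup>+x. h x \<partial>lborel)\<^sup>2"
      by (intro power_mono nn_integral_mono) (auto simp: eh)
    finally show ?thesis .
  qed
  have mono: "(\<integral>\<^sup>+x. ennreal (T n u x) \<partial>lborel) \<le> (\<integral>\<^sup>+x. ennreal (T k u x) \<partial>lborel)" if "n \<le> k" for n k u
    using that by (intro nn_integral_mono) (auto simp: eT min.coboundedI2)
  \<comment> \<open>A product of two suprema runs over pairs of cutoffs; the larger one dominates
    both.\<close>
  have "(\<integral>\<^sup>+x. ennreal (T n f x) \<partial>lborel) * (\<integral>\<^sup>+x. ennreal (T k g x) \<partial>lborel) \<le> (\<integral>\<^sup>+x. h x \<partial>lborel)\<^sup>2" for n k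
  proof -
    have "(\<integral>\<^sup>+x. ennreal (T n f x) \<partial>lborel) * (\<integral>\<^sup>+x. ennreal (T k g x) \<partial>lborel) 
       \<le> (\<integral>\<^sup>+x. ennreal (T (max n k) f x) \<partial>lborel) * (\<integral>\<^sup>+x. ennreal (T (max n k) g x) \<partial>lborel)"
      by (intro mult_mono mono) auto
    also note fin[of "max n k"]
    finally show ?thesis .
  qed
  then show ?thesis
    by (auto simp: lim[of f] lim[of g] SUP_mult_left_ennreal SUP_mult_right_ennreal intro!: SUP_least)
qed

text \<open>Induction on the dimension: by the induction hypothesis, the integrals over the old
  coordinates satisfy the one-dimensional hypothesis in the new one. Points lie in
  \<open>extensional I\<close>, the space carrying the product measure, so the midpoint is
  restricted to \<open>I\<close>.\<close>

theorem prekopa_leindler: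
  fixes f g h :: "('i \<Rightarrow> real) \<Rightarrow> ennreal"
  assumes "finite I"
    and "f \<in> borel_measurable (\<Pi>\<^sub>M i\<in>I. lborel)" "g \<in> borel_measurable (\<Pi>\<^sub>M i\<in>I. lborel)"
      "h \<in> borel_measurable (\<Pi>\<^sub>M i\<in>I. lborel)"
    and "\<And>x y. x \<in> extensional I \<Longrightarrow> y \<in> extensional I \<Longrightarrow> f x * g y \<le> (h (\<lambda>i\<in>I. (x i + y i) / 2))\<^sup>2"
  shows "(\<integral>\<^sup>+x. f x \<partial>(\<Pi>\<^sub>M i\<in>I. lborel)) * (\<integral>\<^sup>+x. g x \<partial>(\<Pi>\<^sub>M i\<in>I. lborel)) \<le> (\<integral>\<^sup>+x. h x \<partial>(\<Pi>\<^sub>M i\<in>I. lborel))\<^sup>2"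
  using assms
proof (induction I arbitrary: f g h)
  case empty
  interpret product_sigma_finite "\<lambda>_::'i. lborel :: real measure" by standard
  show ?case using empty.prems(4)[of "\<lambda>_. undefined" "\<lambda>_. undefined"]
    by (simp add: nn_integral_empty restrict_def)
next
  case (insert i I)
  interpret product_sigma_finite "\<lambda>_::'i. lborel :: real measure" by standard
  note [measurable] = insert.prems(1-3)
  have E: "(\<integral>\<^sup>+x. u x \<partial>(\<Pi>\<^sub>M i\<in>insert i I. lborel)) = (\<integral>\<^sup>+ s. \<integral>\<^sup>+ x. u (x(i := s)) \<partial>(\<Pi>\<^sub>M i\<in>I. lborel) \<partial>lborel)"
    if "u \<in> borel_measurable (\<Pi>\<^sub>M i\<in>insert i I. lborel)" for u :: "('i \<Rightarrow> real) \<Rightarrow> ennreal"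
    using product_nn_integral_insert_rev[OF insert.hyps that] .
  show ?case
    unfolding E[OF insert.prems(1)] E[OF insert.prems(2)] E[OF insert.prems(3)]
  proof (rule prekopa_leindler_real)
    interpret I: finite_product_sigma_finite "\<lambda>_::'i. lborel :: real measure" I
      by standard (fact insert.hyps)
    have m: "(\<lambda>(x::'i \<Rightarrow> real, s::real). u (x(i := s))) \<in> borel_measurable ((\<Pi>\<^sub>M i\<in>I. lborel) \<Otimes>\<^sub>M lborel)"
      if [measurable]: "u \<in> borel_measurable (\<Pi>\<^sub>M i\<in>insert i I. lborel)" for u :: "('i \<Rightarrow> real) \<Rightarrow> ennreal"
      by measurable
    have m2: "(\<lambda>s. \<integral>\<^sup>+ x. u (x(i := s)) \<partial>(\<Pi>\<^sub>M i\<in>I. lborel)) \<in> borel_measurable borel"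
      if [measurable]: "u \<in> borel_measurable (\<Pi>\<^sub>M i\<in>insert i I. lborel)" for u :: "('i \<Rightarrow> real) \<Rightarrow> ennreal"
    proof -
      have "(\<lambda>s. \<integral>\<^sup>+ x. u (x(i := s)) \<partial>(\<Pi>\<^sub>M i\<in>I. lborel)) \<in> borel_measurable lborel" by measurable
      then show ?thesis by simp
    qed
    show "(\<lambda>s. \<integral>\<^sup>+ x. f (x(i := s)) \<partial>(\<Pi>\<^sub>M i\<in>I. lborel)) \<in> borel_measurable borel"
      "(\<lambda>s. \<integral>\<^sup>+ x. g (x(i := s)) \<partial>(\<Pi>\<^sub>M i\<in>I. lborel)) \<in> borel_measurable borel"
      "(\<lambda>s. \<integral>\<^sup>+ x. h (x(i := s)) \<partial>(\<Pi>\<^sub>M i\<in>I. lborel)) \<in> borel_measurable borel"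
      by (rule m2, fact)+
    fix s t :: real
    have m3: "(\<lambda>x::'i \<Rightarrow> real. u (x(i := r))) \<in> borel_measurable (\<Pi>\<^sub>M i\<in>I. lborel)"
      if that: "u \<in> borel_measurable (\<Pi>\<^sub>M i\<in>insert i I. lborel)" for u :: "('i \<Rightarrow> real) \<Rightarrow> ennreal" and r :: real
      by (intro measurable_compose[OF _ that] measurable_fun_upd[where J=I]) auto
    show "(\<integral>\<^sup>+ x. f (x(i := s)) \<partial>(\<Pi>\<^sub>M i\<in>I. lborel)) * (\<integral>\<^sup>+ x. g (x(i := t)) \<partial>(\<Pi>\<^sub>M i\<in>I. lborel))
      \<le> (\<integral>\<^sup>+ x. h (x(i := (s+t)/2)) \<partial>(\<Pi>\<^sub>M i\<in>I. lborel))\<^sup>2"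
    proof (rule insert.IH)
      fix x y :: "'i \<Rightarrow> real" assume xy: "x \<in> extensional I" "y \<in> extensional I"
      have "(\<lambda>j\<in>insert i I. ((x(i:=s)) j + (y(i:=t)) j)/2) = (\<lambda>i\<in>I. (x i + y i) / 2)(i := (s + t) / 2)"
        using insert.hyps by (auto simp: fun_eq_iff)
      moreover have "x(i := s) \<in> extensional (insert i I)" "y(i := t) \<in> extensional (insert i I)"
        using xy by (auto simp: extensional_def)
      ultimately show "f (x(i := s)) * g (y(i := t)) \<le> (h ((\<lambda>i\<in>I. (x i + y i) / 2)(i := (s + t) / 2)))\<^sup>2"
        using insert.prems(4)[of "x(i:=s)" "y(i:=t)"] by (simp only:)
    qed (intro m3 insert.prems)+
  qed
qed

section \<open>Contraction of the loop equations\<close>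

definition forest_length :: "nat list list \<Rightarrow> nat" where
  "forest_length ws = sum_list (map length ws)"

text \<open>With a pure power of \<rho>, the sum over all ways to cut a word in two would leave a
  factor of the length of the word; the quadratic denominators make that sum bounded.\<close>

definition forest_weight :: "real \<Rightarrow> nat list list \<Rightarrow> real" where
  "forest_weight \<rho> ws = prod_list (map (\<lambda>w. \<rho> ^ length w / (real (length w) + 1)\<^sup>2) ws)"

definition occurrences :: "nat \<Rightarrow> nat list \<Rightarrow> nat set" where
  "occurrences i w = {k. k < length w \<and> w ! k = i}"

text \<open>A word \<open>p @ [i] @ r\<close> with marked letter \<open>i\<close> at position \<open>k\<close> becomes \<open>r @ p\<close>, the
  derivative of its trace with respect to that letter.\<close>

definition rotate_out :: "nat \<Rightarrow> nat list \<Rightarrow> nat list" where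
  "rotate_out k w = drop (Suc k) w @ take k w"

text \<open>A forest is a list of words, standing for a product of normalized traces. The loop
  equation of the matrix model is \<open>\<phi> = loop_main \<phi> + N\<^sup>-\<^sup>2 loop_merge \<phi>\<close>, exact at finite \<open>N\<close> and linear in \<open>\<phi>\<close>.\<close>

definition loop_main :: "nat \<Rightarrow> (nat \<Rightarrow> nat list) \<Rightarrow> (nat \<Rightarrow> complex) \<Rightarrow> (nat list list \<Rightarrow> complex) \<Rightarrow>
    nat \<Rightarrow> nat list \<Rightarrow> nat list list \<Rightarrow> complex" where
  "loop_main n q t \<phi> i w vs =
     (\<Sum>k\<in>occurrences i w. \<phi> (take k w # drop (Suc k) w # vs)) -
     (\<Sum>j=1..n. t j * (\<Sum>k\<in>occurrences i (q j). \<phi> ((w @ rotate_out k (q j)) # vs)))"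

text \<open>The terms in which the derivative hits another trace of the product, so that two traces
  fuse into one. In comparison with the splitting terms two traces are lost, whence the factor
  \<open>N\<^sup>-\<^sup>2\<close>.\<close>

definition loop_merge :: "(nat list list \<Rightarrow> complex) \<Rightarrow> nat \<Rightarrow> nat list \<Rightarrow> nat list list \<Rightarrow> complex" where
  "loop_merge \<phi> i w vs =
     (\<Sum>j<length vs. \<Sum>k\<in>occurrences i (vs ! j). \<phi> ((w @ rotate_out k (vs ! j)) # take j vs @ drop (Suc j) vs))"

definition forests :: "nat set \<Rightarrow> nat list list set" where
  "forests A = lists (lists A)"

lemma forest_length_simps [simp]:
  "forest_length [] = 0" "forest_length (w # ws) = length w + forest_length ws"
  "forest_length (vs @ ws) = forest_length vs + forest_length ws"
  by (auto simp: forest_length_def)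

lemma forest_weight_simps:
  "forest_weight \<rho> [] = 1"
  "forest_weight \<rho> (w # ws) = \<rho> ^ length w / (real (length w) + 1)\<^sup>2 * forest_weight \<rho> ws"
  by (auto simp: forest_weight_def)

lemma forest_weight_nonneg: "0 \<le> \<rho> \<Longrightarrow> 0 \<le> forest_weight \<rho> ws"
  by (induction ws) (auto simp: forest_weight_simps)

lemma forest_weight_mono: "0 \<le> \<rho> \<Longrightarrow> \<rho> \<le> \<sigma> \<Longrightarrow> forest_weight \<rho> ws \<le> forest_weight \<sigma> ws"
  by (induction ws) (auto simp: forest_weight_simps intro!: mult_mono divide_right_mono power_mono forest_weight_nonneg)

lemma forest_weight_le_power: "0 \<le> \<rho> \<Longrightarrow> forest_weight \<rho> ws \<le> \<rho> ^ forest_length ws"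
proof (induction ws)
  case (Cons w ws)
  have "\<rho> ^ length w / (real (length w) + 1)\<^sup>2 \<le> \<rho> ^ length w / 1"
    using Cons by (intro divide_left_mono) (auto intro: one_le_power)
  then show ?case using Cons
    by (simp add: forest_weight_simps power_add del: times_divide_eq_left times_divide_eq_right) (intro mult_mono forest_weight_nonneg; simp)
qed (auto simp: forest_weight_simps)

lemma Suc_le_two_power: "real k + 1 \<le> 2 ^ k"
  by (induction k) auto

text \<open>The denominators are at most \<open>4 ^ length w\<close>, so a base four times larger
  pays for them.\<close>

lemma power_le_forest_weight: "0 \<le> \<rho> \<Longrightarrow> \<rho> ^ forest_length ws \<le> forest_weight (4 * \<rho>) ws"
proof (induction ws)
  case (Cons w ws)
  have "(real (length w) + 1)\<^sup>2 \<le> (2 ^ length w)\<^sup>2" by (intro power_mono Suc_le_two_power) auto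
  also have "\<dots> = 4 ^ length w" by (simp add: power_mult[symmetric] power2_eq_square flip: power_mult_distrib)
  finally have "\<rho> ^ length w * (real (length w) + 1)\<^sup>2 \<le> \<rho> ^ length w * 4 ^ length w"
    using Cons by (intro mult_left_mono) auto
  then have "\<rho> ^ length w \<le> (4 * \<rho>) ^ length w / (real (length w) + 1)\<^sup>2"
    by (subst pos_le_divide_eq) (auto simp: power_mult_distrib mult_ac)
  then show ?case using Cons
    by (simp add: forest_weight_simps power_add del: times_divide_eq_left times_divide_eq_right) (intro mult_mono forest_weight_nonneg; simp)
qed (auto simp: forest_weight_simps)

lemma finite_occurrences [simp]: "finite (occurrences i w)"
  by (auto simp: occurrences_def)

lemma card_occurrences: "card (occurrences i w) \<le> length w"
proof -
  have "occurrences i w \<subseteq> {..<length w}" by (auto simp: occurrences_def)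
  then show ?thesis using card_mono[of "{..<length w}"] by fastforce
qed

lemma length_rotate_out: "k \<in> occurrences i w \<Longrightarrow> Suc (length (rotate_out k w)) = length w"
  by (auto simp: occurrences_def rotate_out_def)

lemma forests_simps [simp]:
  "[] \<in> forests A" "w # ws \<in> forests A \<longleftrightarrow> w \<in> lists A \<and> ws \<in> forests A"
  "vs @ ws \<in> forests A \<longleftrightarrow> vs \<in> forests A \<and> ws \<in> forests A"
  by (auto simp: forests_def)

lemma lists_take_drop: "w \<in> lists A \<Longrightarrow> take k w \<in> lists A \<and> drop k w \<in> lists A"
  by (auto dest: in_set_takeD in_set_dropD)

lemma forests_take_drop: "ws \<in> forests A \<Longrightarrow> take k ws \<in> forests A \<and> drop k ws \<in> forests A"
  unfolding forests_def by (rule lists_take_drop)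

lemma rotate_out_lists: "w \<in> lists A \<Longrightarrow> rotate_out k w \<in> lists A"
  using lists_take_drop[of w A k] lists_take_drop[of w A "Suc k"] by (simp add: rotate_out_def)

lemma sum_inverse_squares_le: "(\<Sum>k<n. 1 / (real k + 1)\<^sup>2) \<le> 2"
proof (cases n)
  case (Suc m)
  \<comment> \<open>Strengthened to a telescoping bound for the induction.\<close>
  have "(\<Sum>k<Suc m. 1 / (real k + 1)\<^sup>2) \<le> 2 - 1 / (real m + 1)"
  proof (induction m)
    case (Suc m)
    have "1 / (real m + 2)\<^sup>2 \<le> 1 / (real m + 1) - 1 / (real m + 2)"
      by (simp add: divide_simps power2_eq_square)
    then show ?case using Suc by (simp add: add.commute)
  qed simp
  then show ?thesis using Suc by (smt (verit) divide_nonneg_nonneg of_nat_0_le_iff)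
qed simp

text \<open>The weights \<open>1 / (k + 1)\<^sup>2\<close> are stable under convolution, which makes the splitting
  part of the loop equation a contraction.\<close>

lemma inverse_square_convolution:
  "(\<Sum>k<n. 1 / (real k + 1)\<^sup>2 * (1 / (real (n - Suc k) + 1)\<^sup>2)) \<le> 32 / (real n + 2)\<^sup>2"
proof -
  \<comment> \<open>With \<open>a = k + 1\<close> and \<open>b = n - k\<close>, the estimate
    \<open>(a + b)\<^sup>2 \<le> 2 * (a\<^sup>2 + b\<^sup>2)\<close> turns the product of inverse
    squares into a sum of them, divided by \<open>(n + 1)\<^sup>2\<close>.\<close>
  have "(\<Sum>k<n. 1 / (real k + 1)\<^sup>2 * (1 / (real (n - Suc k) + 1)\<^sup>2))
      \<le> (\<Sum>k<n. 2 / (real n + 1)\<^sup>2 * (1 / (real k + 1)\<^sup>2 + 1 / (real (n - Suc k) + 1)\<^sup>2))"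
  proof (rule sum_mono)
    fix k assume "k \<in> {..<n}"
    define a b where "a = real k + 1" and "b = real (n - Suc k) + 1"
    have ab: "a > 0" "b > 0" "a + b = real n + 1" using \<open>k \<in> _\<close> by (auto simp: a_def b_def of_nat_diff)
    have "(a + b)\<^sup>2 \<le> 2 * (a\<^sup>2 + b\<^sup>2)" using sum_squares_bound[of a b] by (simp add: power2_eq_square algebra_simps)
    then have "(a + b)\<^sup>2 / (a\<^sup>2 * b\<^sup>2 * (a + b)\<^sup>2) \<le> 2 * (a\<^sup>2 + b\<^sup>2) / (a\<^sup>2 * b\<^sup>2 * (a + b)\<^sup>2)"
      by (rule divide_right_mono) auto
    moreover have "(a + b)\<^sup>2 / (a\<^sup>2 * b\<^sup>2 * (a + b)\<^sup>2) = 1 / a\<^sup>2 * (1 / b\<^sup>2)" using ab by simp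
    moreover have "2 * (a\<^sup>2 + b\<^sup>2) / (a\<^sup>2 * b\<^sup>2 * (a + b)\<^sup>2) = 2 / (a + b)\<^sup>2 * (1 / a\<^sup>2 + 1 / b\<^sup>2)"
    proof -
      have "1 / a\<^sup>2 + 1 / b\<^sup>2 = (a\<^sup>2 + b\<^sup>2) / (a\<^sup>2 * b\<^sup>2)" using ab by (simp add: field_simps)
      then show ?thesis by simp
    qed
    ultimately have "1 / a\<^sup>2 * (1 / b\<^sup>2) \<le> 2 / (a + b)\<^sup>2 * (1 / a\<^sup>2 + 1 / b\<^sup>2)" by simp
    then show "1 / (real k + 1)\<^sup>2 * (1 / (real (n - Suc k) + 1)\<^sup>2) \<le> 2 / (real n + 1)\<^sup>2 * (1 / (real k + 1)\<^sup>2 + 1 / (real (n - Suc k) + 1)\<^sup>2)"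
      unfolding ab(3) by (simp add: a_def b_def)
  qed
  also have "\<dots> = 2 / (real n + 1)\<^sup>2 * ((\<Sum>k<n. 1 / (real k + 1)\<^sup>2) + (\<Sum>k<n. 1 / (real (n - Suc k) + 1)\<^sup>2))"
    unfolding sum.distrib[symmetric] sum_distrib_left ..
  also have "(\<Sum>k<n. 1 / (real (n - Suc k) + 1)\<^sup>2) = (\<Sum>k<n. 1 / (real k + 1)\<^sup>2)"
    by (rule sum.nat_diff_reindex[of "\<lambda>k. 1 / (real k + 1)\<^sup>2"])
  also have "2 / (real n + 1)\<^sup>2 * ((\<Sum>k<n. 1 / (real k + 1)\<^sup>2) + (\<Sum>k<n. 1 / (real k + 1)\<^sup>2)) \<le> 2 / (real n + 1)\<^sup>2 * (2 + 2)"
    by (intro mult_left_mono add_mono sum_inverse_squares_le) auto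
  also have "\<dots> \<le> 32 / (real n + 2)\<^sup>2"
  proof -
    have "(real n + 2)\<^sup>2 \<le> (2 * (real n + 1))\<^sup>2" by (intro power_mono) auto
    then have "(real n + 2)\<^sup>2 \<le> 4 * (real n + 1)\<^sup>2" by (simp only: power_mult_distrib) simp
    then show ?thesis by (simp add: divide_simps)
  qed
  finally show ?thesis .
qed

text \<open>Each half of \<open>loop_main\<close> contributes \<open>B / 4\<close>. Splitting loses
  two letters, which gains \<open>\<rho>\<^sup>2\<close>, at least 128, against the convolution
  constant 32. The potential has at most \<open>n * d\<close> terms, each lengthening the word;
  \<eta> pays for them, for the factor \<open>\<rho> ^ d\<close> and for a factor 4 from comparing
  denominators. The hypothesis on \<phi> reaches \<open>d\<close> beyond the length of the forest:
  this is the length used up by one iteration.\<close>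

lemma norm_loop_main_le:
  fixes \<phi> :: "nat list list \<Rightarrow> complex"
  assumes \<rho>: "128 \<le> \<rho>\<^sup>2" "1 \<le> \<rho>" and small: "16 * real n * real d * \<eta> * \<rho> ^ d \<le> 1" and \<eta>: "0 \<le> \<eta>"
    and t: "\<And>j. j \<in> {1..n} \<Longrightarrow> cmod (t j) \<le> \<eta>" and q: "\<And>j. j \<in> {1..n} \<Longrightarrow> q j \<in> lists A \<and> length (q j) \<le> d"
    and B: "0 \<le> B"
    and \<phi>: "\<And>ws. ws \<in> forests A \<Longrightarrow> forest_length ws \<le> forest_length ((i # w) # vs) + d \<Longrightarrow> cmod (\<phi> ws) \<le> B * forest_weight \<rho> ws"
    and F: "(i # w) # vs \<in> forests A"
  shows "cmod (loop_main n q t \<phi> i w vs) \<le> B / 2 * forest_weight \<rho> ((i # w) # vs)"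
proof -
  define W where "W = forest_weight \<rho> vs"
  have W: "W \<ge> 0" using \<rho> by (simp add: W_def forest_weight_nonneg)
  define l where "l = length w"
  define Z where "Z = forest_weight \<rho> ((i # w) # vs)"
  have Z: "Z = \<rho> ^ (l+1) / (real l + 2)\<^sup>2 * W" by (simp add: Z_def forest_weight_simps W_def l_def add.commute)
  have Z0: "Z \<ge> 0" using \<rho> by (simp add: Z_def forest_weight_nonneg)
  have "cmod (\<Sum>k\<in>occurrences i w. \<phi> (take k w # drop (Suc k) w # vs))
      \<le> (\<Sum>k\<in>occurrences i w. B * (\<rho> ^ (l - 1) * W) * (1 / (real k + 1)\<^sup>2 * (1 / (real (l - Suc k) + 1)\<^sup>2)))"
  proof (rule sum_norm_le)
    fix k assume k: "k \<in> occurrences i w"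
    then have kl: "k < l" by (auto simp: occurrences_def l_def)
    have "cmod (\<phi> (take k w # drop (Suc k) w # vs)) \<le> B * forest_weight \<rho> (take k w # drop (Suc k) w # vs)"
      using F kl lists_take_drop[of w A] by (intro \<phi>) (auto simp: l_def)
    also have "forest_weight \<rho> (take k w # drop (Suc k) w # vs) = \<rho> ^ k * \<rho> ^ (l - Suc k) * W * (1 / (real k + 1)\<^sup>2 * (1 / (real (l - Suc k) + 1)\<^sup>2))"
      using kl by (simp add: forest_weight_simps W_def l_def)
    also have "\<rho> ^ k * \<rho> ^ (l - Suc k) = \<rho> ^ (l - 1)" using kl by (simp flip: power_add)
    finally show "cmod (\<phi> (take k w # drop (Suc k) w # vs)) \<le> B * (\<rho> ^ (l - 1) * W) * (1 / (real k + 1)\<^sup>2 * (1 / (real (l - Suc k) + 1)\<^sup>2))"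
      by (simp add: mult.assoc)
  qed
  also have "\<dots> \<le> (\<Sum>k<l. B * (\<rho> ^ (l - 1) * W) * (1 / (real k + 1)\<^sup>2 * (1 / (real (l - Suc k) + 1)\<^sup>2)))"
    using B W \<rho> by (intro sum_mono2) (auto simp: occurrences_def l_def)
  also have "\<dots> = B * (\<rho> ^ (l - 1) * W) * (\<Sum>k<l. 1 / (real k + 1)\<^sup>2 * (1 / (real (l - Suc k) + 1)\<^sup>2))"
    by (simp only: sum_distrib_left)
  also have "\<dots> \<le> B * Z / 4"
  proof (cases "l = 0")
    case True
    then show ?thesis using B Z0 by simp
  next
    case False
    have "B * (\<rho> ^ (l - 1) * W) * (\<Sum>k<l. 1 / (real k + 1)\<^sup>2 * (1 / (real (l - Suc k) + 1)\<^sup>2)) \<le> B * (\<rho> ^ (l - 1) * W) * (32 / (real l + 2)\<^sup>2)"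
      using B W \<rho> by (intro mult_left_mono inverse_square_convolution) auto
    also have "\<dots> = B * (32 * \<rho> ^ (l - 1)) * (W / (real l + 2)\<^sup>2)" by simp
    also have "\<dots> \<le> B * (\<rho> ^ (l + 1) / 4) * (W / (real l + 2)\<^sup>2)"
    proof -
      have "\<rho> ^ (l + 1) = \<rho>\<^sup>2 * \<rho> ^ (l - 1)" using False by (simp add: power_add[symmetric])
      then have "32 * \<rho> ^ (l - 1) \<le> \<rho> ^ (l + 1) / 4" using mult_right_mono[OF \<rho>(1), of "\<rho> ^ (l - 1)"] \<rho>(2) by simp
      then show ?thesis using B W by (intro mult_right_mono mult_left_mono) auto
    qed
    finally show ?thesis by (simp add: Z)
  qed
  finally have 1: "cmod (\<Sum>k\<in>occurrences i w. \<phi> (take k w # drop (Suc k) w # vs)) \<le> B * Z / 4" .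
  have "cmod (\<Sum>j=1..n. t j * (\<Sum>k\<in>occurrences i (q j). \<phi> ((w @ rotate_out k (q j)) # vs))) \<le> (\<Sum>j=1..n. \<eta> * (real d * (B * (4 * \<rho> ^ d * Z))))"
  proof (rule sum_norm_le)
    fix j assume j: "j \<in> {1..n}"
    have "cmod (\<Sum>k\<in>occurrences i (q j). \<phi> ((w @ rotate_out k (q j)) # vs)) \<le> (\<Sum>k\<in>occurrences i (q j). B * (4 * \<rho> ^ d * Z))"
    proof (rule sum_norm_le)
      fix k assume k: "k \<in> occurrences i (q j)"
      define r where "r = length (rotate_out k (q j))"
      have r: "r + 1 \<le> d" using length_rotate_out[OF k] q[OF j] by (simp add: r_def)
      have "cmod (\<phi> ((w @ rotate_out k (q j)) # vs)) \<le> B * forest_weight \<rho> ((w @ rotate_out k (q j)) # vs)"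
        using F r q[OF j] rotate_out_lists[of "q j" A k] by (intro \<phi>) (auto simp: r_def)
      also have "forest_weight \<rho> ((w @ rotate_out k (q j)) # vs) = \<rho> ^ (l + r) / (real (l + r) + 1)\<^sup>2 * W"
        by (simp add: forest_weight_simps W_def l_def r_def)
      also have "\<dots> \<le> (4 * \<rho> ^ d * (\<rho> ^ (l + 1) / (real l + 2)\<^sup>2)) * W"
      proof (rule mult_right_mono[OF _ W])
        have "(real l + 2)\<^sup>2 \<le> (2 * (real (l + r) + 1))\<^sup>2" by (intro power_mono) auto
        then have "(real l + 2)\<^sup>2 \<le> 4 * (real (l + r) + 1)\<^sup>2" by (simp only: power_mult_distrib) simp
        then have "1 / (real (l + r) + 1)\<^sup>2 \<le> 4 / (real l + 2)\<^sup>2" by (simp add: divide_simps)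
        moreover have "\<rho> ^ (l + r) \<le> \<rho> ^ (d + (l + 1))" using \<rho> r by (intro power_increasing) auto
        ultimately have "\<rho> ^ (l + r) * (1 / (real (l + r) + 1)\<^sup>2) \<le> \<rho> ^ (d + (l + 1)) * (4 / (real l + 2)\<^sup>2)"
          using \<rho> by (intro mult_mono) auto
        then show "\<rho> ^ (l + r) / (real (l + r) + 1)\<^sup>2 \<le> 4 * \<rho> ^ d * (\<rho> ^ (l + 1) / (real l + 2)\<^sup>2)"
          by (simp add: power_add mult_ac)
      qed
      also have "\<dots> = 4 * \<rho> ^ d * Z" by (simp add: Z)
      finally show "cmod (\<phi> ((w @ rotate_out k (q j)) # vs)) \<le> B * (4 * \<rho> ^ d * Z)" using B by (simp add: mult_left_mono)
    qed
    also have "\<dots> = real (card (occurrences i (q j))) * (B * (4 * \<rho> ^ d * Z))" by simp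
    also have "\<dots> \<le> real d * (B * (4 * \<rho> ^ d * Z))"
      using card_occurrences[of i "q j"] q[OF j] B Z0 \<rho> by (intro mult_right_mono) auto
    finally show "cmod (t j * (\<Sum>k\<in>occurrences i (q j). \<phi> ((w @ rotate_out k (q j)) # vs))) \<le> \<eta> * (real d * (B * (4 * \<rho> ^ d * Z)))"
      unfolding norm_mult using t[OF j] \<eta> by (intro mult_mono) auto
  qed
  also have "\<dots> = (16 * real n * real d * \<eta> * \<rho> ^ d) * (B * Z / 4)" by simp
  also have "\<dots> \<le> 1 * (B * Z / 4)" using B Z0 by (intro mult_right_mono small) auto
  finally have 2: "cmod (\<Sum>j=1..n. t j * (\<Sum>k\<in>occurrences i (q j). \<phi> ((w @ rotate_out k (q j)) # vs))) \<le> B * Z / 4" by simp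
  show ?thesis unfolding loop_main_def Z_def[symmetric]
    by (rule order_trans[OF norm_triangle_ineq4]) (use 1 2 in simp)
qed

text \<open>The number of terms is at most the total length, hence at most \<open>2 ^ L\<close>;
  converting the powers back into weights costs another factor 4. This is why the base grows from
  \<rho> to \<open>8 * \<rho>\<close>.\<close>

lemma norm_loop_merge_le:
  fixes \<phi> :: "nat list list \<Rightarrow> complex"
  assumes \<rho>: "1 \<le> \<rho>" and B: "0 \<le> B"
    and \<phi>: "\<And>ws. ws \<in> forests A \<Longrightarrow> forest_length ws \<le> forest_length ((i # w) # vs) \<Longrightarrow> cmod (\<phi> ws) \<le> B * \<rho> ^ forest_length ws"
    and F: "(i # w) # vs \<in> forests A"
  shows "cmod (loop_merge \<phi> i w vs) \<le> B * forest_weight (8 * \<rho>) ((i # w) # vs)"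
proof -
  define L where "L = forest_length ((i # w) # vs)"
  have "cmod (loop_merge \<phi> i w vs) \<le> (\<Sum>j<length vs. real (length (vs ! j)) * (B * \<rho> ^ L))"
    unfolding loop_merge_def
  proof (rule sum_norm_le)
    fix j assume j: "j \<in> {..<length vs}"
    have split: "vs = take j vs @ vs ! j # drop (Suc j) vs" using j by (simp add: id_take_nth_drop)
    have fl: "forest_length vs = forest_length (take j vs) + length (vs ! j) + forest_length (drop (Suc j) vs)"
      by (subst split) simp
    have vsj: "vs ! j \<in> lists A" using F j by (auto simp: forests_def in_lists_conv_set)
    have "cmod (\<Sum>k\<in>occurrences i (vs ! j). \<phi> ((w @ rotate_out k (vs ! j)) # take j vs @ drop (Suc j) vs)) \<le> (\<Sum>k\<in>occurrences i (vs ! j). B * \<rho> ^ L)"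
    proof (rule sum_norm_le)
      fix k assume k: "k \<in> occurrences i (vs ! j)"
      define u where "u = (w @ rotate_out k (vs ! j)) # take j vs @ drop (Suc j) vs"
      have "forest_length u \<le> L" using length_rotate_out[OF k] by (simp add: u_def L_def fl)
      moreover have "u \<in> forests A" using F rotate_out_lists[OF vsj] forests_take_drop[of vs A] by (simp add: u_def)
      ultimately have "cmod (\<phi> u) \<le> B * \<rho> ^ forest_length u" by (intro \<phi>) (auto simp: L_def)
      also have "\<dots> \<le> B * \<rho> ^ L" using \<open>forest_length u \<le> L\<close> B \<rho> by (intro mult_left_mono power_increasing) auto
      finally show "cmod (\<phi> ((w @ rotate_out k (vs ! j)) # take j vs @ drop (Suc j) vs)) \<le> B * \<rho> ^ L" by (simp add: u_def)
    qed
    also have "\<dots> \<le> real (length (vs ! j)) * (B * \<rho> ^ L)"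
      using card_occurrences[of i "vs ! j"] B \<rho> by (auto intro!: mult_right_mono)
    finally show "cmod (\<Sum>k\<in>occurrences i (vs ! j). \<phi> ((w @ rotate_out k (vs ! j)) # take j vs @ drop (Suc j) vs)) \<le> real (length (vs ! j)) * (B * \<rho> ^ L)" .
  qed
  also have "\<dots> = real (forest_length vs) * (B * \<rho> ^ L)"
    by (simp add: forest_length_def sum_list_sum_nth atLeast0LessThan sum_distrib_right)
  also have "\<dots> \<le> 2 ^ L * (B * \<rho> ^ L)"
  proof -
    have "real (forest_length vs) \<le> 2 ^ L" using Suc_le_two_power[of L] by (simp add: L_def)
    then show ?thesis using B \<rho> by (intro mult_right_mono) auto
  qed
  also have "\<dots> = B * (2 * \<rho>) ^ L" by (simp add: power_mult_distrib)
  also have "\<dots> \<le> B * forest_weight (4 * (2 * \<rho>)) ((i # w) # vs)"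
    unfolding L_def using B \<rho> by (intro mult_left_mono power_le_forest_weight) auto
  finally show ?thesis by simp
qed

lemma loop_main_diff: "loop_main n q t (\<lambda>ws. \<phi> ws - \<psi> ws) i w vs = loop_main n q t \<phi> i w vs - loop_main n q t \<psi> i w vs"
  by (simp add: loop_main_def sum_subtractf right_diff_distrib)

lemma loop_main_scale: "loop_main n q t (\<lambda>ws. a * \<phi> ws) i w vs = a * loop_main n q t \<phi> i w vs"
  by (simp add: loop_main_def sum_distrib_left right_diff_distrib mult.left_commute)

lemma loop_merge_diff: "loop_merge (\<lambda>ws. \<phi> ws - \<psi> ws) i w vs = loop_merge \<phi> i w vs - loop_merge \<psi> i w vs"
  by (simp add: loop_merge_def sum_subtractf)

text \<open>The base of the weight is raised by a factor 8 twice, starting from an a priori bound in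
  powers of \<open>R\<close>. Smallness is imposed at the largest base \<open>64 * R\<close>; the
  bound \<open>2 \<le> R\<close> makes the smallest base \<open>8 * R\<close> large enough for the
  splitting terms.\<close>

locale loop_contraction =
  fixes n d :: nat and q :: "nat \<Rightarrow> nat list" and t :: "nat \<Rightarrow> complex" and A :: "nat set" and \<eta> R :: real
  assumes R: "2 \<le> R" and d: "1 \<le> d" and \<eta>: "0 \<le> \<eta>"
    and small: "16 * real n * real d * \<eta> * (64 * R) ^ d \<le> 1"
    and t: "\<And>j. j \<in> {1..n} \<Longrightarrow> cmod (t j) \<le> \<eta>"
    and q: "\<And>j. j \<in> {1..n} \<Longrightarrow> q j \<in> lists A \<and> length (q j) \<le> d"
begin

lemma loop_main_contraction:
  assumes "8 * R \<le> \<rho>" "\<rho> \<le> 64 * R" "0 \<le> B"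
    and "\<And>ws. ws \<in> forests A \<Longrightarrow> forest_length ws \<le> forest_length ((i # w) # vs) + d \<Longrightarrow> cmod (\<phi> ws) \<le> B * forest_weight \<rho> ws"
    and "(i # w) # vs \<in> forests A"
  shows "cmod (loop_main n q t \<phi> i w vs) \<le> B / 2 * forest_weight \<rho> ((i # w) # vs)"
proof (rule norm_loop_main_le[OF _ _ _ \<eta> t q assms(3-5)])
  have \<rho>: "16 \<le> \<rho>" using R assms by simp
  then have "16\<^sup>2 \<le> \<rho>\<^sup>2" by (intro power_mono) auto
  then show "128 \<le> \<rho>\<^sup>2" "1 \<le> \<rho>" using \<rho> by auto
  have "16 * real n * real d * \<eta> * \<rho> ^ d \<le> 16 * real n * real d * \<eta> * (64 * R) ^ d"
    using assms \<rho> \<eta> by (intro mult_left_mono power_mono) auto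
  then show "16 * real n * real d * \<eta> * \<rho> ^ d \<le> 1" using small by simp
qed

text \<open>Each of the \<open>k\<close> rounds halves \<open>B\<close> and uses up \<open>d\<close>
  of the admissible length \<open>L\<close>, while the errors form a geometric series with sum at
  most \<open>2 * \<epsilon>\<close>. The inner induction over the forest discards empty words until
  there is a first letter to which the equation applies.\<close>

lemma approximate_solution_bound:
  assumes \<rho>: "8 * R \<le> \<rho>" "\<rho> \<le> 64 * R" and B: "0 \<le> B" and \<epsilon>: "0 \<le> \<epsilon>"
    and nil: "\<psi> [] = 0" "\<And>ws. \<psi> ([] # ws) = \<psi> ws"
    and bound: "\<And>ws. ws \<in> forests A \<Longrightarrow> forest_length ws \<le> L \<Longrightarrow> cmod (\<psi> ws) \<le> B * forest_weight \<rho> ws"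
    and eq: "\<And>i w vs. (i # w) # vs \<in> forests A \<Longrightarrow> forest_length ((i # w) # vs) \<le> L \<Longrightarrow>
      cmod (\<psi> ((i # w) # vs) - loop_main n q t \<psi> i w vs) \<le> \<epsilon> * forest_weight \<rho> ((i # w) # vs)"
    and ws: "ws \<in> forests A" "forest_length ws + k * d \<le> L"
  shows "cmod (\<psi> ws) \<le> (2 * \<epsilon> + B / 2 ^ k) * forest_weight \<rho> ws"
  using ws
proof (induction k arbitrary: ws)
  case 0
  have "cmod (\<psi> ws) \<le> B * forest_weight \<rho> ws" using bound 0 by simp
  also have "\<dots> \<le> (2 * \<epsilon> + B / 2 ^ 0) * forest_weight \<rho> ws"
    using \<epsilon> \<rho> R by (intro mult_right_mono forest_weight_nonneg) auto
  finally show ?case .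
next
  case (Suc k)
  define B' where "B' = 2 * \<epsilon> + B / 2 ^ k"
  have B': "0 \<le> B'" using B \<epsilon> by (simp add: B'_def)
  show ?case using Suc.prems
  proof (induction ws)
    case Nil
    then show ?case using nil B \<epsilon> by (simp add: forest_weight_simps)
  next
    case (Cons w vs)
    show ?case
    proof (cases w)
      case Nil
      then show ?thesis using Cons by (simp add: nil forest_weight_simps)
    next
      case [simp]: (Cons i u)
      have "cmod (loop_main n q t \<psi> i u vs) \<le> B' / 2 * forest_weight \<rho> ((i # u) # vs)"
        using Cons.prems Suc.IH by (intro loop_main_contraction \<rho> B') (auto simp: B'_def)
      moreover have "cmod (\<psi> ((i # u) # vs) - loop_main n q t \<psi> i u vs) \<le> \<epsilon> * forest_weight \<rho> ((i # u) # vs)"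
        using Cons.prems by (intro eq) auto
      moreover have "cmod (\<psi> ((i # u) # vs)) \<le> cmod (\<psi> ((i # u) # vs) - loop_main n q t \<psi> i u vs) + cmod (loop_main n q t \<psi> i u vs)"
        by (metis diff_add_cancel norm_triangle_ineq)
      ultimately have "cmod (\<psi> ((i # u) # vs)) \<le> (\<epsilon> + B' / 2) * forest_weight \<rho> ((i # u) # vs)"
        by (simp add: distrib_right)
      also have "\<epsilon> + B' / 2 = 2 * \<epsilon> + B / 2 ^ Suc k" by (simp add: B'_def field_simps)
      finally show ?thesis by simp
    qed
  qed
qed

text \<open>The number of iterations available at size \<open>N\<close> is a fixed fraction of
  \<open>N\<close>, so the geometric gain beats the factor \<open>N\<^sup>2\<close> of the rescaled
  correction.\<close>

lemma square_le_two_power: "(real N)\<^sup>2 / 2 ^ (N div (2 * d)) \<le> 16 * (real d)\<^sup>2"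
proof -
  define k where "k = N div (2 * d)"
  have sq: "(real k + 1)\<^sup>2 \<le> 4 * 2 ^ k" for k :: nat
  proof (induction k rule: less_induct)
    case (less k)
    show ?case
    proof (cases "k \<le> 2")
      case True
      then consider "k = 0" | "k = 1" | "k = 2" by linarith
      then show ?thesis by cases auto
    next
      case False
      then obtain j where j: "k = Suc j" "2 \<le> j" by (cases k) auto
      have "(real k + 1)\<^sup>2 \<le> 2 * (real j + 1)\<^sup>2"
      proof -
        have "2 * 2 \<le> real j * real j" using j by (intro mult_mono) auto
        then show ?thesis using j by (simp add: power2_eq_square algebra_simps)
      qed
      also have "\<dots> \<le> 2 * (4 * 2 ^ j)" using less j by (intro mult_left_mono) auto
      finally show ?thesis using j by simp
    qed
  qed
  have "N = (2 * d) * k + N mod (2 * d)" by (simp add: k_def)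
  also have "\<dots> \<le> (2 * d) * k + 2 * d" using d by (intro add_left_mono less_imp_le mod_less_divisor) auto
  finally have "real N \<le> real ((2 * d) * k + 2 * d)" by (simp only: of_nat_le_iff)
  then have "real N \<le> 2 * real d * (real k + 1)" by (simp add: algebra_simps)
  then have "(real N)\<^sup>2 \<le> (2 * real d * (real k + 1))\<^sup>2" by (intro power_mono) auto
  also have "\<dots> \<le> (2 * real d)\<^sup>2 * (4 * 2 ^ k)" unfolding power_mult_distrib[of "2 * real d"] by (intro mult_left_mono sq) auto
  finally show ?thesis by (simp add: k_def[symmetric] divide_simps power_mult_distrib)
qed


text \<open>The second conclusion is uniform in \<open>N\<close>, with a constant that depends on
  the coefficients only through the parameters of the locale. It is what later permits dominated
  convergence in the interpolation parameter.\<close>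

lemma expansion:
  fixes \<phi> :: "nat \<Rightarrow> nat list list \<Rightarrow> complex"
  assumes nil: "\<And>N. 1 \<le> N \<Longrightarrow> \<phi> N [] = 1" "\<And>N ws. 1 \<le> N \<Longrightarrow> \<phi> N ([] # ws) = \<phi> N ws"
    and bound: "\<And>N ws. 1 \<le> N \<Longrightarrow> ws \<in> forests A \<Longrightarrow> forest_length ws \<le> N \<Longrightarrow> cmod (\<phi> N ws) \<le> R ^ forest_length ws"
    and eq: "\<And>N i w vs. 1 \<le> N \<Longrightarrow> (i # w) # vs \<in> forests A \<Longrightarrow>
      \<phi> N ((i # w) # vs) = loop_main n q t (\<phi> N) i w vs + loop_merge (\<phi> N) i w vs / (of_nat N)\<^sup>2"
  obtains \<phi>0 \<phi>1 where
    "\<And>ws. ws \<in> forests A \<Longrightarrow> (\<lambda>N. (of_nat N)\<^sup>2 * (\<phi> N ws - \<phi>0 ws)) \<longlonglongrightarrow> \<phi>1 ws"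
    "\<And>N ws. 1 \<le> N \<Longrightarrow> ws \<in> forests A \<Longrightarrow> 2 * forest_length ws \<le> N \<Longrightarrow>
      cmod ((of_nat N)\<^sup>2 * (\<phi> N ws - \<phi>0 ws)) \<le> (2 + 32 * (real d)\<^sup>2) * forest_weight (8 * R) ws"
proof -
  have wt: "R ^ forest_length ws \<le> forest_weight (8 * R) ws" for ws
    using power_le_forest_weight[of R ws] forest_weight_mono[of "4 * R" "8 * R" ws] R by simp
  have merge: "cmod (loop_merge (\<phi> N) i w vs) \<le> forest_weight (8 * R) ((i # w) # vs)"
    if "1 \<le> N" "(i # w) # vs \<in> forests A" "forest_length ((i # w) # vs) \<le> N" for N i w vs
    using norm_loop_merge_le[of R 1 A i w vs "\<phi> N"] that bound R by auto
  define \<epsilon> where "\<epsilon> = (\<lambda>N::nat. 1 / (real N)\<^sup>2)"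
  have \<epsilon>0: "0 \<le> \<epsilon> N" for N by (simp add: \<epsilon>_def)
  have \<epsilon>lim: "\<epsilon> \<longlonglongrightarrow> 0" unfolding \<epsilon>_def by real_asymp
  \<comment> \<open>Two values of \<open>N\<close> solve the same contracting equation up to \<open>O(N\<^sup>-\<^sup>2)\<close>; the a priori bound
    for lengths up to \<open>N\<close> leaves room for \<open>k\<close> iterations, each of which lengthens words by at most \<open>d\<close>.\<close>
  have stage1: "cmod (\<phi> N ws - \<phi> M ws) \<le> (2 * (\<epsilon> N + \<epsilon> M) + 2 / 2 ^ k) * forest_weight (8 * R) ws"
    if NM: "1 \<le> N" "1 \<le> M" and ws: "ws \<in> forests A" "forest_length ws + k * d \<le> min N M" for N M ws k
  proof (rule approximate_solution_bound[where L = "min N M" and \<psi> = "\<lambda>ws. \<phi> N ws - \<phi> M ws"])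
    show "cmod (\<phi> N ws - \<phi> M ws) \<le> 2 * forest_weight (8 * R) ws" if "ws \<in> forests A" "forest_length ws \<le> min N M" for ws
      using norm_triangle_ineq4[of "\<phi> N ws" "\<phi> M ws"] bound[of N ws] bound[of M ws] that NM wt[of ws] by auto
    show "cmod ((\<phi> N ((i # w) # vs) - \<phi> M ((i # w) # vs)) - loop_main n q t (\<lambda>ws. \<phi> N ws - \<phi> M ws) i w vs) \<le> (\<epsilon> N + \<epsilon> M) * forest_weight (8 * R) ((i # w) # vs)"
      if F: "(i # w) # vs \<in> forests A" "forest_length ((i # w) # vs) \<le> min N M" for i w vs
    proof -
      have "(\<phi> N ((i # w) # vs) - \<phi> M ((i # w) # vs)) - loop_main n q t (\<lambda>ws. \<phi> N ws - \<phi> M ws) i w vs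
        = loop_merge (\<phi> N) i w vs / (of_nat N)\<^sup>2 - loop_merge (\<phi> M) i w vs / (of_nat M)\<^sup>2"
        using F NM by (simp add: eq loop_main_diff)
      also have "cmod \<dots> \<le> \<epsilon> N * cmod (loop_merge (\<phi> N) i w vs) + \<epsilon> M * cmod (loop_merge (\<phi> M) i w vs)"
        by (rule order_trans[OF norm_triangle_ineq4]) (simp add: \<epsilon>_def norm_divide norm_power)
      also have "\<dots> \<le> \<epsilon> N * forest_weight (8 * R) ((i # w) # vs) + \<epsilon> M * forest_weight (8 * R) ((i # w) # vs)"
        using F NM by (intro add_mono mult_left_mono merge \<epsilon>0) auto
      finally show ?thesis by (simp add: distrib_right)
    qed
  qed (use R ws NM \<epsilon>0 nil in auto)
  have tail: "\<exists>K. \<forall>k\<ge>K. B / 2 ^ k < e" if "0 < e" for B e :: real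
  proof -
    have "(\<lambda>k. B / 2 ^ k) \<longlonglongrightarrow> 0" by real_asymp
    then show ?thesis using order_tendstoD(2)[of _ 0 sequentially e] that by (auto simp: eventually_sequentially)
  qed
  have Cauchy1: "Cauchy (\<lambda>N. \<phi> N ws)" if ws: "ws \<in> forests A" for ws
  proof (rule CauchyI)
    fix e :: real assume e: "0 < e"
    define W where "W = forest_weight (8 * R) ws"
    have W: "W \<ge> 0" using R by (simp add: W_def forest_weight_nonneg)
    obtain k where k: "2 / 2 ^ k < e / (2 * (W + 1))" using tail[of "e / (2 * (W + 1))" 2] e W by auto
    have "eventually (\<lambda>N. \<epsilon> N < e / (8 * (W + 1))) sequentially"
      using \<epsilon>lim by (rule order_tendstoD) (use e W in auto)
    then obtain N0 where N0: "\<And>N. N \<ge> N0 \<Longrightarrow> \<epsilon> N < e / (8 * (W + 1))" by (auto simp: eventually_sequentially)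
    show "\<exists>M. \<forall>m\<ge>M. \<forall>n\<ge>M. cmod (\<phi> m ws - \<phi> n ws) < e"
    proof (intro exI allI impI)
      fix m l assume ml: "m \<ge> N0 + forest_length ws + k * d + 1" "l \<ge> N0 + forest_length ws + k * d + 1"
      have "cmod (\<phi> m ws - \<phi> l ws) \<le> (2 * (\<epsilon> m + \<epsilon> l) + 2 / 2 ^ k) * W"
        unfolding W_def using ml ws by (intro stage1) auto
      also have "\<dots> \<le> (2 * (e / (8 * (W + 1)) + e / (8 * (W + 1))) + e / (2 * (W + 1))) * W"
        using ml N0[of m] N0[of l] k W by (intro mult_right_mono add_mono mult_left_mono) auto
      also have "\<dots> = e * (W / (W + 1))" using W by (simp add: divide_simps) (simp add: algebra_simps)
      also have "\<dots> < e * 1" using W by (intro mult_strict_left_mono[OF _ e]) (simp add: divide_simps)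
      finally show "cmod (\<phi> m ws - \<phi> l ws) < e" by simp
    qed
  qed
  define \<phi>0 where "\<phi>0 = (\<lambda>ws. lim (\<lambda>N. \<phi> N ws))"
  have lim0: "(\<lambda>N. \<phi> N ws) \<longlonglongrightarrow> \<phi>0 ws" if "ws \<in> forests A" for ws
    using Cauchy1[OF that] by (simp add: \<phi>0_def Cauchy_convergent convergent_LIMSEQ_iff[symmetric])
  have stage1': "cmod (\<phi> N ws - \<phi>0 ws) \<le> (2 * \<epsilon> N + 2 / 2 ^ k) * forest_weight (8 * R) ws"
    if N: "1 \<le> N" and ws: "ws \<in> forests A" "forest_length ws + k * d \<le> N" for N ws k
  proof (rule tendsto_le[OF sequentially_bot])
    show "(\<lambda>M. cmod (\<phi> N ws - \<phi> M ws)) \<longlonglongrightarrow> cmod (\<phi> N ws - \<phi>0 ws)"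
      using lim0[OF ws(1)] by (intro tendsto_intros)
    have "(\<lambda>M. (2 * (\<epsilon> N + \<epsilon> M) + 2 / 2 ^ k) * forest_weight (8 * R) ws) \<longlonglongrightarrow> (2 * (\<epsilon> N + 0) + 2 / 2 ^ k) * forest_weight (8 * R) ws"
      by (intro tendsto_intros \<epsilon>lim)
    then show "(\<lambda>M. (2 * (\<epsilon> N + \<epsilon> M) + 2 / 2 ^ k) * forest_weight (8 * R) ws) \<longlonglongrightarrow> (2 * \<epsilon> N + 2 / 2 ^ k) * forest_weight (8 * R) ws"
      by simp
    show "eventually (\<lambda>M. cmod (\<phi> N ws - \<phi> M ws) \<le> (2 * (\<epsilon> N + \<epsilon> M) + 2 / 2 ^ k) * forest_weight (8 * R) ws) sequentially"
      using eventually_ge_at_top[of "N + 1"] by eventually_elim (rule stage1, use N ws in auto)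
  qed
  have nil0: "\<phi>0 [] = 1" "\<phi>0 ([] # ws) = \<phi>0 ws" for ws
  proof -
    have "(\<lambda>N. \<phi> N []) \<longlonglongrightarrow> 1"
      by (rule tendsto_eventually, rule eventually_mono[OF eventually_ge_at_top[of 1]]) (simp add: nil)
    then show "\<phi>0 [] = 1" unfolding \<phi>0_def by (rule limI)
    have "eventually (\<lambda>N. \<phi> N ([] # ws) = \<phi> N ws) sequentially"
      using eventually_ge_at_top[of 1] by eventually_elim (simp add: nil)
    then have "(\<lambda>N. \<phi> N ([] # ws)) \<longlonglongrightarrow> L \<longleftrightarrow> (\<lambda>N. \<phi> N ws) \<longlonglongrightarrow> L" for L
      by (rule tendsto_cong)
    then show "\<phi>0 ([] # ws) = \<phi>0 ws" unfolding \<phi>0_def lim_def by simp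
  qed
  have sub1: "take k w # drop (Suc k) w # vs \<in> forests A"
    if "(i # w) # vs \<in> forests A" for k i w vs
    using that lists_take_drop[of w A] by auto
  have sub2: "(w @ rotate_out k v) # vs \<in> forests A"
    if "(i # w) # vs \<in> forests A" "v \<in> lists A" for k i w v vs
    using that rotate_out_lists[of v A k] by auto
  have eq0: "\<phi>0 ((i # w) # vs) = loop_main n q t \<phi>0 i w vs" if F: "(i # w) # vs \<in> forests A" for i w vs
  proof (rule LIMSEQ_unique)
    show "(\<lambda>N. \<phi> N ((i # w) # vs)) \<longlonglongrightarrow> \<phi>0 ((i # w) # vs)" using lim0[OF F] .
    have main: "(\<lambda>N. loop_main n q t (\<phi> N) i w vs) \<longlonglongrightarrow> loop_main n q t \<phi>0 i w vs"
      unfolding loop_main_def using q by (intro tendsto_intros lim0 sub1[OF F] sub2[OF F]) blast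
    have "(\<lambda>N. loop_merge (\<phi> N) i w vs / (of_nat N)\<^sup>2) \<longlonglongrightarrow> 0"
    proof (rule Lim_null_comparison)
      show "eventually (\<lambda>N. norm (loop_merge (\<phi> N) i w vs / (of_nat N)\<^sup>2) \<le> \<epsilon> N * forest_weight (8 * R) ((i # w) # vs)) sequentially"
        using eventually_ge_at_top[of "forest_length ((i # w) # vs) + 1"]
      proof eventually_elim
        case (elim N)
        then show ?case using mult_left_mono[OF merge[of N i w vs] \<epsilon>0[of N]] F
          by (simp add: norm_divide norm_power \<epsilon>_def)
      qed
      show "(\<lambda>N. \<epsilon> N * forest_weight (8 * R) ((i # w) # vs)) \<longlonglongrightarrow> 0"
        using tendsto_mult_right[OF \<epsilon>lim] by simp
    qed
    then have "(\<lambda>N. loop_main n q t (\<phi> N) i w vs + loop_merge (\<phi> N) i w vs / (of_nat N)\<^sup>2) \<longlonglongrightarrow> loop_main n q t \<phi>0 i w vs + 0"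
      by (intro tendsto_add main)
    moreover have "eventually (\<lambda>N. loop_main n q t (\<phi> N) i w vs + loop_merge (\<phi> N) i w vs / (of_nat N)\<^sup>2 = \<phi> N ((i # w) # vs)) sequentially"
      using eventually_ge_at_top[of 1] by eventually_elim (rule eq[OF _ F, symmetric])
    ultimately have "(\<lambda>N. \<phi> N ((i # w) # vs)) \<longlonglongrightarrow> loop_main n q t \<phi>0 i w vs + 0"
      by (rule Lim_transform_eventually)
    then show "(\<lambda>N. \<phi> N ((i # w) # vs)) \<longlonglongrightarrow> loop_main n q t \<phi>0 i w vs" by simp
  qed
  \<comment> \<open>The rescaled correction obeys the same contracting equation with source
    \<open>loop_merge (\<phi> N)\<close>. By the first stage this source is close to a limit as
    well, so the Cauchy argument can be repeated.\<close>
  define \<delta> where "\<delta> = (\<lambda>N ws. (of_nat N)\<^sup>2 * (\<phi> N ws - \<phi>0 ws))"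
  define C where "C = 2 + 32 * (real d)\<^sup>2"
  have C: "C \<ge> 0" by (simp add: C_def)
  \<comment> \<open>Forests of length at most \<open>N / 2\<close> leave the other half of the
    admissible length for \<open>N div (2 * d)\<close> iterations.\<close>
  have \<delta>bound: "cmod (\<delta> N ws) \<le> C * forest_weight (8 * R) ws"
    if N: "1 \<le> N" and ws: "ws \<in> forests A" "2 * forest_length ws \<le> N" for N ws
  proof -
    define k where "k = N div (2 * d)"
    have "2 * (k * d) \<le> N" unfolding k_def using div_times_less_eq_dividend[of N "2 * d"] by (simp add: ac_simps)
    then have "cmod (\<phi> N ws - \<phi>0 ws) \<le> (2 * \<epsilon> N + 2 / 2 ^ k) * forest_weight (8 * R) ws"
      using N ws by (intro stage1') auto
    then have "cmod (\<delta> N ws) \<le> (real N)\<^sup>2 * ((2 * \<epsilon> N + 2 / 2 ^ k) * forest_weight (8 * R) ws)"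
      unfolding \<delta>_def norm_mult by (intro mult_mono) (auto simp: norm_power)
    also have "\<dots> = (2 + 2 * ((real N)\<^sup>2 / 2 ^ k)) * forest_weight (8 * R) ws"
      using N by (simp add: \<epsilon>_def field_simps)
    also have "\<dots> \<le> C * forest_weight (8 * R) ws"
      using square_le_two_power[of N] R by (intro mult_right_mono forest_weight_nonneg) (auto simp: C_def k_def)
    finally show ?thesis .
  qed
  have \<delta>eq: "\<delta> N ((i # w) # vs) = loop_main n q t (\<delta> N) i w vs + loop_merge (\<phi> N) i w vs"
    if "1 \<le> N" "(i # w) # vs \<in> forests A" for N i w vs
  proof -
    have "loop_main n q t (\<delta> N) i w vs = (of_nat N)\<^sup>2 * (loop_main n q t (\<phi> N) i w vs - loop_main n q t \<phi>0 i w vs)"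
      unfolding \<delta>_def loop_main_scale loop_main_diff ..
    then show ?thesis using that by (simp add: \<delta>_def eq eq0 distrib_left right_diff_distrib)
  qed
  \<comment> \<open>\<open>l\<close> counts the iterations that make the difference of the sources
    small, \<open>k\<close> those applied to the corrections. Restricting to forests of at most half
    the length \<open>min N M\<close> leaves the other half for the former.\<close>
  have stage2: "cmod (\<delta> N ws - \<delta> M ws) \<le> (2 * (2 * (\<epsilon> N + \<epsilon> M) + 2 / 2 ^ l) + 2 * C / 2 ^ k) * forest_weight (64 * R) ws"
    if NM: "1 \<le> N" "1 \<le> M" "2 * (l * d) \<le> min N M" and ws: "ws \<in> forests A" "forest_length ws + k * d \<le> min N M div 2" for N M ws k l
  proof (rule approximate_solution_bound[where L = "min N M div 2" and \<psi> = "\<lambda>ws. \<delta> N ws - \<delta> M ws"])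
    fix ws assume ws: "ws \<in> forests A" "forest_length ws \<le> min N M div 2"
    have "cmod (\<delta> N ws - \<delta> M ws) \<le> 2 * C * forest_weight (8 * R) ws"
    proof -
      have "2 * forest_length ws \<le> N" "2 * forest_length ws \<le> M" using ws(2) by auto
      then show ?thesis
        using norm_triangle_ineq4[of "\<delta> N ws" "\<delta> M ws"] \<delta>bound[OF NM(1) ws(1)] \<delta>bound[OF NM(2) ws(1)] by linarith
    qed
    also have "\<dots> \<le> 2 * C * forest_weight (64 * R) ws" using C R by (intro mult_left_mono forest_weight_mono) auto
    finally show "cmod (\<delta> N ws - \<delta> M ws) \<le> 2 * C * forest_weight (64 * R) ws" .
  next
    fix i w vs
    assume F: "(i # w) # vs \<in> forests A" "forest_length ((i # w) # vs) \<le> min N M div 2"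
    have "(\<delta> N ((i # w) # vs) - \<delta> M ((i # w) # vs)) - loop_main n q t (\<lambda>ws. \<delta> N ws - \<delta> M ws) i w vs
        = loop_merge (\<lambda>ws. \<phi> N ws - \<phi> M ws) i w vs"
      using F NM by (simp add: \<delta>eq loop_main_diff loop_merge_diff)
    also have "cmod \<dots> \<le> (2 * (\<epsilon> N + \<epsilon> M) + 2 / 2 ^ l) * forest_weight (8 * (8 * R)) ((i # w) # vs)"
    proof (rule norm_loop_merge_le[OF _ _ _ F(1)])
      fix ws assume ws: "ws \<in> forests A" "forest_length ws \<le> forest_length ((i # w) # vs)"
      have "cmod (\<phi> N ws - \<phi> M ws) \<le> (2 * (\<epsilon> N + \<epsilon> M) + 2 / 2 ^ l) * forest_weight (8 * R) ws"
        using ws F NM by (intro stage1) auto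
      also have "\<dots> \<le> (2 * (\<epsilon> N + \<epsilon> M) + 2 / 2 ^ l) * (8 * R) ^ forest_length ws"
        using R \<epsilon>0 by (intro mult_left_mono forest_weight_le_power) auto
      finally show "cmod (\<phi> N ws - \<phi> M ws) \<le> (2 * (\<epsilon> N + \<epsilon> M) + 2 / 2 ^ l) * (8 * R) ^ forest_length ws" .
    qed (use R \<epsilon>0 in auto)
    finally show "cmod ((\<delta> N ((i # w) # vs) - \<delta> M ((i # w) # vs)) - loop_main n q t (\<lambda>ws. \<delta> N ws - \<delta> M ws) i w vs)
      \<le> (2 * (\<epsilon> N + \<epsilon> M) + 2 / 2 ^ l) * forest_weight (64 * R) ((i # w) # vs)" by simp
  next
    show "8 * R \<le> 64 * R" "64 * R \<le> 64 * R" "0 \<le> 2 * C" "0 \<le> 2 * (\<epsilon> N + \<epsilon> M) + 2 / 2 ^ l"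
      using R C \<epsilon>0 by auto
    show "\<delta> N [] - \<delta> M [] = 0" using NM by (simp add: \<delta>_def nil nil0)
    show "\<delta> N ([] # ws) - \<delta> M ([] # ws) = \<delta> N ws - \<delta> M ws" for ws using NM by (simp add: \<delta>_def nil nil0)
  qed (use ws in simp_all)
  have Cauchy2: "Cauchy (\<lambda>N. \<delta> N ws)" if ws: "ws \<in> forests A" for ws
  proof (rule CauchyI)
    fix e :: real assume e: "0 < e"
    define W where "W = forest_weight (64 * R) ws"
    have W: "W \<ge> 0" using R by (simp add: W_def forest_weight_nonneg)
    obtain k where k: "2 * C / 2 ^ k < e / (4 * (W + 1))" using tail[of "e / (4 * (W + 1))" "2 * C"] e W by auto
    obtain l where l: "4 / 2 ^ l < e / (4 * (W + 1))" using tail[of "e / (4 * (W + 1))" 4] e W by auto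
    have "eventually (\<lambda>N. \<epsilon> N < e / (16 * (W + 1))) sequentially"
      using \<epsilon>lim by (rule order_tendstoD) (use e W in auto)
    then obtain N0 where N0: "\<And>N. N \<ge> N0 \<Longrightarrow> \<epsilon> N < e / (16 * (W + 1))" by (auto simp: eventually_sequentially)
    define N1 where "N1 = N0 + 2 * forest_length ws + 2 * (k * d) + 2 * (l * d) + 1"
    show "\<exists>M. \<forall>m\<ge>M. \<forall>n\<ge>M. cmod (\<delta> m ws - \<delta> n ws) < e"
    proof (intro exI allI impI)
      fix a b assume ab: "a \<ge> N1" "b \<ge> N1"
      have "cmod (\<delta> a ws - \<delta> b ws) \<le> (2 * (2 * (\<epsilon> a + \<epsilon> b) + 2 / 2 ^ l) + 2 * C / 2 ^ k) * W"
        unfolding W_def using ab ws by (intro stage2) (auto simp: N1_def)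
      also have "\<dots> = (4 * (\<epsilon> a + \<epsilon> b) + 4 / 2 ^ l + 2 * C / 2 ^ k) * W" by (simp add: algebra_simps)
      also have "\<dots> \<le> (4 * (e / (16 * (W + 1)) + e / (16 * (W + 1))) + e / (4 * (W + 1)) + e / (4 * (W + 1))) * W"
        using ab N0[of a] N0[of b] k l W by (intro mult_right_mono add_mono mult_left_mono) (auto simp: N1_def)
      also have "\<dots> = e * (W / (W + 1))" using W by (simp add: divide_simps) (simp add: algebra_simps)
      also have "\<dots> < e * 1" using W by (intro mult_strict_left_mono[OF _ e]) (simp add: divide_simps)
      finally show "cmod (\<delta> a ws - \<delta> b ws) < e" by simp
    qed
  qed
  show thesis
  proof (rule that[of \<phi>0 "\<lambda>ws. lim (\<lambda>N. \<delta> N ws)"])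
    fix ws assume "ws \<in> forests A"
    then have "(\<lambda>N. \<delta> N ws) \<longlonglongrightarrow> lim (\<lambda>N. \<delta> N ws)"
      using Cauchy2[of ws] by (simp add: Cauchy_convergent convergent_LIMSEQ_iff[symmetric])
    then show "(\<lambda>N. (of_nat N)\<^sup>2 * (\<phi> N ws - \<phi>0 ws)) \<longlonglongrightarrow> lim (\<lambda>N. \<delta> N ws)"
      unfolding \<delta>_def .
  next
    fix N ws assume "1 \<le> N" "ws \<in> forests A" "2 * forest_length ws \<le> N"
    then show "cmod ((of_nat N)\<^sup>2 * (\<phi> N ws - \<phi>0 ws)) \<le> (2 + 32 * (real d)\<^sup>2) * forest_weight (8 * R) ws"
      using \<delta>bound[of N ws] by (simp add: \<delta>_def C_def)
  qed
qed

end

section \<open>Polynomial functions and Gaussian integration by parts\<close>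

text \<open>Polynomial functions as a predicate on functions, so that entries and traces of words
  fall under it by closure rules, while measurability, growth and differentiability follow by rule
  induction.\<close>

inductive cpoly :: "'i set \<Rightarrow> (('i \<Rightarrow> real) \<Rightarrow> complex) \<Rightarrow> bool" for I where
  const: "cpoly I (\<lambda>x. c)"
| coord: "p \<in> I \<Longrightarrow> cpoly I (\<lambda>x. of_real (x p))"
| add: "cpoly I f \<Longrightarrow> cpoly I g \<Longrightarrow> cpoly I (\<lambda>x. f x + g x)"
| mult: "cpoly I f \<Longrightarrow> cpoly I g \<Longrightarrow> cpoly I (\<lambda>x. f x * g x)"

lemma cpoly_cmult: "cpoly I f \<Longrightarrow> cpoly I (\<lambda>x. c * f x)"
  by (intro cpoly.mult cpoly.const)

lemma cpoly_uminus: "cpoly I f \<Longrightarrow> cpoly I (\<lambda>x. - f x)"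
  using cpoly_cmult[of I f "-1"] by simp

lemma cpoly_diff: "cpoly I f \<Longrightarrow> cpoly I g \<Longrightarrow> cpoly I (\<lambda>x. f x - g x)"
  using cpoly.add[OF _ cpoly_uminus[of I g]] by simp

lemma cpoly_sum: "(\<And>j. j \<in> S \<Longrightarrow> cpoly I (f j)) \<Longrightarrow> cpoly I (\<lambda>x. \<Sum>j\<in>S. f j x)"
proof (induction S rule: infinite_finite_induct)
  case (insert j S)
  then show ?case by (simp add: cpoly.add)
qed (simp_all add: cpoly.const)

lemma cpoly_cong: "cpoly I f \<Longrightarrow> (\<And>p. p \<in> I \<Longrightarrow> x p = y p) \<Longrightarrow> f x = f y"
  by (induction rule: cpoly.induct) auto

lemma cpoly_measurable [measurable_dest]: "cpoly I f \<Longrightarrow> f \<in> borel_measurable (\<Pi>\<^sub>M p\<in>I. lborel)"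
proof (induction rule: cpoly.induct)
  case (coord p)
  then have "(\<lambda>x. x p) \<in> borel_measurable (\<Pi>\<^sub>M p\<in>I. lborel :: real measure)"
    using measurable_component_singleton[of p I "\<lambda>_. lborel :: real measure"] by simp
  then show ?case by simp
qed auto

definition sqnorm :: "'i set \<Rightarrow> ('i \<Rightarrow> real) \<Rightarrow> real" where
  "sqnorm I x = (\<Sum>p\<in>I. (x p)\<^sup>2)"

lemma sqnorm_nonneg [simp]: "0 \<le> sqnorm I x"
  by (simp add: sqnorm_def sum_nonneg)

text \<open>Every rate \<open>e\<close> is allowed in the induction because a product has to share
  it between its factors.\<close>

lemma cpoly_bound:
  assumes "finite I" "cpoly I f" "0 < e"
  obtains C where "0 \<le> C" "\<And>x. cmod (f x) \<le> C * exp (e * sqnorm I x)"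
proof -
  have "\<exists>C\<ge>0. \<forall>x. cmod (f x) \<le> C * exp (e * sqnorm I x)"
    using assms(2,3)
  proof (induction arbitrary: e rule: cpoly.induct)
    case (const c)
    have "cmod c * 1 \<le> cmod c * exp (e * sqnorm I x)" for x
      using const by (intro mult_left_mono) auto
    then show ?case by (intro exI[of _ "cmod c"]) auto
  next
    case (coord p)
    have "\<bar>x p\<bar> \<le> (1 + 1 / e) * exp (e * sqnorm I x)" for x
    proof -
      have "\<bar>x p\<bar> \<le> 1 + (x p)\<^sup>2" using sum_squares_bound[of 1 "\<bar>x p\<bar>"] by simp
      also have "(x p)\<^sup>2 \<le> sqnorm I x"
        unfolding sqnorm_def using coord assms(1) by (intro member_le_sum) auto
      also have "1 + sqnorm I x \<le> (1 + 1 / e) * (1 + e * sqnorm I x)"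
        using coord by (simp add: field_simps)
      also have "\<dots> \<le> (1 + 1 / e) * exp (e * sqnorm I x)"
        using coord by (intro mult_left_mono exp_ge_add_one_self) auto
      finally show ?thesis by simp
    qed
    then show ?case using coord by (intro exI[of _ "1 + 1 / e"]) auto
  next
    case (add f g)
    obtain C D where C: "C \<ge> 0" "\<And>x. cmod (f x) \<le> C * exp (e * sqnorm I x)"
      and D: "D \<ge> 0" "\<And>x. cmod (g x) \<le> D * exp (e * sqnorm I x)" using add.IH add.prems by metis
    have "cmod (f x + g x) \<le> (C + D) * exp (e * sqnorm I x)" for x
      using norm_triangle_ineq[of "f x" "g x"] C(2)[of x] D(2)[of x] by (simp add: distrib_right)
    then show ?case using C D by (intro exI[of _ "C + D"]) auto
  next
    case (mult f g)
    have e: "0 < e / 2" using mult by simp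
    obtain C D where C: "C \<ge> 0" "\<And>x. cmod (f x) \<le> C * exp (e/2 * sqnorm I x)"
      and D: "D \<ge> 0" "\<And>x. cmod (g x) \<le> D * exp (e/2 * sqnorm I x)" using mult.IH e by metis
    have "cmod (f x * g x) \<le> (C * exp (e/2 * sqnorm I x)) * (D * exp (e/2 * sqnorm I x))" for x
      unfolding norm_mult using C D by (intro mult_mono) auto
    also have "(C * exp (e/2 * sqnorm I x)) * (D * exp (e/2 * sqnorm I x)) = C * D * exp (e * sqnorm I x)" for x
      by (simp add: exp_add[symmetric])
    finally show ?case using C D by (intro exI[of _ "C * D"]) auto
  qed
  then show thesis using that by auto
qed

section \<open>Partial derivatives of polynomial functions\<close>

definition pd :: "'i \<Rightarrow> (('i \<Rightarrow> real) \<Rightarrow> complex) \<Rightarrow> ('i \<Rightarrow> real) \<Rightarrow> complex" where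
  "pd p f x = vector_derivative (\<lambda>s. f (x(p := s))) (at (x p))"

text \<open>Derivatives along arbitrary lines, with polynomial coefficients, pass through the
  induction. Coordinate lines then identify the coefficients with \<open>pd\<close>, so one
  statement serves both convexity along lines and integration by parts.\<close>

lemma cpoly_gradient:
  assumes "finite I" "cpoly I f"
  shows "\<exists>g. (\<forall>p. cpoly I (g p)) \<and> (\<forall>x v s. ((\<lambda>s. f (\<lambda>i. x i + s * v i)) has_vector_derivative
    (\<Sum>p\<in>I. of_real (v p) * g p (\<lambda>i. x i + s * v i))) (at s))"
  using assms(2)
proof (induction rule: cpoly.induct)
  case (const c)
  then show ?case by (intro exI[of _ "\<lambda>_ _. 0"]) (auto intro: cpoly.const)
next
  case (coord p)
  have 1: "((\<lambda>s. complex_of_real (x p + s * v p)) has_vector_derivative of_real (v p)) (at s)" for x v s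
    by (intro has_vector_derivative_of_real derivative_eq_intros has_real_derivative_iff_has_vector_derivative[THEN iffD1]) (auto intro!: derivative_eq_intros)
  have 2: "(\<Sum>r\<in>I. of_real (v r) * (if r = p then 1 else 0)) = complex_of_real (v p)" for v
    using coord assms(1) by (simp add: if_distrib sum.delta cong: if_cong)
  show ?case
    by (intro exI[of _ "\<lambda>r _. if r = p then 1 else 0"] conjI allI cpoly.const) (use 1 in \<open>simp only: 2\<close>)
next
  case (add f g)
  then obtain f' g' where f': "\<And>p. cpoly I (f' p)" "\<And>x v s. ((\<lambda>s. f (\<lambda>i. x i + s * v i)) has_vector_derivative (\<Sum>p\<in>I. of_real (v p) * f' p (\<lambda>i. x i + s * v i))) (at s)"
    and g': "\<And>p. cpoly I (g' p)" "\<And>x v s. ((\<lambda>s. g (\<lambda>i. x i + s * v i)) has_vector_derivative (\<Sum>p\<in>I. of_real (v p) * g' p (\<lambda>i. x i + s * v i))) (at s)"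
    by blast
  show ?case
    by (intro exI[of _ "\<lambda>p x. f' p x + g' p x"] conjI allI cpoly.add f' g')
      (use has_vector_derivative_add[OF f'(2) g'(2)] in \<open>simp add: sum.distrib distrib_left\<close>)
next
  case (mult f g)
  then obtain f' g' where f': "\<And>p. cpoly I (f' p)" "\<And>x v s. ((\<lambda>s. f (\<lambda>i. x i + s * v i)) has_vector_derivative (\<Sum>p\<in>I. of_real (v p) * f' p (\<lambda>i. x i + s * v i))) (at s)"
    and g': "\<And>p. cpoly I (g' p)" "\<And>x v s. ((\<lambda>s. g (\<lambda>i. x i + s * v i)) has_vector_derivative (\<Sum>p\<in>I. of_real (v p) * g' p (\<lambda>i. x i + s * v i))) (at s)"
    by blast
  have eq: "f y * (\<Sum>p\<in>I. of_real (v p) * g' p y) + (\<Sum>p\<in>I. of_real (v p) * f' p y) * g y = (\<Sum>p\<in>I. of_real (v p) * (f y * g' p y + f' p y * g y))" for y v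
    by (simp add: sum_distrib_left sum_distrib_right sum.distrib[symmetric] algebra_simps)
  show ?case
  proof (intro exI[of _ "\<lambda>p x. f x * g' p x + f' p x * g x"] conjI allI cpoly.add cpoly.mult f' g' mult.hyps)
    fix x v s
    show "((\<lambda>s. f (\<lambda>i. x i + s * v i) * g (\<lambda>i. x i + s * v i)) has_vector_derivative
      (\<Sum>p\<in>I. of_real (v p) * (f (\<lambda>i. x i + s * v i) * g' p (\<lambda>i. x i + s * v i) + f' p (\<lambda>i. x i + s * v i) * g (\<lambda>i. x i + s * v i)))) (at s)"
      using has_vector_derivative_mult[OF f'(2)[of x v s] g'(2)[of x v s]] unfolding eq .
  qed
qed

lemma fun_upd_as_line: "x(p := s) = (\<lambda>i. (x(p := 0)) i + s * (if i = p then 1 else 0))" for x :: "'i \<Rightarrow> real"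
  by auto

lemma
  assumes "finite I" "cpoly I f"
  shows pd_line: "((\<lambda>s. f (\<lambda>i. x i + s * v i)) has_vector_derivative (\<Sum>p\<in>I. of_real (v p) * pd p f (\<lambda>i. x i + s * v i))) (at s)"
    and cpoly_pd: "p \<in> I \<Longrightarrow> cpoly I (pd p f)"
    and pd_coord: "p \<in> I \<Longrightarrow> ((\<lambda>s. f (x(p := s))) has_vector_derivative pd p f (x(p := s))) (at s)"
proof -
  obtain g where g: "\<And>p. cpoly I (g p)" "\<And>x v s. ((\<lambda>s. f (\<lambda>i. x i + s * v i)) has_vector_derivative (\<Sum>p\<in>I. of_real (v p) * g p (\<lambda>i. x i + s * v i))) (at s)"
    using cpoly_gradient[OF assms] by blast
  have upd: "((\<lambda>s. f (x(p := s))) has_vector_derivative g p (x(p := s))) (at s)" if "p \<in> I" for p x s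
  proof -
    have "(\<Sum>r\<in>I. of_real (if r = p then 1 else 0) * g r y) = g p y" for y
      using that assms(1) by (simp add: if_distrib[of of_real] if_distrib[of "\<lambda>z. z * _"] cong: if_cong)
    then show ?thesis using g(2)[of "x(p:=0)" "\<lambda>i. if i = p then 1 else 0" s]
      unfolding fun_upd_as_line[symmetric] by (simp only:)
  qed
  have pd: "pd p f = g p" if "p \<in> I" for p
    using vector_derivative_at[OF upd[OF that, of _ _ ]] by (auto simp: pd_def fun_eq_iff)
  show "((\<lambda>s. f (\<lambda>i. x i + s * v i)) has_vector_derivative (\<Sum>p\<in>I. of_real (v p) * pd p f (\<lambda>i. x i + s * v i))) (at s)"
    using g(2)[of x v s] by (simp add: pd cong: sum.cong)
  show "p \<in> I \<Longrightarrow> cpoly I (pd p f)" using g(1) by (simp add: pd)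
  show "p \<in> I \<Longrightarrow> ((\<lambda>s. f (x(p := s))) has_vector_derivative pd p f (x(p := s))) (at s)" using upd pd by simp
qed

lemma pd_eqI:
  assumes "((\<lambda>s. f (x(p := s))) has_vector_derivative D) (at (x p))"
  shows "pd p f x = D"
  using vector_derivative_at[OF assms] by (simp add: pd_def)

lemma pd_const [simp]: "pd p (\<lambda>x. c) x = 0"
  by (rule pd_eqI) simp

lemma pd_coordinate: "pd p (\<lambda>x. complex_of_real (x r)) x = (if p = r then 1 else 0)"
  by (rule pd_eqI) (auto intro!: derivative_eq_intros has_vector_derivative_of_real simp: has_real_derivative_iff_has_vector_derivative[symmetric])

lemma
  assumes "finite I" "p \<in> I" "cpoly I f" "cpoly I g"
  shows pd_add: "pd p (\<lambda>x. f x + g x) x = pd p f x + pd p g x"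
    and pd_mult: "pd p (\<lambda>x. f x * g x) x = f x * pd p g x + pd p f x * g x"
  using has_vector_derivative_add[OF pd_coord[OF assms(1,3,2), of x "x p"] pd_coord[OF assms(1,4,2), of x "x p"]]
    has_vector_derivative_mult[OF pd_coord[OF assms(1,3,2), of x "x p"] pd_coord[OF assms(1,4,2), of x "x p"]]
  by (auto intro!: pd_eqI)

lemma pd_cmult: "finite I \<Longrightarrow> p \<in> I \<Longrightarrow> cpoly I f \<Longrightarrow> pd p (\<lambda>x. c * f x) x = c * pd p f x"
  using pd_mult[of I p "\<lambda>_. c" f] by (simp add: cpoly.const)

section \<open>Gaussian decay, integration by parts and signed permutations\<close>

lemma integrable_gaussian_1d: "0 < e \<Longrightarrow> integrable lborel (\<lambda>x::real. exp (- e * x\<^sup>2))"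
proof -
  assume e: "0 < e"
  define \<sigma> where "\<sigma> = sqrt (1 / (2 * e))"
  have \<sigma>: "\<sigma> > 0" "\<sigma>\<^sup>2 = 1 / (2 * e)" using e by (auto simp: \<sigma>_def)
  have "integrable lborel (\<lambda>x. sqrt (2 * pi * \<sigma>\<^sup>2) * normal_density 0 \<sigma> x)"
    using \<sigma> integrable_normal_moment[of \<sigma> 0 0] by (intro integrable_mult_right) simp
  moreover have "(\<lambda>x. sqrt (2 * pi * \<sigma>\<^sup>2) * normal_density 0 \<sigma> x) = (\<lambda>x::real. exp (- e * x\<^sup>2))"
    using e \<sigma> by (auto simp: normal_density_def fun_eq_iff)
  ultimately show ?thesis by simp
qed

lemma integrable_gaussian:
  assumes "finite I" "0 < e"
  shows "integrable (\<Pi>\<^sub>M p\<in>I. lborel) (\<lambda>x. exp (- e * sqnorm I x))"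
proof -
  interpret product_sigma_finite "\<lambda>_::'a. lborel :: real measure" by standard
  have "integrable (\<Pi>\<^sub>M p\<in>I. lborel) (\<lambda>x. \<Prod>p\<in>I. exp (- e * (x p)\<^sup>2))"
    using assms by (intro product_integrable_prod integrable_gaussian_1d)
  moreover have "(\<Prod>p\<in>I. exp (- e * (x p)\<^sup>2)) = exp (- e * sqnorm I x)" for x
    using assms by (simp add: sqnorm_def exp_sum[symmetric] sum_distrib_left sum_negf)
  ultimately show ?thesis by simp
qed

lemma integrable_gaussian_bound:
  fixes f :: "('i \<Rightarrow> real) \<Rightarrow> 'b::{banach, second_countable_topology}"
  assumes "finite I" "0 < e" "f \<in> borel_measurable (\<Pi>\<^sub>M p\<in>I. lborel)"
    and "\<And>x. norm (f x) \<le> C * exp (- e * sqnorm I x)"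
  shows "integrable (\<Pi>\<^sub>M p\<in>I. lborel) f"
proof (rule Bochner_Integration.integrable_bound)
  show "integrable (\<Pi>\<^sub>M p\<in>I. lborel) (\<lambda>x. C * exp (- e * sqnorm I x))"
    using assms by (intro integrable_mult_right integrable_gaussian)
  show "AE x in (\<Pi>\<^sub>M p\<in>I. lborel). norm (f x) \<le> norm (C * exp (- e * sqnorm I x))"
    using assms(4) by (intro AE_I2) (metis abs_ge_self order_trans real_norm_def)
qed fact

lemma integral_derivative_eq_0:
  fixes G G' :: "real \<Rightarrow> complex"
  assumes G: "\<And>s. (G has_vector_derivative G' s) (at s)" and cont: "\<And>s. isCont G' s"
    and bd: "\<And>s. cmod (G s) \<le> C * exp (- e * s\<^sup>2)" and bd': "\<And>s. cmod (G' s) \<le> C * exp (- e * s\<^sup>2)" and e: "0 < e"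
  shows "(\<integral>s. G' s \<partial>lborel) = 0"
proof -
  have "integrable lborel G'"
  proof (rule Bochner_Integration.integrable_bound)
    show "integrable lborel (\<lambda>s. C * exp (- e * s\<^sup>2))" using e by (intro integrable_mult_right integrable_gaussian_1d)
    show "AE s in lborel. norm (G' s) \<le> norm (C * exp (- e * s\<^sup>2))"
      using bd' by (intro AE_I2) (metis abs_ge_self order_trans real_norm_def)
    show "G' \<in> borel_measurable lborel" using cont by (simp add: borel_measurable_continuous_onI continuous_at_imp_continuous_on)
  qed
  moreover have U: "einterval (-\<infinity>) \<infinity> = UNIV" by (auto simp: einterval_def)
  ultimately have int: "set_integrable lborel (einterval (-\<infinity>) \<infinity>) G'" by (simp add: set_integrable_def)
  have "(G \<longlongrightarrow> 0) at_top"
    by (rule Lim_null_comparison[OF always_eventually[OF allI[OF bd]]]) (use e in real_asymp)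
  moreover have "(G \<longlongrightarrow> 0) at_bot"
    by (rule Lim_null_comparison[OF always_eventually[OF allI[OF bd]]]) (use e in real_asymp)
  ultimately have "(LBINT s=-\<infinity>..\<infinity>. G' s) = 0 - 0"
    using G cont int by (intro interval_integral_FTC_integrable) (auto simp: ereal_tendsto_simps)
  then show ?thesis by (simp add: interval_lebesgue_integral_def U set_lebesgue_integral_def)
qed

lemma cpoly_continuous_coord: "finite I \<Longrightarrow> cpoly I f \<Longrightarrow> p \<in> I \<Longrightarrow> isCont (\<lambda>s. f (x(p := s))) s"
  using pd_coord has_vector_derivative_continuous by (metis continuous_at_imp_continuous_within)

lemma sqnorm_upd: "finite I \<Longrightarrow> p \<in> I \<Longrightarrow> s\<^sup>2 \<le> sqnorm I (x(p := s))"
  unfolding sqnorm_def using member_le_sum[of p I "\<lambda>r. ((x(p:=s)) r)\<^sup>2"] by simp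

text \<open>Half of the Gaussian decay of \<open>exp (- U x)\<close> is spent on the polynomial
  factor.\<close>

lemma cpoly_exp_bound:
  assumes "finite I" "cpoly I f" "0 < e" and U: "\<And>x. e * sqnorm I x - B \<le> Re (U x)"
  obtains C where "0 \<le> C" "\<And>x. cmod (f x * exp (- U x)) \<le> C * exp (- (e / 2) * sqnorm I x)"
proof -
  obtain C where C: "0 \<le> C" "\<And>x. cmod (f x) \<le> C * exp (e / 2 * sqnorm I x)"
    using cpoly_bound[OF assms(1,2), of "e / 2"] assms(3) by auto
  have "cmod (f x * exp (- U x)) \<le> (C * exp B) * exp (- (e / 2) * sqnorm I x)" for x
  proof -
    have "cmod (f x * exp (- U x)) = cmod (f x) * exp (- Re (U x))" by (simp add: norm_mult)
    also have "\<dots> \<le> (C * exp (e / 2 * sqnorm I x)) * exp (B - e * sqnorm I x)"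
      using C U[of x] by (intro mult_mono) auto
    also have "\<dots> = (C * exp B) * exp (- (e / 2) * sqnorm I x)" by (simp add: exp_add[symmetric] exp_diff[symmetric] mult.assoc)
    finally show ?thesis .
  qed
  then show thesis using C that[of "C * exp B"] by simp
qed

lemma integrable_cpoly_exp:
  assumes "finite I" "cpoly I f" "cpoly I U" "0 < e" and U: "\<And>x. e * sqnorm I x - B \<le> Re (U x)"
  shows "integrable (\<Pi>\<^sub>M p\<in>I. lborel) (\<lambda>x. f x * exp (- U x))"
proof -
  obtain C where "0 \<le> C" "\<And>x. cmod (f x * exp (- U x)) \<le> C * exp (- (e / 2) * sqnorm I x)"
    using cpoly_exp_bound[OF assms(1,2,4,5)] by blast
  then show ?thesis using assms(4) cpoly_measurable[OF assms(2)] cpoly_measurable[OF assms(3)]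
    by (intro integrable_gaussian_bound[OF assms(1), where e = "e / 2" and C = C]) auto
qed

theorem integration_by_parts_gaussian:
  assumes I: "finite I" "p \<in> I" and f: "cpoly I f" and U: "cpoly I U" and e: "0 < e"
    and growth: "\<And>x. e * sqnorm I x - B \<le> Re (U x)"
  shows "(\<integral>x. pd p f x * exp (- U x) \<partial>(\<Pi>\<^sub>M p\<in>I. lborel)) = (\<integral>x. f x * pd p U x * exp (- U x) \<partial>(\<Pi>\<^sub>M p\<in>I. lborel))"
proof -
  interpret product_sigma_finite "\<lambda>_::'a. lborel :: real measure" by standard
  \<comment> \<open>\<open>h\<close> is chosen so that \<open>h x * exp (- U x)\<close> is the
    derivative of \<open>f x * exp (- U x)\<close> in coordinate \<open>p\<close>; integrated over
    that coordinate first, it vanishes.\<close>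
  define h where "h = (\<lambda>x. pd p f x - f x * pd p U x)"
  have h: "cpoly I h" unfolding h_def using I f U by (intro cpoly_diff cpoly.mult cpoly_pd)
  obtain C1 where C1: "0 \<le> C1" "\<And>x. cmod (f x * exp (- U x)) \<le> C1 * exp (- (e / 2) * sqnorm I x)"
    using cpoly_exp_bound[OF I(1) f e growth] by blast
  obtain C2 where C2: "0 \<le> C2" "\<And>x. cmod (h x * exp (- U x)) \<le> C2 * exp (- (e / 2) * sqnorm I x)"
    using cpoly_exp_bound[OF I(1) h e growth] by blast
  define J where "J = I - {p}"
  have J: "I = insert p J" "finite J" "p \<notin> J" using I by (auto simp: J_def)
  have "(\<integral>x. h x * exp (- U x) \<partial>(\<Pi>\<^sub>M p\<in>I. lborel)) = (\<integral>x. \<integral>s. h (x(p := s)) * exp (- U (x(p := s))) \<partial>lborel \<partial>(\<Pi>\<^sub>M p\<in>J. lborel))"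
    using integrable_cpoly_exp[OF I(1) h U e growth] unfolding J(1)
    by (rule product_integral_insert[OF J(2,3)])
  also have "\<dots> = (\<integral>x. 0 \<partial>(\<Pi>\<^sub>M p\<in>J. (lborel :: real measure)))"
  proof (rule Bochner_Integration.integral_cong[OF refl])
    fix x :: "'a \<Rightarrow> real"
    show "(\<integral>s. h (x(p := s)) * exp (- U (x(p := s))) \<partial>lborel) = 0"
    proof (rule integral_derivative_eq_0[where G = "\<lambda>s. f (x(p := s)) * exp (- U (x(p := s)))" and C = "max C1 C2" and e = "e / 2"])
      fix s :: real
      have "((\<lambda>s. exp (- U (x(p := s)))) has_vector_derivative (- pd p U (x(p := s))) * exp (- U (x(p := s)))) (at s)"
        using field_vector_diff_chain_at[OF has_vector_derivative_minus[OF pd_coord[OF I(1) U I(2), of x s]] DERIV_exp]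
        by (simp add: o_def)
      from has_vector_derivative_mult[OF pd_coord[OF I(1) f I(2), of x s] this]
      show "((\<lambda>s. f (x(p := s)) * exp (- U (x(p := s)))) has_vector_derivative h (x(p := s)) * exp (- U (x(p := s)))) (at s)"
        by (simp add: h_def algebra_simps)
      show "isCont (\<lambda>s. h (x(p := s)) * exp (- U (x(p := s)))) s"
        using cpoly_continuous_coord[OF I(1) h I(2), of s x] cpoly_continuous_coord[OF I(1) U I(2), of s x]
        by (intro continuous_intros)
      have E: "exp (- (e / 2) * sqnorm I (x(p := s))) \<le> exp (- (e / 2) * s\<^sup>2)"
        using sqnorm_upd[OF I, where s = s and x = x] e by simp
      show "cmod (f (x(p := s)) * exp (- U (x(p := s)))) \<le> max C1 C2 * exp (- (e / 2) * s\<^sup>2)"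
        by (rule order_trans[OF C1(2)], rule mult_mono) (use E C1 in auto)
      show "cmod (h (x(p := s)) * exp (- U (x(p := s)))) \<le> max C1 C2 * exp (- (e / 2) * s\<^sup>2)"
        by (rule order_trans[OF C2(2)], rule mult_mono) (use E C2 in auto)
    qed (use e in auto)
  qed
  finally have "(\<integral>x. pd p f x * exp (- U x) - f x * pd p U x * exp (- U x) \<partial>(\<Pi>\<^sub>M p\<in>I. lborel)) = 0"
    by (simp add: h_def left_diff_distrib)
  moreover have "integrable (\<Pi>\<^sub>M p\<in>I. lborel) (\<lambda>x. pd p f x * exp (- U x))"
    using I f U by (intro integrable_cpoly_exp[OF I(1) _ U e growth] cpoly_pd)
  moreover have "integrable (\<Pi>\<^sub>M p\<in>I. lborel) (\<lambda>x. f x * pd p U x * exp (- U x))"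
    using I f U by (intro integrable_cpoly_exp[OF I(1) _ U e growth] cpoly.mult cpoly_pd)
  ultimately show ?thesis by simp
qed

text \<open>Preimages of boxes are boxes of the same volume, and boxes determine the product
  measure. Conjugation by a signed permutation matrix acts on the real entries in this way.\<close>

lemma distr_signed_permutation:
  fixes \<epsilon> :: "'i \<Rightarrow> real"
  assumes I: "finite I" and \<sigma>: "bij_betw \<sigma> I I" and \<epsilon>: "\<And>p. p \<in> I \<Longrightarrow> \<epsilon> p = 1 \<or> \<epsilon> p = -1"
  shows "distr (\<Pi>\<^sub>M p\<in>I. lborel) (\<Pi>\<^sub>M p\<in>I. lborel) (\<lambda>x. \<lambda>p\<in>I. \<epsilon> p * x (\<sigma> p)) = (\<Pi>\<^sub>M p\<in>I. lborel)"
proof -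
  interpret product_sigma_finite "\<lambda>_::'i. lborel :: real measure" by standard
  have \<sigma>I: "\<sigma> p \<in> I" if "p \<in> I" for p using \<sigma> that by (auto simp: bij_betw_def)
  have meas: "(\<lambda>x. \<lambda>p\<in>I. \<epsilon> p * x (\<sigma> p)) \<in> measurable (\<Pi>\<^sub>M p\<in>I. lborel) (\<Pi>\<^sub>M p\<in>I. lborel)"
  proof (rule measurable_restrict)
    fix p assume "p \<in> I"
    then have "(\<lambda>x. x (\<sigma> p)) \<in> measurable (\<Pi>\<^sub>M p\<in>I. lborel) (lborel :: real measure)"
      by (intro measurable_component_singleton \<sigma>I)
    then show "(\<lambda>x. \<epsilon> p * x (\<sigma> p)) \<in> measurable (\<Pi>\<^sub>M p\<in>I. lborel) lborel" by simp
  qed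
  define \<tau> where "\<tau> = inv_into I \<sigma>"
  have \<tau>: "\<tau> r \<in> I" "\<sigma> (\<tau> r) = r" if "r \<in> I" for r
    using \<sigma> that by (auto simp: \<tau>_def bij_betw_def inv_into_into f_inv_into_f)
  have \<tau>\<sigma>: "\<tau> (\<sigma> p) = p" if "p \<in> I" for p using \<sigma> that by (auto simp: \<tau>_def bij_betw_def)
  show ?thesis
  proof (rule PiM_eqI[OF I])
    fix A :: "'i \<Rightarrow> real set" assume A: "\<And>i. i \<in> I \<Longrightarrow> A i \<in> sets lborel"
    define B where "B = (\<lambda>r. (\<lambda>s. \<epsilon> (\<tau> r) * s) -` A (\<tau> r))"
    have mB: "B r \<in> sets lborel" if "r \<in> I" for r
      using measurable_sets[of "\<lambda>s::real. \<epsilon> (\<tau> r) * s" borel borel "A (\<tau> r)"] A[of "\<tau> r"] \<tau>(1)[OF that] by (simp add: B_def)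
    have eB: "emeasure lborel (B r) = emeasure lborel (A (\<tau> r))" if r: "r \<in> I" for r
    proof -
      have "emeasure lborel (A (\<tau> r)) = emeasure (density (distr lborel borel (\<lambda>x. 0 + \<epsilon> (\<tau> r) * x)) (\<lambda>_. \<bar>\<epsilon> (\<tau> r)\<bar>)) (A (\<tau> r))"
        using lborel_real_affine[of "\<epsilon> (\<tau> r)" 0] \<epsilon>[of "\<tau> r"] \<tau>(1)[OF r] by auto
      also have "density (distr lborel borel (\<lambda>x. 0 + \<epsilon> (\<tau> r) * x)) (\<lambda>_. \<bar>\<epsilon> (\<tau> r)\<bar>) = distr lborel borel (\<lambda>x. \<epsilon> (\<tau> r) * x)"
        using \<epsilon>[of "\<tau> r"] \<tau>(1)[OF r] by (auto simp: density_1)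
      also have "emeasure \<dots> (A (\<tau> r)) = emeasure lborel (B r)"
        using A[of "\<tau> r"] \<tau>(1)[OF r] by (subst emeasure_distr) (auto simp: B_def)
      finally show ?thesis by simp
    qed
    have "(\<lambda>x. \<lambda>p\<in>I. \<epsilon> p * x (\<sigma> p)) -` (Pi\<^sub>E I A) \<inter> space (\<Pi>\<^sub>M p\<in>I. lborel) = Pi\<^sub>E I B"
    proof (intro Set.set_eqI iffI)
      fix x assume x: "x \<in> (\<lambda>x. \<lambda>p\<in>I. \<epsilon> p * x (\<sigma> p)) -` (Pi\<^sub>E I A) \<inter> space (\<Pi>\<^sub>M p\<in>I. lborel)"
      have "x r \<in> B r" if r: "r \<in> I" for r
      proof -
        have "(\<lambda>p\<in>I. \<epsilon> p * x (\<sigma> p)) (\<tau> r) \<in> A (\<tau> r)" using x \<tau>(1)[OF r] by (auto simp: PiE_def Pi_def)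
        then show ?thesis using \<tau>[OF r] by (simp add: B_def)
      qed
      then show "x \<in> Pi\<^sub>E I B" using x by (auto simp: space_PiM PiE_def)
    next
      fix x assume x: "x \<in> Pi\<^sub>E I B"
      have "\<epsilon> p * x (\<sigma> p) \<in> A p" if p: "p \<in> I" for p
        using PiE_mem[OF x \<sigma>I[OF p]] \<tau>\<sigma>[OF p] by (simp add: B_def)
      then show "x \<in> (\<lambda>x. \<lambda>p\<in>I. \<epsilon> p * x (\<sigma> p)) -` (Pi\<^sub>E I A) \<inter> space (\<Pi>\<^sub>M p\<in>I. lborel)"
        using x by (auto simp: space_PiM PiE_def)
    qed
    then have "emeasure (distr (\<Pi>\<^sub>M p\<in>I. lborel) (\<Pi>\<^sub>M p\<in>I. lborel) (\<lambda>x. \<lambda>p\<in>I. \<epsilon> p * x (\<sigma> p))) (Pi\<^sub>E I A) = emeasure (\<Pi>\<^sub>M p\<in>I. lborel) (Pi\<^sub>E I B)"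
      using A I by (subst emeasure_distr[OF meas]) (auto intro!: sets_PiM_I_finite)
    also have "\<dots> = (\<Prod>r\<in>I. emeasure lborel (A (\<tau> r)))"
      using mB by (simp add: emeasure_PiM I eB cong: prod.cong)
    also have "\<dots> = (\<Prod>p\<in>I. emeasure lborel (A p))"
      by (rule prod.reindex_bij_betw) (unfold \<tau>_def, rule bij_betw_inv_into[OF \<sigma>])
    finally show "emeasure (distr (\<Pi>\<^sub>M p\<in>I. lborel) (\<Pi>\<^sub>M p\<in>I. lborel) (\<lambda>x. \<lambda>p\<in>I. \<epsilon> p * x (\<sigma> p))) (Pi\<^sub>E I A) = (\<Prod>p\<in>I. emeasure lborel (A p))" .
  qed simp
qed

section \<open>Operator norms and nets\<close>

definition vnorm :: "nat \<Rightarrow> (nat \<Rightarrow> complex) \<Rightarrow> real" where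
  "vnorm N u = L2_set (\<lambda>a. cmod (u a)) {..<N}"

text \<open>Bilinear, without conjugation: both vectors range over the whole space, so a bound on it
  is still a bound on the operator norm, and scalars leave both arguments in the same way.\<close>

definition bform :: "nat \<Rightarrow> (nat \<Rightarrow> nat \<Rightarrow> complex) \<Rightarrow> (nat \<Rightarrow> complex) \<Rightarrow> (nat \<Rightarrow> complex) \<Rightarrow> complex" where
  "bform N X u v = (\<Sum>a<N. \<Sum>b<N. u a * X a b * v b)"

fun entry :: "nat \<Rightarrow> (nat \<Rightarrow> nat \<Rightarrow> nat \<Rightarrow> complex) \<Rightarrow> nat list \<Rightarrow> nat \<Rightarrow> nat \<Rightarrow> complex" where
  "entry N A [] a b = (if a = b then 1 else 0)"
| "entry N A (i # w) a b = (\<Sum>k<N. A i a k * entry N A w k b)"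

lemma vnorm_nonneg [simp]: "0 \<le> vnorm N u"
  by (simp add: vnorm_def)

lemma vnorm_triangle: "vnorm N (\<lambda>a. u a + v a) \<le> vnorm N u + vnorm N v"
proof -
  have "vnorm N (\<lambda>a. u a + v a) \<le> L2_set (\<lambda>a. cmod (u a) + cmod (v a)) {..<N}"
    unfolding vnorm_def by (intro L2_set_mono norm_triangle_ineq) auto
  also have "\<dots> \<le> vnorm N u + vnorm N v" unfolding vnorm_def by (rule L2_set_triangle_ineq)
  finally show ?thesis .
qed

lemma vnorm_scale: "vnorm N (\<lambda>a. c * u a) = cmod c * vnorm N u"
  unfolding vnorm_def norm_mult by (rule L2_set_right_distrib[symmetric]) simp

lemma cmod_le_vnorm: "a < N \<Longrightarrow> cmod (u a) \<le> vnorm N u"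
  unfolding vnorm_def by (rule member_le_L2_set) auto

lemma vnorm_square: "(vnorm N u)\<^sup>2 = (\<Sum>a<N. (cmod (u a))\<^sup>2)"
  by (simp add: vnorm_def L2_set_def sum_nonneg)

lemma sum_cmod_mult_le: "(\<Sum>a<N. cmod (u a) * cmod (v a)) \<le> vnorm N u * vnorm N v"
  using L2_set_mult_ineq[of "\<lambda>a. cmod (u a)" "\<lambda>a. cmod (v a)" "{..<N}"] by (simp add: vnorm_def)

lemma bform_scale: "bform N X (\<lambda>a. c * u a) (\<lambda>a. d * v a) = c * d * bform N X u v"
  by (simp add: bform_def sum_distrib_left mult_ac)

lemma bform_split: "bform N X u v = bform N X u' v' + bform N X (\<lambda>a. u a - u' a) v + bform N X u' (\<lambda>a. v a - v' a)"
  by (simp add: bform_def sum.distrib[symmetric] algebra_simps)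

text \<open>Weight an integer vector by \<open>1/2\<close> to the power of its l1-norm. Every point
  of the ball has weight at least \<open>(1/2) ^ L\<close>, and the total weight factorizes with a
  factor at most 3 for each of the \<open>2 * N\<close> real coordinates.\<close>

lemma card_lattice_ball_le:
  fixes G :: "int set" and N L M :: nat
  assumes G: "G = {- int M..int M}"
  defines "Z \<equiv> {z \<in> {..<N} \<rightarrow>\<^sub>E G \<times> G. (\<Sum>a<N. \<bar>fst (z a)\<bar> + \<bar>snd (z a)\<bar>) \<le> int L}"
  shows "real (card Z) \<le> 2 ^ L * 9 ^ N"
proof -
  define h where "h = (\<lambda>z. \<Prod>a<N. (1/2) ^ nat \<bar>fst (z a)\<bar> * (1/2::real) ^ nat \<bar>snd (z a)\<bar>)"
  have finG: "finite G" by (simp add: G)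
  have fin: "finite ({..<N} \<rightarrow>\<^sub>E G \<times> G)" using finG by (intro finite_PiE) auto
  have half: "(\<Sum>j\<in>G. (1/2::real) ^ nat \<bar>j\<bar>) \<le> 3"
  proof -
    have "(\<Sum>j\<in>{- int M..int M}. (1/2::real) ^ nat \<bar>j\<bar>) \<le> 3 - 2 * (1/2) ^ M"
    proof (induction M)
      case (Suc M)
      have "{- int (Suc M)..int (Suc M)} = insert (- int (Suc M)) (insert (int (Suc M)) {- int M..int M})" by auto
      moreover have "nat \<bar>int (Suc M)\<bar> = Suc M" "nat \<bar>- int (Suc M)\<bar> = Suc M" by auto
      ultimately show ?case using Suc by (simp del: of_nat_Suc)
    qed simp
    also have "\<dots> \<le> 3" by simp
    finally show ?thesis by (simp add: G)
  qed
  have "real (card Z) = (\<Sum>z\<in>Z. 1)" by simp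
  also have "\<dots> \<le> (\<Sum>z\<in>Z. 2 ^ L * h z)"
  proof (rule sum_mono)
    fix z assume z: "z \<in> Z"
    have "int (\<Sum>a<N. nat \<bar>fst (z a)\<bar> + nat \<bar>snd (z a)\<bar>) = (\<Sum>a<N. \<bar>fst (z a)\<bar> + \<bar>snd (z a)\<bar>)" by simp
    also have "\<dots> \<le> int L" using z by (simp add: Z_def)
    finally have le: "(\<Sum>a<N. nat \<bar>fst (z a)\<bar> + nat \<bar>snd (z a)\<bar>) \<le> L" by (simp only: of_nat_le_iff)
    have "h z = (1/2) ^ (\<Sum>a<N. nat \<bar>fst (z a)\<bar> + nat \<bar>snd (z a)\<bar>)"
      by (simp add: h_def power_add[symmetric] power_sum)
    moreover have "(1/2::real) ^ L \<le> (1/2) ^ (\<Sum>a<N. nat \<bar>fst (z a)\<bar> + nat \<bar>snd (z a)\<bar>)"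
      using le by (intro power_decreasing) auto
    ultimately have "2 ^ L * (1/2) ^ L \<le> 2 ^ L * h z" by (intro mult_left_mono) auto
    then show "1 \<le> 2 ^ L * h z" by (simp add: power_mult_distrib[symmetric])
  qed
  also have "\<dots> \<le> (\<Sum>z\<in>{..<N} \<rightarrow>\<^sub>E G \<times> G. 2 ^ L * h z)"
    using fin by (intro sum_mono2) (auto simp: Z_def h_def prod_nonneg)
  also have "\<dots> = 2 ^ L * (\<Sum>z\<in>{..<N} \<rightarrow>\<^sub>E G \<times> G. h z)" by (simp add: sum_distrib_left)
  also have "(\<Sum>z\<in>{..<N} \<rightarrow>\<^sub>E G \<times> G. h z) = (\<Prod>a<N. \<Sum>y\<in>G \<times> G. (1/2) ^ nat \<bar>fst y\<bar> * (1/2::real) ^ nat \<bar>snd y\<bar>)"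
    unfolding h_def using finG by (subst prod_sum_PiE) auto
  also have "(\<Sum>y\<in>G \<times> G. (1/2) ^ nat \<bar>fst y\<bar> * (1/2::real) ^ nat \<bar>snd y\<bar>) = (\<Sum>j\<in>G. (1/2) ^ nat \<bar>j\<bar>) * (\<Sum>j\<in>G. (1/2) ^ nat \<bar>j\<bar>)"
    by (simp add: sum_product sum.cartesian_product case_prod_beta)
  also have "(\<Prod>a<N. (\<Sum>j\<in>G. (1/2) ^ nat \<bar>j\<bar>) * (\<Sum>j\<in>G. (1/2::real) ^ nat \<bar>j\<bar>)) \<le> (\<Prod>a<N. 3 * 3)"
    using half by (intro prod_mono conjI mult_mono mult_nonneg_nonneg sum_nonneg) auto
  finally show ?thesis by simp
qed

text \<open>Round down to the lattice of mesh \<open>1 / (8 * sqrt N)\<close>: the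
  \<open>2 * N\<close> real coordinates move by at most the mesh, so the squared distance is at most
  \<open>1/32\<close>. What matters about the cardinality is that it is exponential in
  \<open>N\<close> with a universal base.\<close>

lemma exists_net:
  obtains S :: "(nat \<Rightarrow> complex) set" where "finite S" "real (card S) \<le> (2 ^ 104) ^ N"
    "\<And>u. u \<in> S \<Longrightarrow> vnorm N u \<le> 2"
    "\<And>u. vnorm N u \<le> 1 \<Longrightarrow> \<exists>u'\<in>S. vnorm N (\<lambda>a. u a - u' a) \<le> 1/4"
proof (cases "N = 0")
  case True
  then show thesis by (intro that[of "{\<lambda>_. 0}"]) (auto simp: vnorm_def L2_set_def)
next
  case False
  define s where "s = sqrt (real N)"
  have s: "s > 0" "s\<^sup>2 = real N" using False by (auto simp: s_def)
  \<comment> \<open>An integer satisfies \<open>\<bar>j\<bar> \<le> j\<^sup>2\<close>, and rounded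
    unit vectors have norm at most \<open>5/4\<close>. In lattice units the l1-norm is therefore at
    most \<open>64 * N * (5/4)\<^sup>2 = 100 * N\<close>.\<close>
  define L where "L = 100 * N"
  define G where "G = {- int L..int L}"
  define Z where "Z = {z \<in> {..<N} \<rightarrow>\<^sub>E G \<times> G. (\<Sum>a<N. \<bar>fst (z a)\<bar> + \<bar>snd (z a)\<bar>) \<le> int L}"
  define vec where "vec = (\<lambda>z (a::nat). Complex (real_of_int (fst (z a)) / (8 * s)) (real_of_int (snd (z a)) / (8 * s)))"
  have finZ: "finite Z" unfolding Z_def
    by (rule finite_subset[of _ "{..<N} \<rightarrow>\<^sub>E G \<times> G"]) (auto simp: G_def intro!: finite_PiE)
  define S where "S = {u \<in> vec ` Z. vnorm N u \<le> 2}"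
  have finS: "finite S" using finZ by (auto simp: S_def)
  have "card S \<le> card (vec ` Z)" using finZ by (intro card_mono) (auto simp: S_def)
  also have "\<dots> \<le> card Z" using finZ by (rule card_image_le)
  finally have "real (card S) \<le> 2 ^ L * 9 ^ N" using card_lattice_ball_le[OF G_def, of N L] by (simp only: Z_def)
  also have "\<dots> \<le> (2 ^ 100) ^ N * (2 ^ 4) ^ N" by (intro mult_mono) (auto simp: L_def power_mult intro: power_mono)
  also have "\<dots> = (2 ^ 104) ^ N" by (simp add: power_mult_distrib[symmetric])
  finally have cardS: "real (card S) \<le> (2 ^ 104) ^ N" .
  show thesis
  proof (rule that[OF finS cardS])
    fix u assume u: "vnorm N u \<le> 1"
    define z where "z = (\<lambda>a\<in>{..<N}. (\<lfloor>Re (u a) * (8 * s)\<rfloor>, \<lfloor>Im (u a) * (8 * s)\<rfloor>))"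
    define u' where "u' = vec z"
    have fl: "\<bar>x - real_of_int \<lfloor>x * (8 * s)\<rfloor> / (8 * s)\<bar> \<le> 1 / (8 * s)" for x
    proof -
      have "\<bar>x * (8 * s) - real_of_int \<lfloor>x * (8 * s)\<rfloor>\<bar> \<le> 1" by linarith
      then have "\<bar>x * (8 * s) - real_of_int \<lfloor>x * (8 * s)\<rfloor>\<bar> / (8 * s) \<le> 1 / (8 * s)" using s by (intro divide_right_mono) auto
      moreover have "x - real_of_int \<lfloor>x * (8 * s)\<rfloor> / (8 * s) = (x * (8 * s) - real_of_int \<lfloor>x * (8 * s)\<rfloor>) / (8 * s)"
        using s by (simp add: field_simps)
      ultimately show ?thesis using s by (simp add: abs_divide)
    qed
    have "(vnorm N (\<lambda>a. u a - u' a))\<^sup>2 = (\<Sum>a<N. (Re (u a - u' a))\<^sup>2 + (Im (u a - u' a))\<^sup>2)"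
      by (simp add: vnorm_square cmod_power2)
    also have "\<dots> \<le> (\<Sum>a<N. (1 / (8 * s))\<^sup>2 + (1 / (8 * s))\<^sup>2)"
    proof (intro sum_mono add_mono)
      fix a assume "a \<in> {..<N}"
      then have "\<bar>Re (u a - u' a)\<bar> \<le> 1 / (8 * s)" "\<bar>Im (u a - u' a)\<bar> \<le> 1 / (8 * s)"
        using fl[of "Re (u a)"] fl[of "Im (u a)"] by (auto simp: u'_def vec_def z_def)
      then show "(Re (u a - u' a))\<^sup>2 \<le> (1 / (8 * s))\<^sup>2" "(Im (u a - u' a))\<^sup>2 \<le> (1 / (8 * s))\<^sup>2"
        using s by (auto simp flip: abs_le_square_iff)
    qed
    also have "\<dots> = 1 / 32" using s False by (simp add: power_divide power_mult_distrib)
    also have "\<dots> \<le> (1/4)\<^sup>2" by (simp add: power2_eq_square)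
    finally have near: "vnorm N (\<lambda>a. u a - u' a) \<le> 1/4" by (rule power2_le_imp_le) simp
    have "vnorm N u' = vnorm N (\<lambda>a. u a + (- 1) * (u a - u' a))" by simp
    also have "\<dots> \<le> vnorm N u + vnorm N (\<lambda>a. (-1) * (u a - u' a))" by (rule vnorm_triangle)
    also have "\<dots> \<le> 5/4" using u near unfolding vnorm_scale by simp
    finally have n2: "vnorm N u' \<le> 5/4" .
    have sq: "(\<Sum>a<N. (real_of_int (fst (z a)))\<^sup>2 + (real_of_int (snd (z a)))\<^sup>2) = 64 * real N * (vnorm N u')\<^sup>2"
      using s unfolding vnorm_square sum_distrib_left
      by (intro sum.cong refl) (simp add: u'_def vec_def cmod_power2 power_divide power_mult_distrib field_simps)
    have "real_of_int (\<Sum>a<N. \<bar>fst (z a)\<bar> + \<bar>snd (z a)\<bar>) \<le> (\<Sum>a<N. (real_of_int (fst (z a)))\<^sup>2 + (real_of_int (snd (z a)))\<^sup>2)"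
    proof -
      have le: "\<bar>j\<bar> \<le> j\<^sup>2" for j :: int
      proof (cases "j = 0")
        case False
        then have "\<bar>j\<bar> * 1 \<le> \<bar>j\<bar> * \<bar>j\<bar>" by (intro mult_left_mono) auto
        then show ?thesis by (simp add: power2_eq_square)
      qed simp
      have "(\<Sum>a<N. \<bar>fst (z a)\<bar> + \<bar>snd (z a)\<bar>) \<le> (\<Sum>a<N. (fst (z a))\<^sup>2 + (snd (z a))\<^sup>2)" by (intro sum_mono add_mono le)
      then have "real_of_int (\<Sum>a<N. \<bar>fst (z a)\<bar> + \<bar>snd (z a)\<bar>) \<le> real_of_int (\<Sum>a<N. (fst (z a))\<^sup>2 + (snd (z a))\<^sup>2)"
        by (simp only: of_int_le_iff)
      then show ?thesis by simp
    qed
    also note sq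
    also have "64 * real N * (vnorm N u')\<^sup>2 \<le> 64 * real N * (5/4)\<^sup>2"
      using n2 by (intro mult_left_mono power_mono) auto
    also have "\<dots> = real_of_int (int L)" by (simp add: L_def power2_eq_square)
    finally have tot: "(\<Sum>a<N. \<bar>fst (z a)\<bar> + \<bar>snd (z a)\<bar>) \<le> int L" by (simp only: of_int_le_iff)
    have "z a \<in> G \<times> G" if a: "a < N" for a
    proof -
      have "\<bar>fst (z a)\<bar> + \<bar>snd (z a)\<bar> \<le> (\<Sum>a<N. \<bar>fst (z a)\<bar> + \<bar>snd (z a)\<bar>)" using a by (intro member_le_sum) auto
      then have "\<bar>fst (z a)\<bar> \<le> int L" "\<bar>snd (z a)\<bar> \<le> int L" using tot by linarith+
      then show ?thesis by (auto simp: G_def mem_Times_iff)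
    qed
    then have "z \<in> Z" using tot by (auto simp: Z_def z_def)
    then have "u' \<in> S" using n2 by (auto simp: S_def u'_def)
    then show "\<exists>u'\<in>S. vnorm N (\<lambda>a. u a - u' a) \<le> 1/4" using near by blast
  qed (simp add: S_def)
qed

section \<open>Operator bounds and entries of words\<close>

definition op_bounded :: "nat \<Rightarrow> (nat \<Rightarrow> nat \<Rightarrow> complex) \<Rightarrow> real \<Rightarrow> bool" where
  "op_bounded N X K \<longleftrightarrow> (\<forall>u v. cmod (bform N X u v) \<le> K * vnorm N u * vnorm N v)"

text \<open>The supremum \<open>K\<close> over the unit ball satisfies
  \<open>K \<le> Q + 3/4 * K\<close>: a quarter comes from the error in \<open>u\<close>, a half
  from the error in \<open>v\<close> paired with a net vector of norm at most 2.\<close>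

lemma op_bounded_from_net:
  assumes S: "finite S" "\<And>u. u \<in> S \<Longrightarrow> vnorm N u \<le> 2"
    and net: "\<And>u. vnorm N u \<le> 1 \<Longrightarrow> \<exists>u'\<in>S. vnorm N (\<lambda>a. u a - u' a) \<le> 1/4"
    and Q: "\<And>u v. u \<in> S \<Longrightarrow> v \<in> S \<Longrightarrow> cmod (bform N X u v) \<le> Q"
  shows "op_bounded N X (4 * Q)"
proof -
  define T where "T = {cmod (bform N X u v) |u v. vnorm N u \<le> 1 \<and> vnorm N v \<le> 1}"
  define K where "K = Sup T"
  have ne: "T \<noteq> {}"
    unfolding T_def by (auto intro!: exI[of _ "\<lambda>_. 0"] simp: vnorm_def L2_set_def)
  \<comment> \<open>The supremum has to be finite before it can be absorbed; the sum of all absolute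
    entries is a crude bound.\<close>
  have bdd: "bdd_above T"
  proof (rule bdd_aboveI)
    fix y assume "y \<in> T"
    then obtain u v where y: "y = cmod (bform N X u v)" "vnorm N u \<le> 1" "vnorm N v \<le> 1" by (auto simp: T_def)
    have "y \<le> (\<Sum>a<N. \<Sum>b<N. cmod (u a * X a b * v b))"
      unfolding y bform_def by (intro order_trans[OF norm_sum] sum_mono norm_sum)
    also have "\<dots> \<le> (\<Sum>a<N. \<Sum>b<N. cmod (X a b))"
    proof (intro sum_mono)
      fix a b assume ab: "a \<in> {..<N}" "b \<in> {..<N}"
      have "cmod (u a) \<le> 1" "cmod (v b) \<le> 1" using ab y cmod_le_vnorm[of a N u] cmod_le_vnorm[of b N v] by auto
      then have "cmod (u a) * cmod (X a b) * cmod (v b) \<le> 1 * cmod (X a b) * 1" by (intro mult_mono) auto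
      then show "cmod (u a * X a b * v b) \<le> cmod (X a b)" by (simp add: norm_mult)
    qed
    finally show "y \<le> (\<Sum>a<N. \<Sum>b<N. cmod (X a b))" .
  qed
  have unit: "cmod (bform N X u v) \<le> K" if "vnorm N u \<le> 1" "vnorm N v \<le> 1" for u v
    unfolding K_def using that by (intro cSup_upper bdd) (auto simp: T_def)
  have K0: "0 \<le> K" using unit[of "\<lambda>_. 0" "\<lambda>_. 0"] by (simp add: vnorm_def L2_set_def bform_def)
  have scaled: "cmod (bform N X u v) \<le> K * vnorm N u * vnorm N v" for u v
  proof (cases "vnorm N u = 0 \<or> vnorm N v = 0")
    case True
    then have "(\<forall>a<N. u a = 0) \<or> (\<forall>a<N. v a = 0)" by (auto simp: vnorm_def L2_set_eq_0_iff)
    then have "bform N X u v = 0" by (auto simp: bform_def)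
    then show ?thesis using K0 by simp
  next
    case False
    define p q where "p = vnorm N u" and "q = vnorm N v"
    have pq: "p > 0" "q > 0" using False by (auto simp: p_def q_def less_le)
    have "cmod (bform N X (\<lambda>a. of_real (1/p) * u a) (\<lambda>a. of_real (1/q) * v a)) \<le> K"
      using pq by (intro unit) (simp_all only: vnorm_scale norm_of_real p_def[symmetric] q_def[symmetric], auto)
    then have "cmod (bform N X u v) / (p * q) \<le> K" unfolding bform_scale using pq by (simp add: norm_mult norm_divide)
    then show ?thesis using pq unfolding p_def[symmetric] q_def[symmetric] by (simp add: field_simps)
  qed
  have "K \<le> Q + 3/4 * K"
    unfolding K_def
  proof (rule cSup_least[OF ne])
    fix y assume "y \<in> T"
    then obtain u v where y: "y = cmod (bform N X u v)" "vnorm N u \<le> 1" "vnorm N v \<le> 1" by (auto simp: T_def)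
    obtain u' v' where u': "u' \<in> S" "vnorm N (\<lambda>a. u a - u' a) \<le> 1/4" and v': "v' \<in> S" "vnorm N (\<lambda>a. v a - v' a) \<le> 1/4"
      using net y by blast
    have "y \<le> cmod (bform N X u' v') + cmod (bform N X (\<lambda>a. u a - u' a) v) + cmod (bform N X u' (\<lambda>a. v a - v' a))"
      unfolding y bform_split[of N X u v u' v'] by (intro order_trans[OF norm_triangle_ineq] add_mono norm_triangle_ineq) auto
    also have "\<dots> \<le> Q + K * (1/4) * 1 + K * 2 * (1/4)"
    proof (intro add_mono Q u' v')
      show "cmod (bform N X (\<lambda>a. u a - u' a) v) \<le> K * (1/4) * 1"
        by (rule order_trans[OF scaled], intro mult_mono) (use K0 u' y in auto)
      show "cmod (bform N X u' (\<lambda>a. v a - v' a)) \<le> K * 2 * (1/4)"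
        by (rule order_trans[OF scaled], intro mult_mono) (use K0 u' v' S in auto)
    qed
    finally show "y \<le> Q + 3/4 * Sup T" by (simp add: K_def)
  qed
  then have K: "K \<le> 4 * Q" by simp
  show ?thesis unfolding op_bounded_def
  proof (intro allI)
    fix u v
    show "cmod (bform N X u v) \<le> 4 * Q * vnorm N u * vnorm N v"
      by (rule order_trans[OF scaled], intro mult_right_mono K) auto
  qed
qed

text \<open>Test the form against the conjugate of the image vector.\<close>

lemma op_bounded_apply:
  assumes "op_bounded N X K" "0 \<le> K"
  shows "vnorm N (\<lambda>a. \<Sum>b<N. X a b * v b) \<le> K * vnorm N v"
proof -
  define y where "y = (\<lambda>a. \<Sum>b<N. X a b * v b)"
  have "bform N X (\<lambda>a. cnj (y a)) v = (\<Sum>a<N. cnj (y a) * y a)"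
    by (simp add: bform_def y_def sum_distrib_left mult.assoc)
  also have "\<dots> = of_real ((vnorm N y)\<^sup>2)"
    by (simp add: vnorm_square complex_norm_square mult.commute del: of_real_power) 
  finally have "(vnorm N y)\<^sup>2 = cmod (bform N X (\<lambda>a. cnj (y a)) v)" by (simp del: of_real_power)
  also have "\<dots> \<le> K * vnorm N (\<lambda>a. cnj (y a)) * vnorm N v" using assms by (simp add: op_bounded_def)
  also have "vnorm N (\<lambda>a. cnj (y a)) = vnorm N y" by (simp add: vnorm_def)
  finally have "vnorm N y * vnorm N y \<le> vnorm N y * (K * vnorm N v)" by (simp add: power2_eq_square mult_ac)
  then have "vnorm N y \<le> K * vnorm N v"
    using assms by (cases "vnorm N y = 0") (auto simp: mult_le_cancel_left less_le)
  then show ?thesis by (simp add: y_def)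
qed

lemma entry_vnorm:
  assumes "0 \<le> K" "\<And>i. i \<in> set w \<Longrightarrow> op_bounded N (A i) K"
  shows "vnorm N (\<lambda>a. \<Sum>b<N. entry N A w a b * v b) \<le> K ^ length w * vnorm N v"
  using assms(2)
proof (induction w)
  case Nil
  have "vnorm N (\<lambda>a. \<Sum>b<N. (if a = b then 1 else 0) * v b) = vnorm N v"
    unfolding vnorm_def by (intro L2_set_cong refl) (simp add: if_distrib[of "\<lambda>z. z * _"] cong: if_cong)
  then show ?case by simp
next
  case (Cons i w)
  have "(\<Sum>b<N. entry N A (i # w) a b * v b) = (\<Sum>k<N. A i a k * (\<Sum>b<N. entry N A w k b * v b))" for a
    by (simp add: sum_distrib_left sum_distrib_right mult.assoc) (rule sum.swap)
  then have "vnorm N (\<lambda>a. \<Sum>b<N. entry N A (i # w) a b * v b) \<le> K * vnorm N (\<lambda>a. \<Sum>b<N. entry N A w a b * v b)"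
    using op_bounded_apply[of N "A i" K] Cons.prems assms(1) by simp
  also have "\<dots> \<le> K * (K ^ length w * vnorm N v)" using Cons assms(1) by (intro mult_left_mono) auto
  finally show ?case by (simp add: mult.assoc)
qed

lemma cmod_entry_diag_le:
  assumes "0 \<le> K" "\<And>i. i \<in> set w \<Longrightarrow> op_bounded N (A i) K" "a < N"
  shows "cmod (entry N A w a a) \<le> K ^ length w"
proof -
  define e where "e = (\<lambda>b::nat. if b = a then 1 else 0 :: complex)"
  have e: "vnorm N e = 1"
  proof -
    have "(vnorm N e)\<^sup>2 = (\<Sum>b<N. if b = a then 1 else 0)" unfolding vnorm_square by (intro sum.cong) (auto simp: e_def)
    then show ?thesis using assms(3) by (simp add: power2_eq_1_iff) (metis vnorm_nonneg not_one_le_zero neg_0_le_iff_le)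
  qed
  have "cmod (entry N A w a a) = cmod ((\<lambda>c. \<Sum>b<N. entry N A w c b * e b) a)"
    using assms(3) by (simp add: e_def if_distrib[of "\<lambda>z. _ * z"] cong: if_cong)
  also have "\<dots> \<le> vnorm N (\<lambda>c. \<Sum>b<N. entry N A w c b * e b)" by (rule cmod_le_vnorm[OF assms(3)])
  also have "\<dots> \<le> K ^ length w * vnorm N e" using assms by (intro entry_vnorm)
  finally show ?thesis by (simp add: e)
qed

section \<open>Strongly log-concave Gibbs measures\<close>

text \<open>Along a line, the squared norm differs from \<open>s\<^sup>2 * sqnorm I v\<close> by an
  affine function of \<open>s\<close>, so this is convexity of \<open>W\<close> minus
  \<open>\<kappa> / 2\<close> times the squared norm. No derivative occurs, and the condition passes
  directly to convex combinations.\<close>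

definition strongly_convex :: "'i set \<Rightarrow> real \<Rightarrow> (('i \<Rightarrow> real) \<Rightarrow> real) \<Rightarrow> bool" where
  "strongly_convex I \<kappa> W \<longleftrightarrow>
     (\<forall>x v. convex_on UNIV (\<lambda>s. W (\<lambda>i. x i + s * v i) - \<kappa> / 2 * s\<^sup>2 * sqnorm I v))"

text \<open>\<open>W\<close> has complex type but real values, so that the calculus of
  \<open>cpoly\<close> applies to it. In the matrix model \<kappa> is proportional to
  \<open>N\<close>.\<close>

locale gibbs_measure =
  fixes I :: "'i set" and W :: "('i \<Rightarrow> real) \<Rightarrow> complex" and \<kappa> :: real
  assumes finite_I: "finite I" and cpoly_W: "cpoly I W" and real_W: "\<And>x. W x \<in> \<real>"
    and \<kappa>: "0 < \<kappa>" and convex_W: "strongly_convex I \<kappa> (\<lambda>x. Re (W x))"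
begin

abbreviation "lebesgue_I \<equiv> \<Pi>\<^sub>M p\<in>I. (lborel :: real measure)"

definition weight :: "('i \<Rightarrow> real) \<Rightarrow> real" where
  "weight x = exp (- Re (W x))"

definition partition :: real where
  "partition = (\<integral>x. weight x \<partial>lebesgue_I)"

definition expect :: "(('i \<Rightarrow> real) \<Rightarrow> 'b) \<Rightarrow> 'b::{banach, second_countable_topology}" where
  "expect f = (\<integral>x. weight x *\<^sub>R f x \<partial>lebesgue_I) /\<^sub>R partition"

definition integr :: "(('i \<Rightarrow> real) \<Rightarrow> 'b::{banach, second_countable_topology}) \<Rightarrow> bool" where
  "integr f \<longleftrightarrow> integrable lebesgue_I (\<lambda>x. weight x *\<^sub>R f x)"

definition slope :: "('i \<Rightarrow> real) \<Rightarrow> ('i \<Rightarrow> real) \<Rightarrow> real" where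
  "slope x v = Re (\<Sum>p\<in>I. of_real (v p) * pd p W x)"

lemma weight_pos [simp]: "0 < weight x"
  by (simp add: weight_def)

lemma weight_measurable [measurable]: "weight \<in> borel_measurable lebesgue_I"
proof -
  have [measurable]: "W \<in> borel_measurable lebesgue_I" using cpoly_W by (rule cpoly_measurable)
  show ?thesis unfolding weight_def[abs_def] by measurable
qed

lemma exp_W: "exp (- W x) = of_real (weight x)"
  using real_W[of x] by (auto simp: weight_def Reals_def exp_of_real simp flip: of_real_minus)

lemma line_derivative:
  "((\<lambda>s. Re (W (\<lambda>i. x i + s * v i)) - \<kappa> / 2 * s\<^sup>2 * sqnorm I v) has_real_derivative
     slope (\<lambda>i. x i + s * v i) v - \<kappa> * s * sqnorm I v) (at s)"
proof -
  have "((\<lambda>s. Re (W (\<lambda>i. x i + s * v i))) has_real_derivative slope (\<lambda>i. x i + s * v i) v) (at s)"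
    unfolding slope_def using bounded_linear.has_vector_derivative[OF bounded_linear_Re pd_line[OF finite_I cpoly_W]]
    by (simp add: has_real_derivative_iff_has_vector_derivative)
  moreover have "((\<lambda>s. \<kappa> / 2 * s\<^sup>2 * sqnorm I v) has_real_derivative \<kappa> * s * sqnorm I v) (at s)"
    by (auto intro!: derivative_eq_intros)
  ultimately show ?thesis by (rule DERIV_diff)
qed

text \<open>Tangent inequalities at both ends of the segment from 0 to \<open>x\<close>, for
  \<open>W\<close> with its quadratic part removed.\<close>

lemma slope_monotone:
  fixes x :: "'i \<Rightarrow> real"
  defines "z \<equiv> \<lambda>_. 0"
  shows "\<kappa> * sqnorm I x \<le> slope x x - slope z x"
    and "Re (W z) + slope z x + \<kappa> / 2 * sqnorm I x \<le> Re (W x)"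
proof -
  define g where "g = (\<lambda>s. Re (W (\<lambda>i. z i + s * x i)) - \<kappa> / 2 * s\<^sup>2 * sqnorm I x)"
  have conv: "convex_on UNIV g" using convex_W unfolding strongly_convex_def g_def by blast
  have d: "(g has_real_derivative slope (\<lambda>i. z i + s * x i) x - \<kappa> * s * sqnorm I x) (at s)" for s
    unfolding g_def by (rule line_derivative)
  have tangent: "g s - g r \<ge> (slope (\<lambda>i. z i + r * x i) x - \<kappa> * r * sqnorm I x) * (s - r)" for s r
    by (rule convex_on_imp_above_tangent[OF conv]) (auto intro: d)
  show "\<kappa> * sqnorm I x \<le> slope x x - slope z x" "Re (W z) + slope z x + \<kappa> / 2 * sqnorm I x \<le> Re (W x)"
    using tangent[of 0 1] tangent[of 1 0] by (simp_all add: g_def z_def)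
qed

text \<open>The linear term of the tangent bound at the origin is absorbed by completing the square,
  which costs half of the quadratic coefficient \<open>\<kappa> / 2\<close>.\<close>

lemma growth:
  obtains B where "\<And>x. \<kappa> / 4 * sqnorm I x - B \<le> Re (W x)"
proof -
  define z :: "'i \<Rightarrow> real" where "z = (\<lambda>_. 0)"
  define b where "b = (\<lambda>p. Re (pd p W z))"
  have "\<kappa> / 4 * sqnorm I x - ((\<Sum>p\<in>I. (b p)\<^sup>2) / \<kappa> - Re (W z)) \<le> Re (W x)" for x
  proof -
    have "slope z x = (\<Sum>p\<in>I. x p * b p)" by (simp add: slope_def b_def)
    moreover have "- (\<Sum>p\<in>I. x p * b p) \<le> (\<Sum>p\<in>I. \<kappa> / 4 * (x p)\<^sup>2 + (b p)\<^sup>2 / \<kappa>)"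
      unfolding sum_negf[symmetric]
    proof (rule sum_mono)
      fix p
      have "0 \<le> (\<kappa> * x p + 2 * b p)\<^sup>2 / (4 * \<kappa>)" using \<kappa> by simp
      also have "\<dots> = \<kappa> / 4 * (x p)\<^sup>2 + (b p)\<^sup>2 / \<kappa> + x p * b p"
        using \<kappa> by (simp add: power2_eq_square field_simps)
      finally show "- (x p * b p) \<le> \<kappa> / 4 * (x p)\<^sup>2 + (b p)\<^sup>2 / \<kappa>" by simp
    qed
    moreover have "(\<Sum>p\<in>I. \<kappa> / 4 * (x p)\<^sup>2 + (b p)\<^sup>2 / \<kappa>) = \<kappa> / 4 * sqnorm I x + (\<Sum>p\<in>I. (b p)\<^sup>2) / \<kappa>"
      by (simp add: sum.distrib sqnorm_def sum_distrib_left sum_divide_distrib)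
    ultimately show ?thesis using slope_monotone(2)[of x] by (simp add: z_def)
  qed
  then show thesis using that by blast
qed

lemma integr_cpoly [intro]: "cpoly I f \<Longrightarrow> integr f"
proof -
  assume f: "cpoly I f"
  obtain B where B: "\<And>x. \<kappa> / 4 * sqnorm I x - B \<le> Re (W x)" using growth by blast
  have "integrable lebesgue_I (\<lambda>x. f x * exp (- W x))"
    by (rule integrable_cpoly_exp[OF finite_I f cpoly_W _ B]) (use \<kappa> in simp)
  then show ?thesis by (simp add: integr_def exp_W scaleR_conv_of_real mult.commute)
qed

lemma integr_const [intro]: "integr (\<lambda>x. c)"
proof -
  have "integr (\<lambda>x. 1 :: complex)" by (intro integr_cpoly cpoly.const)
  then have "integrable lebesgue_I weight" using integrable_Re by (fastforce simp: integr_def)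
  then show ?thesis by (simp add: integr_def)
qed

lemma partition_pos: "0 < partition"
proof -
  interpret product_sigma_finite "\<lambda>_::'i. lborel :: real measure" by standard
  have int: "integrable lebesgue_I weight" using integr_const[of "1::real"] by (simp add: integr_def)
  have "partition \<noteq> 0"
  proof
    assume "partition = 0"
    then have "AE x in lebesgue_I. weight x = 0"
      using integral_nonneg_eq_0_iff_AE[OF int] by (simp add: partition_def less_imp_le)
    then have "emeasure lebesgue_I (space lebesgue_I) = 0"
      by (subst (asm) AE_iff_measurable[OF _ refl]) (auto simp: less_imp_neq[symmetric])
    moreover have "space lebesgue_I = Pi\<^sub>E I (\<lambda>_. UNIV)" by (simp add: space_PiM)
    ultimately show False using finite_I by (simp add: emeasure_PiM)
  qed
  moreover have "0 \<le> partition" unfolding partition_def by (intro Bochner_Integration.integral_nonneg less_imp_le weight_pos)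
  ultimately show ?thesis by simp
qed

lemma integr_add [intro]: "integr f \<Longrightarrow> integr g \<Longrightarrow> integr (\<lambda>x. f x + g x)"
  by (simp add: integr_def scaleR_add_right)

lemma integr_cmult [intro]: "integr f \<Longrightarrow> integr (\<lambda>x. c * f x)" for f :: "_ \<Rightarrow> 'b::{real_normed_algebra, banach, second_countable_topology}"
  by (simp add: integr_def mult_scaleR_right[symmetric] del: mult_scaleR_right)

lemma integr_Re [intro]: "integr f \<Longrightarrow> integr (\<lambda>x. Re (f x))"
  unfolding integr_def by (drule integrable_Re) simp

lemma integr_norm [intro]: "integr f \<Longrightarrow> integr (\<lambda>x. norm (f x))"
  unfolding integr_def by (drule integrable_norm) (simp add: less_imp_le)

lemma integr_bound:
  assumes "integr g" "f \<in> borel_measurable lebesgue_I" "\<And>x. norm (f x) \<le> g x"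
  shows "integr f"
  unfolding integr_def
proof (rule Bochner_Integration.integrable_bound)
  show "integrable lebesgue_I (\<lambda>x. weight x *\<^sub>R g x)" using assms by (simp add: integr_def)
  have "norm (weight x *\<^sub>R f x) \<le> norm (weight x *\<^sub>R g x)" for x
    using assms(3)[of x] by (simp add: less_imp_le mult_left_mono abs_mult)
  then show "AE x in lebesgue_I. norm (weight x *\<^sub>R f x) \<le> norm (weight x *\<^sub>R g x)" by simp
qed (use assms in measurable)

lemma expect_add: "integr f \<Longrightarrow> integr g \<Longrightarrow> expect (\<lambda>x. f x + g x) = expect f + expect g"
  by (simp add: expect_def integr_def scaleR_add_right)

lemma expect_diff: "integr f \<Longrightarrow> integr g \<Longrightarrow> expect (\<lambda>x. f x - g x) = expect f - expect g"
  by (simp add: expect_def integr_def scaleR_diff_right)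

lemma expect_cmult: "integr f \<Longrightarrow> expect (\<lambda>x. c * f x) = c * expect f" for f :: "_ \<Rightarrow> 'b::{real_normed_algebra, banach, second_countable_topology}"
  by (simp add: expect_def integr_def mult_scaleR_right[symmetric] del: mult_scaleR_right)

lemma expect_const: "expect (\<lambda>x. c) = c"
proof -
  have "integrable lebesgue_I weight" using integr_const[of "1::real"] by (simp add: integr_def)
  then have "(\<integral>x. weight x *\<^sub>R c \<partial>lebesgue_I) = partition *\<^sub>R c" by (simp add: partition_def)
  then show ?thesis using partition_pos by (simp add: expect_def)
qed

lemma integr_sum: "(\<And>j. j \<in> S \<Longrightarrow> integr (f j)) \<Longrightarrow> integr (\<lambda>x. \<Sum>j\<in>S. f j x)"
proof (induction S rule: infinite_finite_induct)
  case (insert j S)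
  then show ?case by (simp add: integr_add)
qed (simp_all add: integr_const)

lemma expect_sum: "(\<And>j. j \<in> S \<Longrightarrow> integr (f j)) \<Longrightarrow> expect (\<lambda>x. \<Sum>j\<in>S. f j x) = (\<Sum>j\<in>S. expect (f j))"
proof (induction S rule: infinite_finite_induct)
  case (insert j S)
  then show ?case by (simp add: expect_add integr_sum)
qed (simp_all add: expect_const)

lemma expect_mono:
  fixes f g :: "('i \<Rightarrow> real) \<Rightarrow> real"
  assumes "integr f" "integr g" "\<And>x. f x \<le> g x"
  shows "expect f \<le> expect g"
proof -
  have "(\<integral>x. weight x *\<^sub>R f x \<partial>lebesgue_I) \<le> (\<integral>x. weight x *\<^sub>R g x \<partial>lebesgue_I)"
    using assms by (intro integral_mono) (auto simp: integr_def less_imp_le mult_left_mono)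
  then show ?thesis using partition_pos by (simp add: expect_def mult_left_mono)
qed

lemma Re_expect: "integr f \<Longrightarrow> Re (expect f) = expect (\<lambda>x. Re (f x))"
  unfolding integr_def expect_def by (drule integral_Re[symmetric]) simp

lemma norm_expect_le: "integr f \<Longrightarrow> norm (expect f) \<le> expect (\<lambda>x. norm (f x))"
proof -
  have "norm (\<integral>x. weight x *\<^sub>R f x \<partial>lebesgue_I) \<le> (\<integral>x. norm (weight x *\<^sub>R f x) \<partial>lebesgue_I)" by (rule integral_norm_bound)
  also have "\<dots> = (\<integral>x. weight x *\<^sub>R norm (f x) \<partial>lebesgue_I)" by (simp add: less_imp_le)
  finally show ?thesis using partition_pos by (simp add: expect_def mult_left_mono abs_of_pos)
qed

lemma expect_of_real: "integr f \<Longrightarrow> expect (\<lambda>x. of_real (f x) :: complex) = of_real (expect f)"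
  unfolding expect_def integr_def scaleR_conv_of_real of_real_mult[symmetric]
  by (simp del: of_real_mult of_real_inverse add: of_real_mult[symmetric] of_real_inverse[symmetric])

lemma integration_by_parts:
  assumes "p \<in> I" "cpoly I f"
  shows "expect (pd p f) = expect (\<lambda>x. f x * pd p W x)"
proof -
  obtain B where B: "\<And>x. \<kappa> / 4 * sqnorm I x - B \<le> Re (W x)" using growth by blast
  have "(\<integral>x. pd p f x * exp (- W x) \<partial>lebesgue_I) = (\<integral>x. f x * pd p W x * exp (- W x) \<partial>lebesgue_I)"
    by (rule integration_by_parts_gaussian[OF finite_I assms cpoly_W _ B]) (use \<kappa> in simp)
  then show ?thesis by (simp add: expect_def exp_W scaleR_conv_of_real mult_ac)
qed

section \<open>Exponential moments of linear functionals\<close>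

definition linear_form :: "('i \<Rightarrow> real) \<Rightarrow> ('i \<Rightarrow> real) \<Rightarrow> real" where
  "linear_form \<theta> x = (\<Sum>p\<in>I. \<theta> p * x p)"

lemma cpoly_linear_form: "cpoly I (\<lambda>x. of_real (linear_form \<theta> x))"
  unfolding linear_form_def of_real_sum of_real_mult
  by (intro cpoly_sum cpoly_cmult cpoly.coord)

lemma linear_form_measurable [measurable]: "linear_form \<theta> \<in> borel_measurable lebesgue_I"
  using measurable_compose[OF cpoly_measurable[OF cpoly_linear_form[of \<theta>]] borel_measurable_Re] by simp

lemma integr_linear_form: "integr (linear_form \<theta>)"
  using integr_Re[OF integr_cpoly[OF cpoly_linear_form[of \<theta>]]] by simp

lemma linear_form_le: "0 < a \<Longrightarrow> linear_form \<theta> x \<le> sqnorm I \<theta> / (4 * a) + a * sqnorm I x"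
proof -
  assume a: "0 < a"
  have "linear_form \<theta> x \<le> (\<Sum>p\<in>I. (\<theta> p)\<^sup>2 / (4 * a) + a * (x p)\<^sup>2)"
    unfolding linear_form_def
  proof (rule sum_mono)
    fix p
    have "0 \<le> (\<theta> p - 2 * a * x p)\<^sup>2 / (4 * a)" using a by simp
    also have "\<dots> = (\<theta> p)\<^sup>2 / (4 * a) + a * (x p)\<^sup>2 - \<theta> p * x p"
      using a by (simp add: power2_eq_square field_simps)
    finally show "\<theta> p * x p \<le> (\<theta> p)\<^sup>2 / (4 * a) + a * (x p)\<^sup>2" by simp
  qed
  then show ?thesis by (simp add: sqnorm_def sum.distrib sum_distrib_left sum_divide_distrib)
qed

lemma integr_exp_linear_form: "integr (\<lambda>x. exp (linear_form \<theta> x))"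
proof -
  obtain B where B: "\<And>x. \<kappa> / 4 * sqnorm I x - B \<le> Re (W x)" using growth by blast
  show ?thesis unfolding integr_def
  proof (rule integrable_gaussian_bound[OF finite_I, where e = "\<kappa> / 8"])
  fix x
  have "linear_form \<theta> x \<le> sqnorm I \<theta> / (4 * (\<kappa> / 8)) + \<kappa> / 8 * sqnorm I x"
    using \<kappa> by (intro linear_form_le) simp
  then have "linear_form \<theta> x - Re (W x) \<le> (sqnorm I \<theta> / (4 * (\<kappa> / 8)) + B) + - (\<kappa> / 8) * sqnorm I x"
    using B[of x] by (simp add: algebra_simps)
  then show "norm (weight x *\<^sub>R exp (linear_form \<theta> x)) \<le> exp (sqnorm I \<theta> / (4 * (\<kappa> / 8)) + B) * exp (- (\<kappa> / 8) * sqnorm I x)"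
    by (simp add: weight_def exp_add[symmetric])
  qed (use \<kappa> in auto)
qed

text \<open>Strong convexity at the parameter \<open>1/2\<close> of the segment. The midpoint is
  restricted to \<open>I\<close> as in \<open>prekopa_leindler\<close>, which does not change the
  value of \<open>W\<close>.\<close>

lemma midpoint_convexity:
  "Re (W x) + Re (W y) - 2 * Re (W (\<lambda>i\<in>I. (x i + y i) / 2)) \<ge> \<kappa> / 4 * sqnorm I (\<lambda>i. x i - y i)"
proof -
  define v where "v = (\<lambda>i. y i - x i)"
  define g where "g = (\<lambda>s. Re (W (\<lambda>i. x i + s * v i)) - \<kappa> / 2 * s\<^sup>2 * sqnorm I v)"
  have "convex_on UNIV g" using convex_W unfolding strongly_convex_def g_def by blast
  then have "g ((1 - 1/2) *\<^sub>R 0 + (1/2) *\<^sub>R 1) \<le> (1 - 1/2) * g 0 + 1/2 * g 1"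
    by (rule convex_onD) auto
  moreover have "W (\<lambda>i. x i + 1/2 * v i) = W (\<lambda>i\<in>I. (x i + y i) / 2)"
    by (rule cpoly_cong[OF cpoly_W]) (simp add: v_def field_simps)
  moreover have "(\<lambda>i. x i + 1 * v i) = y" by (simp add: v_def)
  moreover have "sqnorm I v = sqnorm I (\<lambda>i. x i - y i)" by (simp add: sqnorm_def v_def power2_commute)
  ultimately show ?thesis by (simp add: g_def power2_eq_square field_simps)
qed

text \<open>Prekopa-Leindler applied to the densities tilted by \<open>\<theta>\<close> and \<open>- \<theta>\<close>: the gain from strong convexity
  at the midpoint absorbs the tilt.\<close>

lemma expect_exp_linear_form_mult:
  "expect (\<lambda>x. exp (linear_form \<theta> x)) * expect (\<lambda>x. exp (- linear_form \<theta> x)) \<le> exp (sqnorm I \<theta> / \<kappa>)"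
proof -
  define f where "f = (\<lambda>\<theta> x. weight x * exp (linear_form \<theta> x))"
  \<comment> \<open>The tilt at \<open>x\<close> and the opposite tilt at \<open>y\<close> leave a
    linear form in \<open>x - y\<close>; it exceeds the midpoint gain by at most
    \<open>sqnorm I \<theta> / \<kappa>\<close>. Half of this goes into \<open>h\<close> because
    \<open>h\<close> enters squared.\<close>
  define h where "h = (\<lambda>x. weight x * exp (sqnorm I \<theta> / (2 * \<kappa>)))"
  define A where "A = (\<lambda>\<theta>. \<integral>x. f \<theta> x \<partial>lebesgue_I)"
  have fint: "integrable lebesgue_I (f \<theta>)" for \<theta>
    using integr_exp_linear_form[of \<theta>] by (simp add: integr_def f_def)
  have f0: "0 \<le> f \<theta> x" for \<theta> x by (simp add: f_def less_imp_le)
  have nf: "(\<integral>\<^sup>+x. ennreal (f \<theta> x) \<partial>lebesgue_I) = ennreal (A \<theta>)" for \<theta>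
    unfolding A_def using fint f0 by (intro nn_integral_eq_integral) auto
  have A0: "0 \<le> A \<theta>" for \<theta> unfolding A_def by (intro Bochner_Integration.integral_nonneg f0)
  have wint: "integrable lebesgue_I weight" using integr_const[of "1::real"] by (simp add: integr_def)
  have nh: "(\<integral>\<^sup>+x. ennreal (h x) \<partial>lebesgue_I) = ennreal (partition * exp (sqnorm I \<theta> / (2 * \<kappa>)))"
    unfolding h_def using wint by (subst nn_integral_eq_integral) (auto simp: partition_def less_imp_le)
  define m\<theta> where "m\<theta> = (\<lambda>p. - \<theta> p)"
  have neg: "linear_form m\<theta> x = - linear_form \<theta> x" for x by (simp add: linear_form_def m\<theta>_def sum_negf)
  have "(\<integral>\<^sup>+x. ennreal (f \<theta> x) \<partial>lebesgue_I) * (\<integral>\<^sup>+x. ennreal (f m\<theta> x) \<partial>lebesgue_I) \<le> (\<integral>\<^sup>+x. ennreal (h x) \<partial>lebesgue_I)\<^sup>2"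
  proof (rule prekopa_leindler[OF finite_I])
    fix x y :: "'i \<Rightarrow> real"
    define mid where "mid = (\<lambda>i\<in>I. (x i + y i) / 2)"
    have "linear_form \<theta> x - linear_form \<theta> y = linear_form \<theta> (\<lambda>i. x i - y i)"
      by (simp add: linear_form_def sum_subtractf right_diff_distrib)
    also have "\<dots> \<le> sqnorm I \<theta> / (4 * (\<kappa> / 4)) + \<kappa> / 4 * sqnorm I (\<lambda>i. x i - y i)"
      using \<kappa> by (intro linear_form_le) simp
    finally have "- Re (W x) + linear_form \<theta> x + (- Re (W y) - linear_form \<theta> y) \<le> 2 * (- Re (W mid) + sqnorm I \<theta> / (2 * \<kappa>))"
      using midpoint_convexity[of x y] by (simp add: mid_def algebra_simps)
    then have "exp (- Re (W x) + linear_form \<theta> x) * exp (- Re (W y) - linear_form \<theta> y) \<le> (exp (- Re (W mid) + sqnorm I \<theta> / (2 * \<kappa>)))\<^sup>2"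
      by (simp add: exp_add[symmetric] exp_double[symmetric])
    then have "f \<theta> x * f m\<theta> y \<le> (h mid)\<^sup>2"
      by (simp add: f_def h_def weight_def neg exp_add exp_diff exp_minus field_simps)
    then show "ennreal (f \<theta> x) * ennreal (f m\<theta> y) \<le> (ennreal (h (\<lambda>i\<in>I. (x i + y i) / 2)))\<^sup>2"
      using f0 by (simp add: mid_def[symmetric] ennreal_mult[symmetric] ennreal_power h_def less_imp_le ennreal_leI)
  qed (auto simp: f_def h_def)
  then have "ennreal (A \<theta> * A m\<theta>) \<le> ennreal ((partition * exp (sqnorm I \<theta> / (2 * \<kappa>)))\<^sup>2)"
    unfolding nf nh ennreal_mult[OF A0 A0] using partition_pos
    by (subst ennreal_power[symmetric]) (simp_all add: less_imp_le)
  then have "A \<theta> * A m\<theta> \<le> (partition * exp (sqnorm I \<theta> / (2 * \<kappa>)))\<^sup>2"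
    by (subst (asm) ennreal_le_iff) auto
  also have "\<dots> = partition\<^sup>2 * exp (sqnorm I \<theta> / \<kappa>)" by (simp add: power_mult_distrib exp_double[symmetric])
  finally have "A \<theta> / partition * (A m\<theta> / partition) \<le> exp (sqnorm I \<theta> / \<kappa>)"
    using partition_pos by (simp add: field_simps power2_eq_square)
  then show ?thesis by (simp add: expect_def A_def f_def neg divide_inverse mult.commute)
qed

text \<open>Jensen's inequality bounds the factor with the opposite tilt below by the exponential of
  minus the mean, and dividing by it makes the product bound one-sided. Jensen appears as the
  tangent line of the exponential at the mean.\<close>

lemma expect_exp_linear_form_le:
  "expect (\<lambda>x. exp (linear_form \<theta> x)) \<le> exp (expect (linear_form \<theta>) + sqnorm I \<theta> / \<kappa>)"
proof -
  define m where "m = expect (linear_form \<theta>)"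
  define m\<theta> where "m\<theta> = (\<lambda>p. - \<theta> p)"
  have neg: "linear_form m\<theta> = (\<lambda>x. - linear_form \<theta> x)" by (simp add: linear_form_def m\<theta>_def sum_negf fun_eq_iff)
  have "exp (- m) * (1 + m - linear_form \<theta> x) \<le> exp (- linear_form \<theta> x)" for x
  proof -
    have "1 + (m - linear_form \<theta> x) \<le> exp (m - linear_form \<theta> x)" by (rule exp_ge_add_one_self)
    then have "exp (- m) * (1 + (m - linear_form \<theta> x)) \<le> exp (- m) * exp (m - linear_form \<theta> x)" by (rule mult_left_mono) simp
    then show ?thesis by (simp add: exp_add[symmetric] algebra_simps)
  qed
  moreover have i: "integr (\<lambda>x. 1 + m - linear_form \<theta> x)"
    using integr_add[OF integr_const integr_linear_form[of m\<theta>], of "1 + m"] by (simp add: neg)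
  ultimately have "expect (\<lambda>x. exp (- m) * (1 + m - linear_form \<theta> x)) \<le> expect (\<lambda>x. exp (- linear_form \<theta> x))"
    using integr_exp_linear_form[of m\<theta>] by (intro expect_mono integr_cmult) (auto simp: neg)
  moreover have "expect (\<lambda>x. 1 + m - linear_form \<theta> x) = 1"
    by (subst expect_diff) (auto simp: expect_const m_def intro: integr_linear_form)
  ultimately have lower: "exp (- m) \<le> expect (\<lambda>x. exp (- linear_form \<theta> x))"
    using i by (simp add: expect_cmult)
  have pos: "0 \<le> expect (\<lambda>x. exp (linear_form \<theta> x))"
    using expect_mono[OF integr_const integr_exp_linear_form, of 0 \<theta>] by (simp add: expect_const)
  have "expect (\<lambda>x. exp (linear_form \<theta> x)) * exp (- m) \<le> expect (\<lambda>x. exp (linear_form \<theta> x)) * expect (\<lambda>x. exp (- linear_form \<theta> x))"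
    using lower pos by (rule mult_left_mono)
  also have "\<dots> \<le> exp (sqnorm I \<theta> / \<kappa>)" by (rule expect_exp_linear_form_mult)
  finally show ?thesis by (simp add: m_def[symmetric] exp_add exp_minus field_simps)
qed

text \<open>Bounding \<open>\<bar>y\<bar> ^ n\<close> by \<open>exp (n * \<bar>y\<bar>)\<close>
  turns the power into tilts by \<open>n * \<theta>\<close>. For \<open>n = N\<close>, \<kappa> of
  order \<open>N\<close> and \<theta> of bounded norm, the result is exponential in
  \<open>N\<close>, just like the cardinality of the net.\<close>

lemma expect_power_linear_form_le:
  "expect (\<lambda>x. \<bar>linear_form \<theta> x\<bar> ^ n) \<le> 2 * exp (real n * \<bar>expect (linear_form \<theta>)\<bar> + (real n)\<^sup>2 * sqnorm I \<theta> / \<kappa>)"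
    and integr_power_linear_form: "integr (\<lambda>x. \<bar>linear_form \<theta> x\<bar> ^ n)"
proof -
  define \<theta>1 where "\<theta>1 = (\<lambda>p. real n * \<theta> p)"
  define \<theta>2 where "\<theta>2 = (\<lambda>p. - real n * \<theta> p)"
  have f1: "linear_form \<theta>1 = (\<lambda>x. real n * linear_form \<theta> x)" and f2: "linear_form \<theta>2 = (\<lambda>x. - real n * linear_form \<theta> x)"
    by (simp_all add: linear_form_def \<theta>1_def \<theta>2_def sum_distrib_left sum_negf mult.assoc fun_eq_iff)
  have s: "sqnorm I \<theta>1 = (real n)\<^sup>2 * sqnorm I \<theta>" "sqnorm I \<theta>2 = (real n)\<^sup>2 * sqnorm I \<theta>"
    by (simp_all add: sqnorm_def \<theta>1_def \<theta>2_def power_mult_distrib sum_distrib_left)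
  have le: "\<bar>y\<bar> ^ n \<le> exp (real n * y) + exp (- real n * y)" for y :: real
  proof -
    have "\<bar>y\<bar> \<le> exp \<bar>y\<bar>" using exp_ge_add_one_self[of "\<bar>y\<bar>"] by linarith
    then have "\<bar>y\<bar> ^ n \<le> exp \<bar>y\<bar> ^ n" by (intro power_mono) auto
    also have "\<dots> = exp (real n * \<bar>y\<bar>)" by (simp add: exp_of_nat_mult)
    also have "\<dots> \<le> exp (real n * y) + exp (- real n * y)" by (cases "0 \<le> y") auto
    finally show ?thesis .
  qed
  have i: "integr (\<lambda>x. exp (linear_form \<theta>1 x) + exp (linear_form \<theta>2 x))"
    by (intro integr_add integr_exp_linear_form)
  show i': "integr (\<lambda>x. \<bar>linear_form \<theta> x\<bar> ^ n)"
    by (rule integr_bound[OF i]) (use le in \<open>auto simp: f1 f2 power_abs[symmetric]\<close>)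
  have "expect (\<lambda>x. \<bar>linear_form \<theta> x\<bar> ^ n) \<le> expect (\<lambda>x. exp (linear_form \<theta>1 x) + exp (linear_form \<theta>2 x))"
    using i i' le by (intro expect_mono) (auto simp: f1 f2)
  also have "\<dots> = expect (\<lambda>x. exp (linear_form \<theta>1 x)) + expect (\<lambda>x. exp (linear_form \<theta>2 x))"
    by (intro expect_add integr_exp_linear_form)
  also have "\<dots> \<le> exp (expect (linear_form \<theta>1) + sqnorm I \<theta>1 / \<kappa>) + exp (expect (linear_form \<theta>2) + sqnorm I \<theta>2 / \<kappa>)"
    by (intro add_mono expect_exp_linear_form_le)
  also have "expect (linear_form \<theta>1) = real n * expect (linear_form \<theta>)" unfolding f1 by (intro expect_cmult integr_linear_form)
  also have "expect (linear_form \<theta>2) = - real n * expect (linear_form \<theta>)" unfolding f2 by (intro expect_cmult integr_linear_form)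
  also have "exp (real n * expect (linear_form \<theta>) + sqnorm I \<theta>1 / \<kappa>) + exp (- real n * expect (linear_form \<theta>) + sqnorm I \<theta>2 / \<kappa>)
    \<le> exp (real n * \<bar>expect (linear_form \<theta>)\<bar> + (real n)\<^sup>2 * sqnorm I \<theta> / \<kappa>) + exp (real n * \<bar>expect (linear_form \<theta>)\<bar> + (real n)\<^sup>2 * sqnorm I \<theta> / \<kappa>)"
    unfolding s by (intro add_mono) (auto simp: abs_if mult_left_mono)
  finally show "expect (\<lambda>x. \<bar>linear_form \<theta> x\<bar> ^ n) \<le> 2 * exp (real n * \<bar>expect (linear_form \<theta>)\<bar> + (real n)\<^sup>2 * sqnorm I \<theta> / \<kappa>)"
    by simp
qed

text \<open>Integrating each coordinate by parts against its own derivative of \<open>W\<close>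
  shows that \<open>slope x x\<close> has the dimension as its expectation; monotonicity of the
  slope compares it with the squared norm. This is the input for bounding the means, which the
  exponential bound leaves open.\<close>

lemma second_moment_le:
  "\<kappa> * expect (sqnorm I) \<le> real (card I) - expect (\<lambda>x. slope (\<lambda>_. 0) x)"
  and integr_sqnorm: "integr (sqnorm I)"
proof -
  have c2: "cpoly I (\<lambda>x. of_real (sqnorm I x))"
    unfolding sqnorm_def power2_eq_square of_real_sum of_real_mult by (intro cpoly_sum cpoly.mult cpoly.coord)
  then show i2: "integr (sqnorm I)" using integr_Re[OF integr_cpoly[OF c2]] by simp
  have c0: "cpoly I (\<lambda>x. \<Sum>p\<in>I. of_real (x p) * pd p W (\<lambda>_. 0))" by (intro cpoly_sum cpoly.mult cpoly.coord cpoly.const)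
  then have i0: "integr (slope (\<lambda>_. 0))" unfolding slope_def[abs_def] by (intro integr_Re integr_cpoly)
  have c1: "cpoly I (\<lambda>x. of_real (x p) * pd p W x)" if "p \<in> I" for p
    using that finite_I cpoly_W by (intro cpoly.mult cpoly.coord cpoly_pd)
  have i1: "integr (\<lambda>x. slope x x)" unfolding slope_def using c1 by (intro integr_Re integr_cpoly cpoly_sum)
  have "expect (\<lambda>x. slope x x) = Re (expect (\<lambda>x. \<Sum>p\<in>I. of_real (x p) * pd p W x))"
    unfolding slope_def using c1 by (intro Re_expect[symmetric] integr_cpoly cpoly_sum)
  also have "expect (\<lambda>x. \<Sum>p\<in>I. of_real (x p) * pd p W x) = (\<Sum>p\<in>I. expect (\<lambda>x. of_real (x p) * pd p W x))"
    using c1 by (intro expect_sum integr_cpoly)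
  also have "\<dots> = (\<Sum>p\<in>I. expect (pd p (\<lambda>x. of_real (x p))))"
    by (intro sum.cong refl integration_by_parts[symmetric] cpoly.coord)
  also have "\<dots> = of_nat (card I)" by (simp add: pd_coordinate[abs_def] expect_const)
  finally have trace: "expect (\<lambda>x. slope x x) = real (card I)" by simp
  have "expect (\<lambda>x. \<kappa> * sqnorm I x) \<le> expect (\<lambda>x. slope x x + (-1) * slope (\<lambda>_. 0) x)"
    using slope_monotone(1) i0 i1 i2 by (intro expect_mono integr_add integr_cmult) auto
  then show "\<kappa> * expect (sqnorm I) \<le> real (card I) - expect (\<lambda>x. slope (\<lambda>_. 0) x)"
    using i0 i1 i2 by (simp add: expect_cmult expect_diff trace)
qed

end

section \<open>The loop equations of the matrix model\<close>

definition hentry :: "(nat \<times> nat \<times> nat \<Rightarrow> real) \<Rightarrow> nat \<Rightarrow> nat \<Rightarrow> nat \<Rightarrow> complex" where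
  "hentry x i a b = (if a = b then complex_of_real (x (i, a, a))
     else if a < b then Complex (x (i, a, b)) (x (i, b, a))
     else Complex (x (i, b, a)) (- x (i, a, b)))"

definition wtrace :: "nat \<Rightarrow> (nat \<times> nat \<times> nat \<Rightarrow> real) \<Rightarrow> nat list \<Rightarrow> complex" where
  "wtrace N x w = (\<Sum>a<N. entry N (hentry x) w a a)"

text \<open>The derivative in the direction of the matrix unit \<open>E\<^sub>a\<^sub>b\<close> of the \<open>i\<close>-th matrix, in the
  complexification of the space of Hermitian matrices.\<close>

definition unit_deriv :: "nat \<Rightarrow> nat \<Rightarrow> nat \<Rightarrow> ((nat \<times> nat \<times> nat \<Rightarrow> real) \<Rightarrow> complex) \<Rightarrow> (nat \<times> nat \<times> nat \<Rightarrow> real) \<Rightarrow> complex" where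
  "unit_deriv i a b f x = (if a = b then pd (i, a, a) f x
     else if a < b then 1/2 * (pd (i, a, b) f x - \<i> * pd (i, b, a) f x)
     else 1/2 * (pd (i, b, a) f x + \<i> * pd (i, a, b) f x))"

definition pot :: "nat \<Rightarrow> nat \<Rightarrow> nat \<Rightarrow> (nat \<Rightarrow> nat list) \<Rightarrow> (nat \<Rightarrow> complex) \<Rightarrow> (nat \<times> nat \<times> nat \<Rightarrow> real) \<Rightarrow> complex" where
  "pot m N n q t x = of_nat N * ((\<Sum>j=1..n. t j * wtrace N x (q j)) + 1/2 * (\<Sum>i<m. wtrace N x [i, i]))"

section \<open>Derivatives of words, traces and the potential\<close>

lemma occurrences_Cons:
  "occurrences i (j # w) = (if j = i then insert 0 (Suc ` occurrences i w) else Suc ` occurrences i w)"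
proof -
  have "k \<in> occurrences i (j # w) \<longleftrightarrow> (k = 0 \<and> j = i) \<or> k \<in> Suc ` occurrences i w" for k
    by (cases k) (auto simp: occurrences_def)
  then show ?thesis by auto
qed

lemma occurrences_Nil [simp]: "occurrences i [] = {}"
  by (simp add: occurrences_def)

lemma finite_coords [simp]: "finite (coords m N)"
  by (simp add: coords_def)

lemma coords_iff [simp]: "(i, a, b) \<in> coords m N \<longleftrightarrow> i < m \<and> a < N \<and> b < N"
  by (auto simp: coords_def)

lemma cpoly_hentry: "i < m \<Longrightarrow> a < N \<Longrightarrow> b < N \<Longrightarrow> cpoly (coords m N) (\<lambda>x. hentry x i a b)"
  unfolding hentry_def Complex_eq
  by (cases a b rule: linorder_cases)
     (auto intro!: cpoly.add cpoly_cmult cpoly.coord cpoly_uminus cpoly_diff simp: cpoly_uminus)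

lemma cpoly_entry: "set w \<subseteq> {..<m} \<Longrightarrow> a < N \<Longrightarrow> cpoly (coords m N) (\<lambda>x. entry N (hentry x) w a b)"
proof (induction w arbitrary: a)
  case (Cons i w)
  then show ?case by (auto intro!: cpoly_sum cpoly.mult cpoly_hentry)
qed (simp add: cpoly.const)

lemma cpoly_wtrace: "set w \<subseteq> {..<m} \<Longrightarrow> cpoly (coords m N) (\<lambda>x. wtrace N x w)"
  unfolding wtrace_def by (intro cpoly_sum cpoly_entry) auto

lemma cpoly_pot: "(\<And>j. j \<in> {1..n} \<Longrightarrow> set (q j) \<subseteq> {..<m}) \<Longrightarrow> cpoly (coords m N) (pot m N n q t)"
  unfolding pot_def[abs_def] by (intro cpoly_cmult cpoly.add cpoly_sum cpoly_wtrace) auto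

context
  fixes m N i a b :: nat
  assumes i: "i < m" and a: "a < N" and b: "b < N"
begin

lemma unit_deriv_const [simp]: "unit_deriv i a b (\<lambda>x. c) x = 0"
  by (simp add: unit_deriv_def)

lemma
  assumes "cpoly (coords m N) f" "cpoly (coords m N) g"
  shows unit_deriv_add: "unit_deriv i a b (\<lambda>x. f x + g x) x = unit_deriv i a b f x + unit_deriv i a b g x"
    and unit_deriv_mult: "unit_deriv i a b (\<lambda>x. f x * g x) x = f x * unit_deriv i a b g x + unit_deriv i a b f x * g x"
  using assms i a b by (simp_all add: unit_deriv_def pd_add[of "coords m N"] pd_mult[of "coords m N"] algebra_simps)

lemma unit_deriv_cmult: "cpoly (coords m N) f \<Longrightarrow> unit_deriv i a b (\<lambda>x. c * f x) x = c * unit_deriv i a b f x"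
  using i a b by (simp add: unit_deriv_def pd_cmult[of "coords m N"] algebra_simps)

lemma unit_deriv_sum: "(\<And>j. j \<in> S \<Longrightarrow> cpoly (coords m N) (f j)) \<Longrightarrow> unit_deriv i a b (\<lambda>x. \<Sum>j\<in>S. f j x) x = (\<Sum>j\<in>S. unit_deriv i a b (f j) x)"
proof (induction S rule: infinite_finite_induct)
  case (insert j S)
  then show ?case by (simp add: unit_deriv_add cpoly_sum)
qed simp_all

text \<open>The combinations in \<open>unit_deriv\<close> treat the entries \<open>(a, b)\<close>
  and \<open>(b, a)\<close> as independent variables, like the Wirtinger derivatives with respect to
  \<open>z\<close> and its conjugate.\<close>

lemma unit_deriv_hentry:
  assumes "j < m" "c < N" "d < N"
  shows "unit_deriv i a b (\<lambda>x. hentry x j c d) x = (if j = i \<and> c = a \<and> d = b then 1 else 0)"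
proof -
  have cp: "cpoly (coords m N) (\<lambda>x. complex_of_real (x (j, c', d')))" if "c' < N" "d' < N" for c' d'
    using assms that by (intro cpoly.coord) simp
  have "unit_deriv i a b (\<lambda>x. of_real (x (j, c', d')) + \<i> * of_real (x (j, d', c'))) x
    = unit_deriv i a b (\<lambda>x. of_real (x (j, c', d'))) x + \<i> * unit_deriv i a b (\<lambda>x. of_real (x (j, d', c'))) x"
    "unit_deriv i a b (\<lambda>x. of_real (x (j, d', c')) + (- \<i>) * of_real (x (j, c', d'))) x
    = unit_deriv i a b (\<lambda>x. of_real (x (j, d', c'))) x + (- \<i>) * unit_deriv i a b (\<lambda>x. of_real (x (j, c', d'))) x"
    if "c' < N" "d' < N" for c' d'
    using cp that by (simp_all only: unit_deriv_add unit_deriv_cmult cpoly_cmult)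
  note * = this[OF assms(2,3)]
  have coord: "unit_deriv i a b (\<lambda>x. complex_of_real (x (j, c', d'))) x = (if a = b then (if i = j \<and> a = c' \<and> a = d' then 1 else 0)
     else if a < b then 1/2 * ((if i = j \<and> a = c' \<and> b = d' then 1 else 0) - \<i> * (if i = j \<and> b = c' \<and> a = d' then 1 else 0))
     else 1/2 * ((if i = j \<and> b = c' \<and> a = d' then 1 else 0) + \<i> * (if i = j \<and> a = c' \<and> b = d' then 1 else 0)))" for c' d'
    by (simp only: unit_deriv_def pd_coordinate prod.inject)
  consider "c = d" | "c < d" | "d < c" by linarith
  then show ?thesis
  proof cases
    case 1
    then have h: "(\<lambda>x. hentry x j c d) = (\<lambda>x. of_real (x (j, c, c)))" by (simp add: hentry_def)
    show ?thesis unfolding h coord using 1 by auto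
  next
    case 2
    then have h: "(\<lambda>x. hentry x j c d) = (\<lambda>x. of_real (x (j, c, d)) + \<i> * of_real (x (j, d, c)))"
      by (auto simp: hentry_def Complex_eq)
    show ?thesis unfolding h * coord using 2 by auto
  next
    case 3
    then have h: "(\<lambda>x. hentry x j c d) = (\<lambda>x. of_real (x (j, d, c)) + (- \<i>) * of_real (x (j, c, d)))"
      by (auto simp: hentry_def Complex_eq)
    show ?thesis unfolding h * coord using 3
      by (cases "i = j"; cases "a = c"; cases "b = d"; cases "a = d"; cases "b = c"; simp)
  qed
qed

text \<open>Leibniz rule: removing a letter leaves a prefix ending in row index \<open>a\<close> and
  a suffix starting from column index \<open>b\<close>.\<close>

lemma unit_deriv_entry:
  assumes "set w \<subseteq> {..<m}" "c < N" "d < N"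
  shows "unit_deriv i a b (\<lambda>x. entry N (hentry x) w c d) x
    = (\<Sum>k\<in>occurrences i w. entry N (hentry x) (take k w) c a * entry N (hentry x) (drop (Suc k) w) b d)"
  using assms(1,2)
proof (induction w arbitrary: c)
  case (Cons j w)
  have j: "j < m" "set w \<subseteq> {..<m}" using Cons.prems by auto
  have "unit_deriv i a b (\<lambda>x. entry N (hentry x) (j # w) c d) x = (\<Sum>k<N. unit_deriv i a b (\<lambda>x. hentry x j c k * entry N (hentry x) w k d) x)"
    unfolding entry.simps using Cons.prems j by (intro unit_deriv_sum cpoly.mult cpoly_hentry cpoly_entry) auto
  also have "\<dots> = (\<Sum>k<N. hentry x j c k * unit_deriv i a b (\<lambda>x. entry N (hentry x) w k d) x + (if j = i \<and> c = a \<and> k = b then 1 else 0) * entry N (hentry x) w k d)"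
    using Cons.prems j by (intro sum.cong refl) (simp add: unit_deriv_mult cpoly_hentry cpoly_entry unit_deriv_hentry)
  also have "\<dots> = (\<Sum>k<N. hentry x j c k * unit_deriv i a b (\<lambda>x. entry N (hentry x) w k d) x) + (if j = i \<and> c = a then entry N (hentry x) w b d else 0)"
    using b by (cases "j = i \<and> c = a") (auto simp: sum.distrib if_distrib[of "\<lambda>z. z * _"] cong: if_cong)
  also have "(\<Sum>k<N. hentry x j c k * unit_deriv i a b (\<lambda>x. entry N (hentry x) w k d) x)
     = (\<Sum>l\<in>occurrences i w. entry N (hentry x) (j # take l w) c a * entry N (hentry x) (drop (Suc l) w) b d)"
    using Cons.IH[OF j(2)] by (simp add: sum_distrib_left sum_distrib_right mult.assoc) (rule sum.swap)
  also have "\<dots> = (\<Sum>l\<in>Suc ` occurrences i w. entry N (hentry x) (take l (j # w)) c a * entry N (hentry x) (drop (Suc l) (j # w)) b d)"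
    by (subst sum.reindex) auto
  finally show ?case unfolding occurrences_Cons by (auto simp: sum.insert)
qed simp

end

lemma entry_append: "a < N \<Longrightarrow> entry N A (u @ v) a b = (\<Sum>k<N. entry N A u a k * entry N A v k b)"
proof (induction u arbitrary: a)
  case Nil
  then show ?case by (simp add: if_distrib[of "\<lambda>z. z * _"] cong: if_cong)
next
  case (Cons i u)
  then show ?case by (simp add: sum_distrib_left sum_distrib_right mult.assoc) (rule sum.swap)
qed

lemma sum_entry_entry: "(\<Sum>a<N. \<Sum>b<N. entry N (hentry x) u a b * entry N (hentry x) v b a) = wtrace N x (u @ v)"
  unfolding wtrace_def by (intro sum.cong refl) (simp add: entry_append)

lemma wtrace_swap: "wtrace N x (u @ v) = wtrace N x (v @ u)"
  unfolding sum_entry_entry[symmetric] by (subst sum.swap) (simp add: mult.commute)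

text \<open>Summing over the trace index glues suffix and prefix in cyclic order, suffix first; this
  is the origin of \<open>rotate_out\<close>.\<close>

lemma unit_deriv_wtrace:
  assumes "i < m" "a < N" "b < N" "set w \<subseteq> {..<m}"
  shows "unit_deriv i a b (\<lambda>x. wtrace N x w) x = (\<Sum>k\<in>occurrences i w. entry N (hentry x) (rotate_out k w) b a)"
proof -
  have "unit_deriv i a b (\<lambda>x. wtrace N x w) x = (\<Sum>c<N. \<Sum>k\<in>occurrences i w. entry N (hentry x) (take k w) c a * entry N (hentry x) (drop (Suc k) w) b c)"
    unfolding wtrace_def using assms by (subst unit_deriv_sum[OF assms(1-3)]) (auto intro: cpoly_entry simp: unit_deriv_entry)
  also have "\<dots> = (\<Sum>k\<in>occurrences i w. entry N (hentry x) (rotate_out k w) b a)"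
    using assms(3) by (subst sum.swap) (simp add: rotate_out_def entry_append mult.commute)
  finally show ?thesis .
qed

lemma unit_deriv_pot:
  assumes i: "i < m" "a < N" "b < N" and q: "\<And>j. j \<in> {1..n} \<Longrightarrow> set (q j) \<subseteq> {..<m}"
  shows "unit_deriv i a b (pot m N n q t) x = of_nat N * ((\<Sum>j=1..n. t j * (\<Sum>k\<in>occurrences i (q j). entry N (hentry x) (rotate_out k (q j)) b a)) + hentry x i b a)"
proof -
  \<comment> \<open>Each quadratic word contains its letter twice, which cancels the factor
    \<open>1/2\<close> of the Gaussian part.\<close>
  have occ: "occurrences i [l, l] = (if l = i then {0, 1} else {})" for l
    by (auto simp: occurrences_Cons)
  have e1: "entry N (hentry x) [i] b a = hentry x i b a"
    using i by (simp add: if_distrib[of "\<lambda>z. _ * z"] cong: if_cong)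
  have c0: "cpoly (coords m N) (\<lambda>x. t j * wtrace N x (q j))" if "j \<in> {1..n}" for j
    using q that by (intro cpoly_cmult cpoly_wtrace)
  have c0': "cpoly (coords m N) (\<lambda>x. wtrace N x [l, l])" if "l \<in> {..<m}" for l
    using that by (intro cpoly_wtrace) auto
  note c1 = cpoly_sum[of "{1..n}", OF c0] and c2 = cpoly_sum[of "{..<m}", OF c0']
  have "unit_deriv i a b (pot m N n q t) x = of_nat N * (unit_deriv i a b (\<lambda>x. \<Sum>j=1..n. t j * wtrace N x (q j)) x + 1/2 * unit_deriv i a b (\<lambda>x. \<Sum>l<m. wtrace N x [l, l]) x)"
    unfolding pot_def[abs_def] by (simp only: unit_deriv_cmult[OF i] unit_deriv_add[OF i] c1 c2 cpoly_cmult cpoly.add)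
  also have "unit_deriv i a b (\<lambda>x. \<Sum>j=1..n. t j * wtrace N x (q j)) x = (\<Sum>j=1..n. unit_deriv i a b (\<lambda>x. t j * wtrace N x (q j)) x)"
    by (rule unit_deriv_sum[OF i c0])
  also have "\<dots> = (\<Sum>j=1..n. t j * unit_deriv i a b (\<lambda>x. wtrace N x (q j)) x)"
    using q by (intro sum.cong refl unit_deriv_cmult[OF i] cpoly_wtrace)
  also have "unit_deriv i a b (\<lambda>x. \<Sum>l<m. wtrace N x [l, l]) x = (\<Sum>l<m. unit_deriv i a b (\<lambda>x. wtrace N x [l, l]) x)"
    by (rule unit_deriv_sum[OF i c0'])
  also have "(\<Sum>j=1..n. t j * unit_deriv i a b (\<lambda>x. wtrace N x (q j)) x) = (\<Sum>j=1..n. t j * (\<Sum>k\<in>occurrences i (q j). entry N (hentry x) (rotate_out k (q j)) b a))"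
    using q by (intro sum.cong refl) (simp add: unit_deriv_wtrace[OF i])
  also have "(\<Sum>l<m. unit_deriv i a b (\<lambda>x. wtrace N x [l, l]) x) = (\<Sum>l<m. if l = i then 2 * hentry x i b a else 0)"
  proof (intro sum.cong refl)
    fix l assume "l \<in> {..<m}"
    then have "unit_deriv i a b (\<lambda>x. wtrace N x [l, l]) x = (\<Sum>k\<in>occurrences i [l, l]. entry N (hentry x) (rotate_out k [l, l]) b a)"
      by (intro unit_deriv_wtrace[OF i]) auto
    also have "\<dots> = (if l = i then 2 * hentry x i b a else 0)"
      unfolding occ using e1 by (auto simp: rotate_out_def simp del: entry.simps)
    finally show "unit_deriv i a b (\<lambda>x. wtrace N x [l, l]) x = (if l = i then 2 * hentry x i b a else 0)" .
  qed
  finally show ?thesis using i by simp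
qed

lemma unit_deriv_prod_list:
  assumes i: "i < m" "a < N" "b < N" and vs: "\<And>v. v \<in> set vs \<Longrightarrow> set v \<subseteq> {..<m}"
  shows "unit_deriv i a b (\<lambda>x. prod_list (map (wtrace N x) vs)) x =
    (\<Sum>j<length vs. unit_deriv i a b (\<lambda>x. wtrace N x (vs ! j)) x * prod_list (map (wtrace N x) (take j vs @ drop (Suc j) vs)))"
  using vs
proof (induction vs)
  case Nil
  then show ?case using unit_deriv_const[OF i] by simp
next
  case (Cons v vs)
  have cp: "cpoly (coords m N) (\<lambda>x. prod_list (map (wtrace N x) vs))"
    using Cons.prems
  proof (induction vs)
    case (Cons w ws)
    then show ?case by (auto intro!: cpoly.mult cpoly_wtrace)
  qed (simp add: cpoly.const)
  have "unit_deriv i a b (\<lambda>x. prod_list (map (wtrace N x) (v # vs))) x = wtrace N x v * unit_deriv i a b (\<lambda>x. prod_list (map (wtrace N x) vs)) x + unit_deriv i a b (\<lambda>x. wtrace N x v) x * prod_list (map (wtrace N x) vs)"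
    using Cons.prems cp by (simp add: unit_deriv_mult[OF i] cpoly_wtrace)
  then show ?case using Cons
    by (simp add: sum.lessThan_Suc_shift sum_distrib_left mult_ac del: sum.lessThan_Suc)
qed

lemma cpoly_prod_wtrace:
  "(\<And>v. v \<in> set vs \<Longrightarrow> set v \<subseteq> {..<m}) \<Longrightarrow> cpoly (coords m N) (\<lambda>x. prod_list (map (wtrace N x) vs))"
  by (induction vs) (auto intro!: cpoly.mult cpoly_wtrace cpoly.const)

text \<open>The potential \<open>pot\<close> contains the factor \<open>N\<close> of the density,
  hence the convexity constant \<open>N * c\<close>. The bound \<open>nd\<close> keeps its gradient
  at the zero matrices of order \<open>N\<close>, through which the size of the coefficients enters
  the bound on the means.\<close>

locale matrix_gibbs =
  fixes m N n d :: nat and q :: "nat \<Rightarrow> nat list" and t :: "nat \<Rightarrow> complex" and c \<eta> :: real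
  assumes m: "1 \<le> m" and N: "1 \<le> N" and c: "0 < c" and \<eta>: "0 \<le> \<eta>" and nd: "real n * real d * \<eta> \<le> 1"
    and t: "\<And>j. j \<in> {1..n} \<Longrightarrow> cmod (t j) \<le> \<eta>"
    and q: "\<And>j. j \<in> {1..n} \<Longrightarrow> set (q j) \<subseteq> {..<m} \<and> length (q j) \<le> d"
    and real_pot: "\<And>x. pot m N n q t x \<in> \<real>"
    and convex_pot: "strongly_convex (coords m N) (real N * c) (\<lambda>x. Re (pot m N n q t x))"
begin

sublocale gibbs_measure "coords m N" "pot m N n q t" "real N * c"
proof
  show "cpoly (coords m N) (pot m N n q t)" using q by (intro cpoly_pot) auto
qed (use N c real_pot convex_pot in auto)

lemma expect_double_sum:
  assumes "\<And>a b. a \<in> A \<Longrightarrow> b \<in> B a \<Longrightarrow> integr (f a b)"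
  shows "expect (\<lambda>x. \<Sum>a\<in>A. \<Sum>b\<in>B a. f a b x) = (\<Sum>a\<in>A. \<Sum>b\<in>B a. expect (f a b))"
    and "integr (\<lambda>x. \<Sum>a\<in>A. \<Sum>b\<in>B a. f a b x)"
proof -
  have "integr (\<lambda>x. \<Sum>b\<in>B a. f a b x)" if "a \<in> A" for a
    using assms[OF that] by (rule integr_sum)
  then show "integr (\<lambda>x. \<Sum>a\<in>A. \<Sum>b\<in>B a. f a b x)"
    and "expect (\<lambda>x. \<Sum>a\<in>A. \<Sum>b\<in>B a. f a b x) = (\<Sum>a\<in>A. \<Sum>b\<in>B a. expect (f a b))"
    using assms by (auto simp: expect_sum intro: integr_sum)
qed

definition corr :: "nat list list \<Rightarrow> complex" where
  "corr ws = expect (\<lambda>x. prod_list (map (\<lambda>w. wtrace N x w / of_nat N) ws))"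

lemma prod_list_divide: "prod_list (map (\<lambda>w. wtrace N x w / of_nat N) ws) = prod_list (map (wtrace N x) ws) / of_nat N ^ length ws"
  by (induction ws) auto

lemma expect_prod_wtrace:
  assumes "ws \<in> forests {..<m}"
  shows "expect (\<lambda>x. prod_list (map (wtrace N x) ws)) = of_nat N ^ length ws * corr ws"
proof -
  have "corr ws = expect (\<lambda>x. (1 / of_nat N ^ length ws) * prod_list (map (wtrace N x) ws))"
    by (simp add: corr_def prod_list_divide)
  also have "\<dots> = (1 / of_nat N ^ length ws) * expect (\<lambda>x. prod_list (map (wtrace N x) ws))"
    using assms by (intro expect_cmult integr_cpoly cpoly_prod_wtrace) (auto simp: forests_def)
  finally show ?thesis using N by simp
qed

lemma corr_Nil [simp]: "corr [] = 1"
  by (simp add: corr_def expect_const)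

lemma corr_Nil_Cons [simp]: "corr ([] # ws) = corr ws"
  using N by (simp add: corr_def wtrace_def)

text \<open>The relation is linear in the derivative and so extends to complexified
  directions.\<close>

lemma matrix_integration_by_parts:
  assumes i: "i < m" "a < N" "b < N" and f: "cpoly (coords m N) f"
  shows "expect (unit_deriv i a b f) = expect (\<lambda>x. f x * unit_deriv i a b (pot m N n q t) x)"
proof -
  let ?W = "pot m N n q t"
  have p: "(i, a, b) \<in> coords m N" "(i, b, a) \<in> coords m N" "(i, a, a) \<in> coords m N" using i by auto
  have cp: "cpoly (coords m N) (pd p f)" "cpoly (coords m N) (\<lambda>x. f x * pd p ?W x)" if "p \<in> coords m N" for p
    using that f cpoly_W by (auto intro!: cpoly_pd cpoly.mult)
  have ip: "integr (pd p f)" "integr (\<lambda>x. f x * pd p ?W x)" if "p \<in> coords m N" for p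
    using cp[OF that] by auto
  have comb: "expect (\<lambda>x. e * pd r f x + e' * pd r' f x) = expect (\<lambda>x. e * (f x * pd r ?W x) + e' * (f x * pd r' ?W x))"
    if "r \<in> coords m N" "r' \<in> coords m N" for e e' r r'
    using that ip by (simp add: expect_add expect_cmult integr_cmult integration_by_parts f)
  consider "a = b" | "a < b" | "b < a" by linarith
  then show ?thesis
  proof cases
    case 1
    then show ?thesis using integration_by_parts[OF p(3) f] by (simp add: unit_deriv_def[abs_def])
  next
    case 2
    then show ?thesis using comb[OF p(1,2), of "1/2" "- \<i>/2"] by (simp add: unit_deriv_def[abs_def] algebra_simps)
  next
    case 3
    then show ?thesis using comb[OF p(2,1), of "1/2" "\<i>/2"] by (simp add: unit_deriv_def[abs_def] algebra_simps)
  qed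
qed

lemma cpoly_unit_deriv: "i < m \<Longrightarrow> a < N \<Longrightarrow> b < N \<Longrightarrow> cpoly (coords m N) f \<Longrightarrow> cpoly (coords m N) (unit_deriv i a b f)"
proof -
  assume *: "i < m" "a < N" "b < N" "cpoly (coords m N) f"
  then have pd: "cpoly (coords m N) (pd (i, a', b') f)" if "a' \<in> {a, b}" "b' \<in> {a, b}" for a' b'
    using that by (intro cpoly_pd) auto
  show ?thesis
  proof (cases a b rule: linorder_cases)
    case less
    then have "unit_deriv i a b f = (\<lambda>x. 1/2 * (pd (i, a, b) f x - \<i> * pd (i, b, a) f x))" by (auto simp: unit_deriv_def)
    then show ?thesis using pd by (simp only:) (intro cpoly_cmult cpoly_diff pd, auto)
  next
    case equal
    then show ?thesis using pd[of a a] by (simp add: unit_deriv_def[abs_def])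
  next
    case greater
    then have "unit_deriv i a b f = (\<lambda>x. 1/2 * (pd (i, b, a) f x + \<i> * pd (i, a, b) f x))" by (auto simp: unit_deriv_def)
    then show ?thesis using pd by (simp only:) (intro cpoly_cmult cpoly.add pd, auto)
  qed
qed

text \<open>Integrate the divergence of the field whose component at the matrix unit
  \<open>(i, a, b)\<close> is entry \<open>(a, b)\<close> of the word \<open>w\<close> times the
  remaining traces. Splitting yields \<open>length vs + 2\<close> traces, merging
  \<open>length vs\<close>, and the derivative of the potential \<open>length vs + 1\<close> with an
  additional factor \<open>N\<close>; this fixes the powers of \<open>N\<close>.\<close>

theorem loop_equation:
  assumes F: "(i # w) # vs \<in> forests {..<m}"
  shows "corr ((i # w) # vs) = loop_main n q t corr i w vs + loop_merge corr i w vs / (of_nat N)\<^sup>2"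
proof -
  let ?W = "pot m N n q t"
  have i: "i < m" and w: "set w \<subseteq> {..<m}" and vs: "\<And>v. v \<in> set vs \<Longrightarrow> set v \<subseteq> {..<m}"
    using F by (auto simp: forests_def)
  define P where "P = (\<lambda>vs x. prod_list (map (wtrace N x) vs))"
  define f where "f = (\<lambda>a b x. entry N (hentry x) w a b * P vs x)"
  have cP: "cpoly (coords m N) (P vs)" unfolding P_def using vs by (rule cpoly_prod_wtrace)
  have cf: "cpoly (coords m N) (f a b)" if "a < N" "b < N" for a b
    unfolding f_def using that w cP by (intro cpoly.mult cpoly_entry) auto
  define Pm where "Pm = (\<lambda>j x. P (take j vs @ drop (Suc j) vs) x)"
  \<comment> \<open>The derivative either cuts \<open>w\<close> into two traces or hits one of the
    other traces, which then fuses with \<open>w\<close>.\<close>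
  have left: "(\<Sum>a<N. \<Sum>b<N. unit_deriv i a b (f a b) x) =
     (\<Sum>k\<in>occurrences i w. P (take k w # drop (Suc k) w # vs) x) +
     (\<Sum>j<length vs. \<Sum>k\<in>occurrences i (vs ! j). P ((w @ rotate_out k (vs ! j)) # take j vs @ drop (Suc j) vs) x)" for x
  proof -
    have "unit_deriv i a b (f a b) x = (\<Sum>j<length vs. \<Sum>k\<in>occurrences i (vs ! j). entry N (hentry x) w a b * entry N (hentry x) (rotate_out k (vs ! j)) b a * Pm j x)
       + (\<Sum>k\<in>occurrences i w. entry N (hentry x) (take k w) a a * entry N (hentry x) (drop (Suc k) w) b b * P vs x)"
      if ab: "a < N" "b < N" for a b
    proof -
      have "unit_deriv i a b (f a b) x = entry N (hentry x) w a b * unit_deriv i a b (P vs) x + unit_deriv i a b (\<lambda>x. entry N (hentry x) w a b) x * P vs x"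
        unfolding f_def using w ab cP by (intro unit_deriv_mult[OF i ab] cpoly_entry) auto
      also have "unit_deriv i a b (P vs) x = (\<Sum>j<length vs. \<Sum>k\<in>occurrences i (vs ! j). entry N (hentry x) (rotate_out k (vs ! j)) b a * Pm j x)"
        unfolding P_def Pm_def using vs
        by (subst unit_deriv_prod_list[OF i ab vs]) (auto simp: unit_deriv_wtrace[OF i ab] sum_distrib_right)
      also have "unit_deriv i a b (\<lambda>x. entry N (hentry x) w a b) x = (\<Sum>k\<in>occurrences i w. entry N (hentry x) (take k w) a a * entry N (hentry x) (drop (Suc k) w) b b)"
        using w ab by (intro unit_deriv_entry[OF i ab])
      finally show ?thesis by (simp add: sum_distrib_left sum_distrib_right mult.assoc)
    qed
    then have "(\<Sum>a<N. \<Sum>b<N. unit_deriv i a b (f a b) x) =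
       (\<Sum>a<N. \<Sum>b<N. \<Sum>j<length vs. \<Sum>k\<in>occurrences i (vs ! j). entry N (hentry x) w a b * entry N (hentry x) (rotate_out k (vs ! j)) b a * Pm j x)
       + (\<Sum>a<N. \<Sum>b<N. \<Sum>k\<in>occurrences i w. entry N (hentry x) (take k w) a a * entry N (hentry x) (drop (Suc k) w) b b * P vs x)"
      by (simp add: sum.distrib)
    also have "(\<Sum>a<N. \<Sum>b<N. \<Sum>k\<in>occurrences i w. entry N (hentry x) (take k w) a a * entry N (hentry x) (drop (Suc k) w) b b * P vs x)
       = (\<Sum>k\<in>occurrences i w. \<Sum>a<N. \<Sum>b<N. entry N (hentry x) (take k w) a a * entry N (hentry x) (drop (Suc k) w) b b * P vs x)"
      by (subst sum.swap[of _ "occurrences i w"], subst (2) sum.swap) (rule refl)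
    also have "\<dots> = (\<Sum>k\<in>occurrences i w. P (take k w # drop (Suc k) w # vs) x)"
      by (simp add: P_def wtrace_def sum_distrib_left[symmetric] sum_distrib_right[symmetric] mult.assoc)
    also have "(\<Sum>a<N. \<Sum>b<N. \<Sum>j<length vs. \<Sum>k\<in>occurrences i (vs ! j). entry N (hentry x) w a b * entry N (hentry x) (rotate_out k (vs ! j)) b a * Pm j x)
       = (\<Sum>a<N. \<Sum>j<length vs. \<Sum>b<N. \<Sum>k\<in>occurrences i (vs ! j). entry N (hentry x) w a b * entry N (hentry x) (rotate_out k (vs ! j)) b a * Pm j x)"
      by (intro sum.cong refl sum.swap)
    also have "\<dots> = (\<Sum>j<length vs. \<Sum>a<N. \<Sum>b<N. \<Sum>k\<in>occurrences i (vs ! j). entry N (hentry x) w a b * entry N (hentry x) (rotate_out k (vs ! j)) b a * Pm j x)"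
      by (rule sum.swap)
    also have "\<dots> = (\<Sum>j<length vs. \<Sum>k\<in>occurrences i (vs ! j). wtrace N x (w @ rotate_out k (vs ! j)) * Pm j x)"
    proof (rule sum.cong[OF refl])
      fix j
      have "(\<Sum>a<N. \<Sum>b<N. \<Sum>k\<in>occurrences i (vs ! j). entry N (hentry x) w a b * entry N (hentry x) (rotate_out k (vs ! j)) b a * Pm j x)
        = (\<Sum>a<N. \<Sum>k\<in>occurrences i (vs ! j). \<Sum>b<N. entry N (hentry x) w a b * entry N (hentry x) (rotate_out k (vs ! j)) b a * Pm j x)"
        by (intro sum.cong refl sum.swap)
      also have "\<dots> = (\<Sum>k\<in>occurrences i (vs ! j). \<Sum>a<N. \<Sum>b<N. entry N (hentry x) w a b * entry N (hentry x) (rotate_out k (vs ! j)) b a * Pm j x)"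
        by (rule sum.swap)
      also have "\<dots> = (\<Sum>k\<in>occurrences i (vs ! j). wtrace N x (w @ rotate_out k (vs ! j)) * Pm j x)"
        by (simp add: sum_entry_entry[symmetric] sum_distrib_right)
      finally show "(\<Sum>a<N. \<Sum>b<N. \<Sum>k\<in>occurrences i (vs ! j). entry N (hentry x) w a b * entry N (hentry x) (rotate_out k (vs ! j)) b a * Pm j x)
         = (\<Sum>k\<in>occurrences i (vs ! j). wtrace N x (w @ rotate_out k (vs ! j)) * Pm j x)" .
    qed
    also have "\<dots> = (\<Sum>j<length vs. \<Sum>k\<in>occurrences i (vs ! j). P ((w @ rotate_out k (vs ! j)) # take j vs @ drop (Suc j) vs) x)"
      by (simp add: Pm_def P_def)
    finally show ?thesis by (simp add: add.commute)
  qed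
  \<comment> \<open>The words of the potential are inserted, rotated, behind \<open>w\<close>. The
    Gaussian part contributes the letter \<open>i\<close> alone and thereby the forest for which the
    equation is solved.\<close>
  have right: "(\<Sum>a<N. \<Sum>b<N. f a b x * unit_deriv i a b ?W x) =
     of_nat N * (\<Sum>j=1..n. t j * (\<Sum>k\<in>occurrences i (q j). P ((w @ rotate_out k (q j)) # vs) x)) + of_nat N * P ((i # w) # vs) x" for x
  proof -
    have e1: "entry N (hentry x) [i] b a = hentry x i b a" if "a < N" for a b
      using that by (simp add: if_distrib[of "\<lambda>z. _ * z"] cong: if_cong)
    have 1: "f a b x * unit_deriv i a b ?W x = of_nat N * P vs x * ((\<Sum>j=1..n. t j * (\<Sum>k\<in>occurrences i (q j). entry N (hentry x) w a b * entry N (hentry x) (rotate_out k (q j)) b a)) + entry N (hentry x) w a b * entry N (hentry x) [i] b a)"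
      if ab: "a < N" "b < N" for a b
      using q by (subst unit_deriv_pot[OF i ab]) (auto simp: f_def e1[OF ab(1)] algebra_simps sum_distrib_left simp del: entry.simps)
    have 2: "(\<Sum>a<N. \<Sum>b<N. \<Sum>j=1..n. t j * (\<Sum>k\<in>occurrences i (q j). entry N (hentry x) w a b * entry N (hentry x) (rotate_out k (q j)) b a))
        = (\<Sum>j=1..n. t j * (\<Sum>k\<in>occurrences i (q j). wtrace N x (w @ rotate_out k (q j))))"
    proof -
      have "(\<Sum>a<N. \<Sum>b<N. \<Sum>j=1..n. t j * (\<Sum>k\<in>occurrences i (q j). entry N (hentry x) w a b * entry N (hentry x) (rotate_out k (q j)) b a))
        = (\<Sum>a<N. \<Sum>j=1..n. \<Sum>b<N. t j * (\<Sum>k\<in>occurrences i (q j). entry N (hentry x) w a b * entry N (hentry x) (rotate_out k (q j)) b a))"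
        by (intro sum.cong refl sum.swap)
      also have "\<dots> = (\<Sum>j=1..n. \<Sum>a<N. \<Sum>b<N. t j * (\<Sum>k\<in>occurrences i (q j). entry N (hentry x) w a b * entry N (hentry x) (rotate_out k (q j)) b a))"
        by (rule sum.swap)
      also have "\<dots> = (\<Sum>j=1..n. t j * (\<Sum>a<N. \<Sum>b<N. \<Sum>k\<in>occurrences i (q j). entry N (hentry x) w a b * entry N (hentry x) (rotate_out k (q j)) b a))"
        by (simp add: sum_distrib_left)
      also have "\<dots> = (\<Sum>j=1..n. t j * (\<Sum>k\<in>occurrences i (q j). wtrace N x (w @ rotate_out k (q j))))"
      proof (rule sum.cong[OF refl], rule arg_cong[where f = "(*) (t _)"])
        fix j
        have "(\<Sum>a<N. \<Sum>b<N. \<Sum>k\<in>occurrences i (q j). entry N (hentry x) w a b * entry N (hentry x) (rotate_out k (q j)) b a)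
          = (\<Sum>a<N. \<Sum>k\<in>occurrences i (q j). \<Sum>b<N. entry N (hentry x) w a b * entry N (hentry x) (rotate_out k (q j)) b a)"
          by (intro sum.cong refl sum.swap)
        also have "\<dots> = (\<Sum>k\<in>occurrences i (q j). \<Sum>a<N. \<Sum>b<N. entry N (hentry x) w a b * entry N (hentry x) (rotate_out k (q j)) b a)"
          by (rule sum.swap)
        finally show "(\<Sum>a<N. \<Sum>b<N. \<Sum>k\<in>occurrences i (q j). entry N (hentry x) w a b * entry N (hentry x) (rotate_out k (q j)) b a) = (\<Sum>k\<in>occurrences i (q j). wtrace N x (w @ rotate_out k (q j)))"
          by (simp only: sum_entry_entry)
      qed
      finally show ?thesis .
    qed
    have "(\<Sum>a<N. \<Sum>b<N. f a b x * unit_deriv i a b ?W x) = of_nat N * P vs x *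
       ((\<Sum>a<N. \<Sum>b<N. \<Sum>j=1..n. t j * (\<Sum>k\<in>occurrences i (q j). entry N (hentry x) w a b * entry N (hentry x) (rotate_out k (q j)) b a))
       + (\<Sum>a<N. \<Sum>b<N. entry N (hentry x) w a b * entry N (hentry x) [i] b a))"
      unfolding sum.distrib[symmetric] sum_distrib_left[of "of_nat N * P vs x"] by (intro sum.cong refl) (use 1 in auto)
    also have "\<dots> = of_nat N * P vs x * ((\<Sum>j=1..n. t j * (\<Sum>k\<in>occurrences i (q j). wtrace N x (w @ rotate_out k (q j)))) + wtrace N x ([i] @ w))"
      unfolding 2 sum_entry_entry by (simp only: wtrace_swap[of N x w "[i]"])
    also have "\<dots> = of_nat N * (\<Sum>j=1..n. t j * (\<Sum>k\<in>occurrences i (q j). P ((w @ rotate_out k (q j)) # vs) x)) + of_nat N * P ((i # w) # vs) x"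
      by (simp add: P_def distrib_left sum_distrib_left mult_ac)
    finally show ?thesis .
  qed
  have Pi: "integr (P ws)" "expect (P ws) = of_nat N ^ length ws * corr ws" if "ws \<in> forests {..<m}" for ws
    using that expect_prod_wtrace[OF that] unfolding P_def
    by (auto intro!: integr_cpoly cpoly_prod_wtrace simp: forests_def)
  have F1: "take k w # drop (Suc k) w # vs \<in> forests {..<m}" for k
    using F lists_take_drop[of w "{..<m}"] by auto
  have F2: "(w @ rotate_out k v) # ws \<in> forests {..<m}" if "v \<in> lists {..<m}" "ws \<in> forests {..<m}" for k v ws
    using F that rotate_out_lists[of v "{..<m}" k] by auto
  have vsj: "vs ! j \<in> lists {..<m}" "take j vs @ drop (Suc j) vs \<in> forests {..<m}" if "j < length vs" for j
    using F that forests_take_drop[of vs "{..<m}"] by (auto simp: forests_def in_lists_conv_set)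
  have qj: "q j \<in> lists {..<m}" if "j \<in> {1..n}" for j using q[OF that] by auto
  have vsF: "vs \<in> forests {..<m}" using F by simp
  have len: "length (take j vs @ drop (Suc j) vs) = length vs - 1" if "j < length vs" for j using that by simp
  have "(\<Sum>a<N. \<Sum>b<N. expect (unit_deriv i a b (f a b))) = (\<Sum>a<N. \<Sum>b<N. expect (\<lambda>x. f a b x * unit_deriv i a b ?W x))"
    using matrix_integration_by_parts[OF i _ _ cf] by (intro sum.cong refl) auto
  also have "(\<Sum>a<N. \<Sum>b<N. expect (unit_deriv i a b (f a b))) = expect (\<lambda>x. \<Sum>a<N. \<Sum>b<N. unit_deriv i a b (f a b) x)"
    using i cf by (intro expect_double_sum(1)[symmetric] integr_cpoly cpoly_unit_deriv) auto
  also have "\<dots> = (\<Sum>k\<in>occurrences i w. of_nat N ^ (length vs + 2) * corr (take k w # drop (Suc k) w # vs))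
     + (\<Sum>j<length vs. \<Sum>k\<in>occurrences i (vs ! j). of_nat N ^ length vs * corr ((w @ rotate_out k (vs ! j)) # take j vs @ drop (Suc j) vs))"
    unfolding left
  proof (subst expect_add)
    have i1: "integr (P (take k w # drop (Suc k) w # vs))" for k by (rule Pi[OF F1])
    have i2: "integr (P ((w @ rotate_out k (vs ! j)) # take j vs @ drop (Suc j) vs))" if "j \<in> {..<length vs}" for j k
      using that vsj by (intro Pi F2) auto
    show "integr (\<lambda>x. \<Sum>k\<in>occurrences i w. P (take k w # drop (Suc k) w # vs) x)" using i1 by (intro integr_sum)
    show "integr (\<lambda>x. \<Sum>j<length vs. \<Sum>k\<in>occurrences i (vs ! j). P ((w @ rotate_out k (vs ! j)) # take j vs @ drop (Suc j) vs) x)"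
      using i2 by (intro expect_double_sum(2))
    have "expect (\<lambda>x. \<Sum>k\<in>occurrences i w. P (take k w # drop (Suc k) w # vs) x) = (\<Sum>k\<in>occurrences i w. of_nat N ^ (length vs + 2) * corr (take k w # drop (Suc k) w # vs))"
      by (subst expect_sum[OF i1]) (simp add: Pi(2)[OF F1])
    moreover have "expect (\<lambda>x. \<Sum>j<length vs. \<Sum>k\<in>occurrences i (vs ! j). P ((w @ rotate_out k (vs ! j)) # take j vs @ drop (Suc j) vs) x)
      = (\<Sum>j<length vs. \<Sum>k\<in>occurrences i (vs ! j). of_nat N ^ length vs * corr ((w @ rotate_out k (vs ! j)) # take j vs @ drop (Suc j) vs))"
    proof (subst expect_double_sum(1)[OF i2], assumption, intro sum.cong refl)
      fix j k assume j: "j \<in> {..<length vs}"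
      have "expect (P ((w @ rotate_out k (vs ! j)) # take j vs @ drop (Suc j) vs)) = of_nat N ^ length ((w @ rotate_out k (vs ! j)) # take j vs @ drop (Suc j) vs) * corr ((w @ rotate_out k (vs ! j)) # take j vs @ drop (Suc j) vs)"
        using j vsj by (intro Pi F2) auto
      moreover have "length ((w @ rotate_out k (vs ! j)) # take j vs @ drop (Suc j) vs) = length vs" using j by auto
      ultimately show "expect (P ((w @ rotate_out k (vs ! j)) # take j vs @ drop (Suc j) vs)) = of_nat N ^ length vs * corr ((w @ rotate_out k (vs ! j)) # take j vs @ drop (Suc j) vs)"
        by (simp only:)
    qed
    ultimately show "expect (\<lambda>x. \<Sum>k\<in>occurrences i w. P (take k w # drop (Suc k) w # vs) x) + expect (\<lambda>x. \<Sum>j<length vs. \<Sum>k\<in>occurrences i (vs ! j). P ((w @ rotate_out k (vs ! j)) # take j vs @ drop (Suc j) vs) x)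
      = (\<Sum>k\<in>occurrences i w. of_nat N ^ (length vs + 2) * corr (take k w # drop (Suc k) w # vs))
     + (\<Sum>j<length vs. \<Sum>k\<in>occurrences i (vs ! j). of_nat N ^ length vs * corr ((w @ rotate_out k (vs ! j)) # take j vs @ drop (Suc j) vs))"
      by (simp only:)
  qed
  also have "(\<Sum>a<N. \<Sum>b<N. expect (\<lambda>x. f a b x * unit_deriv i a b ?W x)) = expect (\<lambda>x. \<Sum>a<N. \<Sum>b<N. f a b x * unit_deriv i a b ?W x)"
    using i cf cpoly_W by (intro expect_double_sum(1)[symmetric] integr_cpoly cpoly.mult cpoly_unit_deriv) auto
  also have "\<dots> = of_nat N * (\<Sum>j=1..n. t j * (\<Sum>k\<in>occurrences i (q j). of_nat N ^ (length vs + 1) * corr ((w @ rotate_out k (q j)) # vs)))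
     + of_nat N * (of_nat N ^ (length vs + 1) * corr ((i # w) # vs))"
    unfolding right
  proof (subst expect_add)
    have i1: "integr (P ((w @ rotate_out k (q j)) # vs))" if "j \<in> {1..n}" for j k by (rule Pi[OF F2[OF qj[OF that] vsF]])
    have i2: "integr (\<lambda>x. t j * (\<Sum>k\<in>occurrences i (q j). P ((w @ rotate_out k (q j)) # vs) x))" if "j \<in> {1..n}" for j
      using i1[OF that] by (intro integr_cmult integr_sum)
    have i3: "integr (\<lambda>x. \<Sum>j=1..n. t j * (\<Sum>k\<in>occurrences i (q j). P ((w @ rotate_out k (q j)) # vs) x))"
      using i2 by (rule integr_sum)
    then show "integr (\<lambda>x. of_nat N * (\<Sum>j=1..n. t j * (\<Sum>k\<in>occurrences i (q j). P ((w @ rotate_out k (q j)) # vs) x)))"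
      by (rule integr_cmult)
    show "integr (\<lambda>x. of_nat N * P ((i # w) # vs) x)" by (intro integr_cmult Pi F)
    have "expect (\<lambda>x. t j * (\<Sum>k\<in>occurrences i (q j). P ((w @ rotate_out k (q j)) # vs) x)) =
       t j * (\<Sum>k\<in>occurrences i (q j). of_nat N ^ (length vs + 1) * corr ((w @ rotate_out k (q j)) # vs))" if j: "j \<in> {1..n}" for j
    proof -
      have "expect (\<lambda>x. t j * (\<Sum>k\<in>occurrences i (q j). P ((w @ rotate_out k (q j)) # vs) x)) = t j * (\<Sum>k\<in>occurrences i (q j). expect (P ((w @ rotate_out k (q j)) # vs)))"
        using i1[OF j] by (subst expect_cmult, intro integr_sum) (auto simp: expect_sum)
      then show ?thesis using Pi(2)[OF F2[OF qj[OF j] vsF]] by simp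
    qed
    then have "expect (\<lambda>x. of_nat N * (\<Sum>j=1..n. t j * (\<Sum>k\<in>occurrences i (q j). P ((w @ rotate_out k (q j)) # vs) x)))
      = of_nat N * (\<Sum>j=1..n. t j * (\<Sum>k\<in>occurrences i (q j). of_nat N ^ (length vs + 1) * corr ((w @ rotate_out k (q j)) # vs)))"
      using i2 i3 by (simp only: expect_cmult expect_sum cong: sum.cong)
    moreover have "expect (\<lambda>x. of_nat N * P ((i # w) # vs) x) = of_nat N * (of_nat N ^ (length vs + 1) * corr ((i # w) # vs))"
      using Pi[OF F] by (simp add: expect_cmult)
    ultimately show "expect (\<lambda>x. of_nat N * (\<Sum>j=1..n. t j * (\<Sum>k\<in>occurrences i (q j). P ((w @ rotate_out k (q j)) # vs) x))) + expect (\<lambda>x. of_nat N * P ((i # w) # vs) x)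
      = of_nat N * (\<Sum>j=1..n. t j * (\<Sum>k\<in>occurrences i (q j). of_nat N ^ (length vs + 1) * corr ((w @ rotate_out k (q j)) # vs)))
     + of_nat N * (of_nat N ^ (length vs + 1) * corr ((i # w) # vs))" by (simp only:)
  qed
  finally have main: "of_nat N ^ (length vs + 2) * corr ((i # w) # vs) =
      of_nat N ^ (length vs + 2) * loop_main n q t corr i w vs + of_nat N ^ length vs * loop_merge corr i w vs"
    by (simp add: loop_main_def loop_merge_def sum_distrib_left right_diff_distrib algebra_simps)
  have "of_nat N ^ (length vs + 2) * corr ((i # w) # vs) = of_nat N ^ (length vs + 2) * (loop_main n q t corr i w vs + loop_merge corr i w vs / (of_nat N)\<^sup>2)"
    unfolding main using N by (simp add: distrib_left power_add field_simps power2_eq_square)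
  then show ?thesis using N by simp
qed

end

section \<open>Moment bounds\<close>

text \<open>In the real coordinates, conjugation of all matrices by the signed permutation matrix given by
  an involution \<open>\<sigma>\<close> and signs \<open>s\<close> is a signed permutation: an imaginary part changes sign when \<open>\<sigma>\<close>
  reverses the order of its indices.\<close>

definition conj_index :: "(nat \<Rightarrow> nat) \<Rightarrow> nat \<times> nat \<times> nat \<Rightarrow> nat \<times> nat \<times> nat" where
  "conj_index \<sigma> = (\<lambda>(i, a, b). if a = b then (i, \<sigma> a, \<sigma> b)
     else if a < b then (i, min (\<sigma> a) (\<sigma> b), max (\<sigma> a) (\<sigma> b)) else (i, max (\<sigma> a) (\<sigma> b), min (\<sigma> a) (\<sigma> b)))"

definition conj_sign :: "(nat \<Rightarrow> nat) \<Rightarrow> (nat \<Rightarrow> real) \<Rightarrow> nat \<times> nat \<times> nat \<Rightarrow> real" where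
  "conj_sign \<sigma> s = (\<lambda>(i, a, b). s a * s b * (if b < a \<and> \<sigma> a < \<sigma> b then - 1 else 1))"

definition conj_coords :: "(nat \<Rightarrow> nat) \<Rightarrow> (nat \<Rightarrow> real) \<Rightarrow> (nat \<times> nat \<times> nat \<Rightarrow> real) \<Rightarrow> nat \<times> nat \<times> nat \<Rightarrow> real" where
  "conj_coords \<sigma> s x p = conj_sign \<sigma> s p * x (conj_index \<sigma> p)"

context
  fixes N :: nat and \<sigma> :: "nat \<Rightarrow> nat" and s :: "nat \<Rightarrow> real"
  assumes inv: "\<And>a. \<sigma> (\<sigma> a) = a" and less: "\<And>a. a < N \<Longrightarrow> \<sigma> a < N" and s: "\<And>a. s a = 1 \<or> s a = -1"
begin

lemma s_square: "s a * s a = 1"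
  using s[of a] by auto

lemma \<sigma>_eq_iff: "\<sigma> a = \<sigma> b \<longleftrightarrow> a = b"
  by (metis inv)

lemma hentry_conj: "hentry (conj_coords \<sigma> s x) i a b = of_real (s a * s b) * hentry x i (\<sigma> a) (\<sigma> b)"
proof -
  consider "a = b" | "a < b" "\<sigma> a < \<sigma> b" | "a < b" "\<sigma> b < \<sigma> a" | "b < a" "\<sigma> a < \<sigma> b" | "b < a" "\<sigma> b < \<sigma> a"
    using \<sigma>_eq_iff[of a b] by (metis linorder_neqE_nat)
  then show ?thesis
    by cases (auto simp: hentry_def conj_coords_def conj_sign_def conj_index_def min_def max_def complex_eq_iff)
qed

lemma bij_betw_\<sigma>: "bij_betw \<sigma> {..<N} {..<N}"
  by (rule bij_betw_byWitness[where f' = \<sigma>]) (auto simp: inv less)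

text \<open>Signs of summation indices occur in pairs and cancel, and the permutation only relabels
  these indices.\<close>

lemma entry_conj: "entry N (hentry (conj_coords \<sigma> s x)) w a b = of_real (s a * s b) * entry N (hentry x) w (\<sigma> a) (\<sigma> b)" 
proof (induction w arbitrary: a)
  case Nil
  then show ?case using s_square by (auto simp: \<sigma>_eq_iff simp flip: of_real_mult)
next
  case (Cons i w)
  have "entry N (hentry (conj_coords \<sigma> s x)) (i # w) a b = (\<Sum>k<N. of_real (s a * s k) * hentry x i (\<sigma> a) (\<sigma> k) * (of_real (s k * s b) * entry N (hentry x) w (\<sigma> k) (\<sigma> b)))"
    by (simp only: entry.simps Cons.IH hentry_conj)
  also have "\<dots> = (\<Sum>k<N. of_real (s a * s b) * (hentry x i (\<sigma> a) (\<sigma> k) * entry N (hentry x) w (\<sigma> k) (\<sigma> b)))"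
  proof (rule sum.cong[OF refl])
    fix k
    have "complex_of_real (s k) * of_real (s k) = 1" using s_square[of k] by (simp flip: of_real_mult)
    then have "complex_of_real (s k) * (of_real (s k) * z) = z" for z by (metis mult.assoc mult_1)
    then show "of_real (s a * s k) * hentry x i (\<sigma> a) (\<sigma> k) * (of_real (s k * s b) * entry N (hentry x) w (\<sigma> k) (\<sigma> b)) = of_real (s a * s b) * (hentry x i (\<sigma> a) (\<sigma> k) * entry N (hentry x) w (\<sigma> k) (\<sigma> b))"
      by (simp add: mult_ac)
  qed
  also have "\<dots> = of_real (s a * s b) * (\<Sum>k<N. hentry x i (\<sigma> a) (\<sigma> k) * entry N (hentry x) w (\<sigma> k) (\<sigma> b))"
    by (simp only: sum_distrib_left)
  also have "(\<Sum>k<N. hentry x i (\<sigma> a) (\<sigma> k) * entry N (hentry x) w (\<sigma> k) (\<sigma> b)) = (\<Sum>k<N. hentry x i (\<sigma> a) k * entry N (hentry x) w k (\<sigma> b))"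
    by (rule sum.reindex_bij_betw[OF bij_betw_\<sigma>])
  finally show ?case by simp
qed

lemma wtrace_conj: "wtrace N (conj_coords \<sigma> s x) w = wtrace N x w"
proof -
  have "wtrace N (conj_coords \<sigma> s x) w = (\<Sum>a<N. entry N (hentry x) w (\<sigma> a) (\<sigma> a))"
    unfolding wtrace_def by (simp add: entry_conj s_square)
  also have "\<dots> = wtrace N x w" unfolding wtrace_def by (rule sum.reindex_bij_betw[OF bij_betw_\<sigma>])
  finally show ?thesis .
qed

lemma pot_conj: "pot m N n q t (conj_coords \<sigma> s x) = pot m N n q t x"
  by (simp add: pot_def wtrace_conj)

lemma conj_index_involution: "conj_index \<sigma> (conj_index \<sigma> p) = p"
proof -
  obtain i a b where p: "p = (i, a, b)" by (cases p)
  consider "a = b" | "a < b" "\<sigma> a < \<sigma> b" | "a < b" "\<sigma> b < \<sigma> a" | "b < a" "\<sigma> a < \<sigma> b" | "b < a" "\<sigma> b < \<sigma> a"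
    using \<sigma>_eq_iff[of a b] by (metis linorder_neqE_nat)
  then show ?thesis
    by cases (auto simp: p conj_index_def inv min_def max_def)
qed

lemma bij_betw_conj_index: "bij_betw (conj_index \<sigma>) (coords m N) (coords m N)"
  by (rule bij_betw_byWitness[where f' = "conj_index \<sigma>"])
     (auto simp: conj_index_involution, auto simp: conj_index_def less min_def max_def split: if_splits)

lemma distr_conj: "distr (\<Pi>\<^sub>M p\<in>coords m N. lborel) (\<Pi>\<^sub>M p\<in>coords m N. lborel) (\<lambda>x. \<lambda>p\<in>coords m N. conj_coords \<sigma> s x p) = (\<Pi>\<^sub>M p\<in>coords m N. lborel)"
  unfolding conj_coords_def
proof (rule distr_signed_permutation[OF finite_coords bij_betw_conj_index])
  fix p :: "nat \<times> nat \<times> nat"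
  obtain i a b where p: "p = (i, a, b)" by (cases p)
  show "conj_sign \<sigma> s p = 1 \<or> conj_sign \<sigma> s p = - 1"
    using s[of a] s[of b] by (auto simp: p conj_sign_def)
qed

end

text \<open>Obtained by solving \<open>c * S2 \<le> 2 * m + m / c\<close> for the sum
  \<open>S2\<close> of the squared means and then using
  \<open>\<bar>y\<bar> \<le> 1 + y\<^sup>2\<close>.\<close>

definition mean_bound :: "nat \<Rightarrow> real \<Rightarrow> real" where
  "mean_bound m c = 1 + (2 * real m + real m / c) / c"

text \<open>The 32 is \<open>8 * 4\<close>: operator norms are at most 8 times the bound for real
  and imaginary parts on the net, and the two moments for a pair of net vectors add up to at most 4
  times the exponential to the power \<open>N\<close>. \<open>2 ^ 208\<close> counts pairs of net
  vectors per power of \<open>N\<close>, and \<open>m\<close> counts the matrices. The leading 2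
  absorbs a sum of two terms.\<close>

definition moment_radius :: "nat \<Rightarrow> real \<Rightarrow> real" where
  "moment_radius m c = 2 * (32 * real m * 2 ^ 208 * exp (4 * mean_bound m c + 64 / c))"

text \<open>An off-diagonal coordinate occurs in both entries \<open>(a, b)\<close> and
  \<open>(b, a)\<close>, so its coefficient collects two products; for imaginary parts they have
  opposite signs.\<close>

definition bform_coeff :: "nat \<Rightarrow> (nat \<Rightarrow> complex) \<Rightarrow> (nat \<Rightarrow> complex) \<Rightarrow> nat \<times> nat \<times> nat \<Rightarrow> real" where
  "bform_coeff i u v = (\<lambda>(j, a, b). if j \<noteq> i then 0 else if a = b then Re (u a * v a)
     else if a < b then Re (u a * v b + u b * v a) else Re (\<i> * (u b * v a - u a * v b)))"

lemma sum_coords: "(\<Sum>p\<in>coords m N. g p) = (\<Sum>i<m. \<Sum>a<N. \<Sum>b<N. g (i, a, b))"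
  by (simp add: coords_def sum.cartesian_product)

text \<open>Real and imaginary parts share a pair of mirror entries, so expressions in coordinates
  and in entries agree only after adding the terms at \<open>(a, b)\<close> and
  \<open>(b, a)\<close>.\<close>

lemma sum_symmetrize:
  fixes f g :: "nat \<Rightarrow> nat \<Rightarrow> real"
  assumes "\<And>a b. f a b + f b a = g a b + g b a"
  shows "(\<Sum>a<N. \<Sum>b<N. f a b) = (\<Sum>a<N. \<Sum>b<N. g a b)"
proof -
  have *: "2 * (\<Sum>a<N. \<Sum>b<N. h a b) = (\<Sum>a<N. \<Sum>b<N. h a b + h b a)" for h :: "nat \<Rightarrow> nat \<Rightarrow> real"
  proof -
    have "(\<Sum>a<N. \<Sum>b<N. h b a) = (\<Sum>a<N. \<Sum>b<N. h a b)" by (rule sum.swap)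
    then show ?thesis by (simp add: sum.distrib)
  qed
  have "2 * (\<Sum>a<N. \<Sum>b<N. f a b) = 2 * (\<Sum>a<N. \<Sum>b<N. g a b)" unfolding * by (simp only: assms)
  then show ?thesis by simp
qed

lemma Re_bform:
  assumes "i < m"
  shows "Re (bform N (hentry x i) u v) = (\<Sum>p\<in>coords m N. bform_coeff i u v p * x p)"
proof -
  have "(\<Sum>p\<in>coords m N. bform_coeff i u v p * x p) = (\<Sum>j<m. if j = i then \<Sum>a<N. \<Sum>b<N. bform_coeff i u v (i, a, b) * x (i, a, b) else 0)"
    unfolding sum_coords by (intro sum.cong refl) (auto simp: bform_coeff_def)
  also have "\<dots> = (\<Sum>a<N. \<Sum>b<N. bform_coeff i u v (i, a, b) * x (i, a, b))" using assms by simp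
  also have "\<dots> = (\<Sum>a<N. \<Sum>b<N. Re (u a * hentry x i a b * v b))"
  proof (rule sum_symmetrize)
    fix a b :: nat
    consider "a = b" | "a < b" | "b < a" by linarith
    then show "bform_coeff i u v (i, a, b) * x (i, a, b) + bform_coeff i u v (i, b, a) * x (i, b, a) = Re (u a * hentry x i a b * v b) + Re (u b * hentry x i b a * v a)"
      by cases (simp_all add: bform_coeff_def hentry_def algebra_simps)
  qed
  finally show ?thesis by (simp add: bform_def)
qed

lemma sqnorm_bform_coeff:
  assumes "i < m"
  shows "sqnorm (coords m N) (bform_coeff i u v) \<le> 4 * (vnorm N u)\<^sup>2 * (vnorm N v)\<^sup>2"
proof -
  define h where "h = (\<lambda>a b. (cmod (u a))\<^sup>2 * (cmod (v b))\<^sup>2)"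
  have sq: "(Re z)\<^sup>2 \<le> 2 * h a b + 2 * h b a" if "cmod z \<le> cmod (u a * v b) + cmod (u b * v a)" for z a b
  proof -
    have "(Re z)\<^sup>2 \<le> (cmod z)\<^sup>2" using abs_Re_le_cmod[of z] by (simp flip: abs_le_square_iff)
    also have "\<dots> \<le> (cmod (u a * v b) + cmod (u b * v a))\<^sup>2" using that by (intro power_mono) auto
    also have "\<dots> \<le> 2 * (cmod (u a * v b))\<^sup>2 + 2 * (cmod (u b * v a))\<^sup>2"
      using sum_squares_bound[of "cmod (u a * v b)" "cmod (u b * v a)"] by (simp add: power2_sum)
    finally show ?thesis by (simp add: h_def norm_mult power_mult_distrib)
  qed
  have le: "(bform_coeff i u v (i, a, b))\<^sup>2 \<le> 2 * h a b + 2 * h b a" for a b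
  proof -
    consider "a = b" | "a < b" | "b < a" by linarith
    then show ?thesis
    proof cases
      case 1
      then have "(Re (u a * v a))\<^sup>2 \<le> 2 * h a a + 2 * h a a" by (intro sq) simp
      then show ?thesis using 1 by (simp add: bform_coeff_def)
    next
      case 2
      then have "(Re (u a * v b + u b * v a))\<^sup>2 \<le> 2 * h a b + 2 * h b a" by (intro sq norm_triangle_ineq)
      then show ?thesis using 2 by (simp add: bform_coeff_def)
    next
      case 3
      have "cmod (\<i> * (u b * v a - u a * v b)) \<le> cmod (u a * v b) + cmod (u b * v a)"
        using norm_triangle_ineq4[of "u b * v a" "u a * v b"] by (simp add: norm_mult)
      then have "(Re (\<i> * (u b * v a - u a * v b)))\<^sup>2 \<le> 2 * h a b + 2 * h b a" by (rule sq)
      then show ?thesis using 3 by (simp add: bform_coeff_def)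
    qed
  qed
  have "sqnorm (coords m N) (bform_coeff i u v) = (\<Sum>j<m. if j = i then \<Sum>a<N. \<Sum>b<N. (bform_coeff i u v (i, a, b))\<^sup>2 else 0)"
    unfolding sqnorm_def sum_coords by (intro sum.cong refl) (auto simp: bform_coeff_def)
  also have "\<dots> = (\<Sum>a<N. \<Sum>b<N. (bform_coeff i u v (i, a, b))\<^sup>2)" using assms by simp
  also have "\<dots> \<le> (\<Sum>a<N. \<Sum>b<N. 2 * h a b + 2 * h b a)" by (intro sum_mono le)
  also have "\<dots> = 4 * (\<Sum>a<N. \<Sum>b<N. h a b)"
  proof -
    have "(\<Sum>a<N. \<Sum>b<N. h b a) = (\<Sum>a<N. \<Sum>b<N. h a b)" by (rule sum.swap)
    then show ?thesis by (simp add: sum.distrib sum_distrib_left[symmetric])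
  qed
  also have "(\<Sum>a<N. \<Sum>b<N. h a b) = (vnorm N u)\<^sup>2 * (vnorm N v)\<^sup>2"
    unfolding h_def vnorm_square by (simp add: sum_product)
  finally show ?thesis by simp
qed

section \<open>Means and correlations under the Gibbs measure\<close>

context matrix_gibbs
begin

text \<open>Traces are invariant under conjugation, and Lebesgue measure under the signed
  permutation of the coordinates. Restricting the transformed point to \<open>coords m N\<close>
  returns to the product space and is invisible to polynomials.\<close>

lemma expect_conj:
  assumes \<sigma>: "\<And>a. \<sigma> (\<sigma> a) = a" "\<And>a. a < N \<Longrightarrow> \<sigma> a < N" "\<And>a. s a = 1 \<or> s a = -1"
    and f: "cpoly (coords m N) f"
  shows "expect (\<lambda>x. f (conj_coords \<sigma> s x)) = expect f"
proof -
  let ?L = "\<Pi>\<^sub>M p\<in>coords m N. (lborel :: real measure)"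
  define T where "T = (\<lambda>x. \<lambda>p\<in>coords m N. conj_coords \<sigma> s x p)"
  have T: "g (T x) = g (conj_coords \<sigma> s x)" if "cpoly (coords m N) g" for g x
    by (rule cpoly_cong[OF that]) (simp add: T_def)
  have d: "distr ?L ?L T = ?L" unfolding T_def by (rule distr_conj[OF \<sigma>])
  have mT: "T \<in> measurable ?L ?L" unfolding T_def
  proof (rule measurable_restrict)
    fix p assume p: "p \<in> coords m N"
    then have "conj_index \<sigma> p \<in> coords m N"
      using bij_betw_conj_index[OF \<sigma>, where m = m] by (auto simp: bij_betw_def)
    then have "(\<lambda>x. x (conj_index \<sigma> p)) \<in> measurable ?L (lborel :: real measure)" by (rule measurable_component_singleton)
    then show "(\<lambda>x. conj_coords \<sigma> s x p) \<in> measurable ?L lborel" by (simp add: conj_coords_def)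
  qed
  have [measurable]: "f \<in> borel_measurable ?L" using f by (rule cpoly_measurable)
  have "(\<integral>x. weight x *\<^sub>R f x \<partial>?L) = (\<integral>x. weight x *\<^sub>R f x \<partial>distr ?L ?L T)" by (simp only: d)
  also have "\<dots> = (\<integral>x. weight (T x) *\<^sub>R f (T x) \<partial>?L)" by (rule integral_distr[OF mT]) measurable
  also have "\<dots> = (\<integral>x. weight x *\<^sub>R f (conj_coords \<sigma> s x) \<partial>?L)"
    by (simp add: weight_def T[OF f] T[OF cpoly_W] pot_conj[OF \<sigma>])
  finally show ?thesis by (simp add: expect_def)
qed

definition mean :: "nat \<Rightarrow> real" where
  "mean i = expect (\<lambda>x. x (i, 0, 0))"

lemma integr_coord: "p \<in> coords m N \<Longrightarrow> integr (\<lambda>x. x p)"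
  using integr_Re[OF integr_cpoly[OF cpoly.coord]] by fastforce

text \<open>Flipping the sign of one basis vector kills the off-diagonal means; exchanging the basis
  vectors 0 and \<open>a\<close> makes the diagonal ones equal.\<close>

lemma expect_hentry:
  assumes i: "i < m" "a < N" "b < N"
  shows "expect (\<lambda>x. hentry x i a b) = (if a = b then of_real (mean i) else 0)"
proof (cases "a = b")
  case False
  define s :: "nat \<Rightarrow> real" where "s = (\<lambda>k. if k = a then - 1 else 1)"
  have "expect (\<lambda>x. hentry (conj_coords (\<lambda>a. a) s x) i a b) = expect (\<lambda>x. hentry x i a b)"
    using i by (intro expect_conj cpoly_hentry) (auto simp: s_def)
  moreover have "hentry (conj_coords (\<lambda>a. a) s x) i a b = - hentry x i a b" for x
    using False by (subst hentry_conj[where N = N]) (auto simp: s_def)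
  moreover have "expect (\<lambda>x. - hentry x i a b) = - expect (\<lambda>x. hentry x i a b)"
    using expect_cmult[OF integr_cpoly[OF cpoly_hentry[OF i]], of "-1"] by simp
  ultimately show ?thesis using False by simp
next
  case True
  define \<sigma> :: "nat \<Rightarrow> nat" where "\<sigma> = (\<lambda>k. if k = 0 then a else if k = a then 0 else k)"
  have "expect (\<lambda>x. hentry (conj_coords \<sigma> (\<lambda>_. 1) x) i 0 0) = expect (\<lambda>x. hentry x i 0 0)"
    using i by (intro expect_conj cpoly_hentry) (auto simp: \<sigma>_def)
  moreover have "hentry (conj_coords \<sigma> (\<lambda>_. 1) x) i 0 0 = hentry x i a a" for x
    by (subst hentry_conj[where N = "Suc a"]) (auto simp: \<sigma>_def)
  moreover have "expect (\<lambda>x. hentry x i 0 0) = of_real (mean i)"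
    unfolding mean_def hentry_def using i by (simp add: expect_of_real integr_coord)
  ultimately show ?thesis using True by simp
qed

lemma expect_coord:
  assumes i: "i < m" "a < N" "b < N"
  shows "expect (\<lambda>x. x (i, a, b)) = (if a = b then mean i else 0)"
proof -
  consider "a = b" | "a < b" | "b < a" by linarith
  then show ?thesis
  proof cases
    case 3
    have "expect (\<lambda>x. x (i, a, b)) = expect (\<lambda>x. Re ((- \<i>) * hentry x i b a))" using 3 by (simp add: hentry_def)
    also have "\<dots> = Re (expect (\<lambda>x. (- \<i>) * hentry x i b a))"
      using i by (intro Re_expect[symmetric] integr_cpoly cpoly_cmult cpoly_hentry)
    also have "expect (\<lambda>x. (- \<i>) * hentry x i b a) = (- \<i>) * expect (\<lambda>x. hentry x i b a)"
      using i by (intro expect_cmult integr_cpoly cpoly_hentry)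
    finally show ?thesis using 3 i by (simp add: expect_hentry)
  next
    case 1
    have "expect (\<lambda>x. x (i, a, b)) = expect (\<lambda>x. Re (hentry x i a b))" using 1 by (simp add: hentry_def)
    also have "\<dots> = Re (expect (\<lambda>x. hentry x i a b))" using i by (intro Re_expect[symmetric] integr_cpoly cpoly_hentry)
    finally show ?thesis using i by (simp add: expect_hentry)
  next
    case 2
    have "expect (\<lambda>x. x (i, a, b)) = expect (\<lambda>x. Re (hentry x i a b))" using 2 by (simp add: hentry_def)
    also have "\<dots> = Re (expect (\<lambda>x. hentry x i a b))" using i by (intro Re_expect[symmetric] integr_cpoly cpoly_hentry)
    finally show ?thesis using i by (simp add: expect_hentry)
  qed
qed

text \<open>At the zero matrices only the empty word has nonzero entries, so each occurrence
  contributes at most 1.\<close>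

lemma pd_pot_0_bound:
  assumes i: "i < m" "a < N"
  shows "cmod (pd (i, a, a) (pot m N n q t) (\<lambda>_. 0)) \<le> real N"
proof -
  have "hentry (\<lambda>_. 0) i a b = 0" for i a b by (simp add: hentry_def complex_eq_iff)
  then have e: "cmod (entry N (hentry (\<lambda>_. 0)) r a a) \<le> 1" for r
    by (cases r) simp_all
  have "cmod (\<Sum>j=1..n. t j * (\<Sum>k\<in>occurrences i (q j). entry N (hentry (\<lambda>_. 0)) (rotate_out k (q j)) a a)) \<le> (\<Sum>j=1..n. \<eta> * real d)"
  proof (rule sum_norm_le)
    fix j assume j: "j \<in> {1..n}"
    have "cmod (\<Sum>k\<in>occurrences i (q j). entry N (hentry (\<lambda>_. 0)) (rotate_out k (q j)) a a) \<le> (\<Sum>k\<in>occurrences i (q j). 1)"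
      by (rule sum_norm_le) (rule e)
    also have "\<dots> \<le> real d" using card_occurrences[of i "q j"] q[OF j] by simp
    finally show "cmod (t j * (\<Sum>k\<in>occurrences i (q j). entry N (hentry (\<lambda>_. 0)) (rotate_out k (q j)) a a)) \<le> \<eta> * real d"
      unfolding norm_mult using t[OF j] \<eta> by (intro mult_mono) auto
  qed
  also have "\<dots> \<le> 1" using nd by (simp add: mult_ac)
  finally have le: "cmod (\<Sum>j=1..n. t j * (\<Sum>k\<in>occurrences i (q j). entry N (hentry (\<lambda>_. 0)) (rotate_out k (q j)) a a)) \<le> 1" .
  have "pd (i, a, a) (pot m N n q t) (\<lambda>_. 0) = unit_deriv i a a (pot m N n q t) (\<lambda>_. 0)" by (simp add: unit_deriv_def)
  also have "\<dots> = of_nat N * ((\<Sum>j=1..n. t j * (\<Sum>k\<in>occurrences i (q j). entry N (hentry (\<lambda>_. 0)) (rotate_out k (q j)) a a)) + hentry (\<lambda>_. 0) i a a)"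
    using q by (intro unit_deriv_pot i) auto
  finally show ?thesis using mult_left_mono[OF le, of "real N"] by (simp add: norm_mult hentry_def)
qed

text \<open>Both the dimension and the slope at the origin are of order \<open>N\<^sup>2\<close>, as
  is \<open>N * c\<close> times the squared mean of the diagonal. The factors
  \<open>N\<^sup>2\<close> cancel in the second moment bound, and the sum \<open>S1\<close> of the
  absolute means is absorbed by half of \<open>c * S2\<close>.\<close>

lemma mean_le: "i < m \<Longrightarrow> \<bar>mean i\<bar> \<le> mean_bound m c"
proof -
  assume i: "i < m"
  let ?W = "pot m N n q t"
  define S1 where "S1 = (\<Sum>i<m. \<bar>mean i\<bar>)"
  define S2 where "S2 = (\<Sum>i<m. (mean i)\<^sup>2)"
  have "expect (slope (\<lambda>_. 0)) = expect (\<lambda>x. \<Sum>p\<in>coords m N. Re (pd p ?W (\<lambda>_. 0)) * x p)"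
    by (simp add: slope_def[abs_def] mult.commute)
  also have "\<dots> = (\<Sum>p\<in>coords m N. Re (pd p ?W (\<lambda>_. 0)) * expect (\<lambda>x. x p))"
    using integr_coord by (subst expect_sum) (auto intro!: integr_cmult sum.cong simp: expect_cmult)
  also have "\<dots> = (\<Sum>i<m. \<Sum>a<N. \<Sum>b<N. if b = a then Re (pd (i, a, a) ?W (\<lambda>_. 0)) * mean i else 0)"
    unfolding sum_coords by (intro sum.cong refl) (auto simp: expect_coord)
  also have "\<dots> = (\<Sum>i<m. \<Sum>a<N. Re (pd (i, a, a) ?W (\<lambda>_. 0)) * mean i)" by simp
  finally have "\<bar>expect (slope (\<lambda>_. 0))\<bar> \<le> (\<Sum>i<m. \<Sum>a<N. \<bar>Re (pd (i, a, a) ?W (\<lambda>_. 0)) * mean i\<bar>)"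
    by (simp only:) (intro order_trans[OF sum_abs] sum_mono sum_abs)
  also have "\<dots> \<le> (\<Sum>i<m. \<Sum>a<N. real N * \<bar>mean i\<bar>)"
    unfolding abs_mult using pd_pot_0_bound by (intro sum_mono mult_right_mono) (auto intro: order_trans[OF abs_Re_le_cmod])
  also have "\<dots> = (real N)\<^sup>2 * S1" by (simp add: S1_def sum_distrib_left power2_eq_square mult.assoc)
  finally have slope: "\<bar>expect (slope (\<lambda>_. 0))\<bar> \<le> (real N)\<^sup>2 * S1" .
  \<comment> \<open>Only diagonal coordinates are kept; the tangent form of Jensen's inequality for
    the square makes the left side affine in \<open>x\<close>.\<close>
  have "(\<Sum>i<m. \<Sum>a<N. 2 * mean i * x (i, a, a) + - ((mean i)\<^sup>2)) \<le> sqnorm (coords m N) x" for x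
  proof -
    have "(\<Sum>i<m. \<Sum>a<N. 2 * mean i * x (i, a, a) + - ((mean i)\<^sup>2)) \<le> (\<Sum>i<m. \<Sum>a<N. \<Sum>b<N. (x (i, a, b))\<^sup>2)"
    proof (intro sum_mono)
      fix i a assume a: "a \<in> {..<N}"
      have "2 * mean i * x (i, a, a) + - ((mean i)\<^sup>2) \<le> (x (i, a, a))\<^sup>2"
        using zero_le_power2[of "x (i, a, a) - mean i"] by (simp add: power2_diff mult_ac)
      also have "\<dots> \<le> (\<Sum>b<N. (x (i, a, b))\<^sup>2)" using a by (intro member_le_sum) auto
      finally show "2 * mean i * x (i, a, a) + - ((mean i)\<^sup>2) \<le> (\<Sum>b<N. (x (i, a, b))\<^sup>2)" .
    qed
    then show ?thesis by (simp add: sqnorm_def sum_coords)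
  qed
  moreover have i1: "integr (\<lambda>x. 2 * mean i * x (i, a, a) + - ((mean i)\<^sup>2))" if "i \<in> {..<m}" "a \<in> {..<N}" for i a
    using that by (intro integr_add integr_cmult integr_coord integr_const) auto
  ultimately have "expect (\<lambda>x. \<Sum>i<m. \<Sum>a<N. 2 * mean i * x (i, a, a) + - ((mean i)\<^sup>2)) \<le> expect (sqnorm (coords m N))"
    using integr_sqnorm by (intro expect_mono expect_double_sum(2)) auto
  moreover have "expect (\<lambda>x. \<Sum>i<m. \<Sum>a<N. 2 * mean i * x (i, a, a) + - ((mean i)\<^sup>2)) = real N * S2"
  proof -
    have "expect (\<lambda>x. \<Sum>i<m. \<Sum>a<N. 2 * mean i * x (i, a, a) + - ((mean i)\<^sup>2)) = (\<Sum>i<m. \<Sum>a<N. expect (\<lambda>x. 2 * mean i * x (i, a, a) + - ((mean i)\<^sup>2)))"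
      using i1 by (rule expect_double_sum(1))
    also have "\<dots> = (\<Sum>i<m. \<Sum>a<N. (mean i)\<^sup>2)"
    proof (intro sum.cong refl)
      fix i a assume ia: "i \<in> {..<m}" "a \<in> {..<N}"
      have "expect (\<lambda>x. 2 * mean i * x (i, a, a) + - ((mean i)\<^sup>2)) = 2 * mean i * expect (\<lambda>x. x (i, a, a)) + expect (\<lambda>x. - ((mean i)\<^sup>2))"
        using ia by (subst expect_add) (auto intro: integr_cmult integr_coord simp: expect_cmult integr_coord)
      then show "expect (\<lambda>x. 2 * mean i * x (i, a, a) + - ((mean i)\<^sup>2)) = (mean i)\<^sup>2"
        using ia by (simp add: expect_coord expect_const power2_eq_square)
    qed
    finally show ?thesis by (simp add: S2_def sum_distrib_left)
  qed
  ultimately have "real N * S2 \<le> expect (sqnorm (coords m N))" by simp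
  then have "real N * c * (real N * S2) \<le> real N * c * expect (sqnorm (coords m N))"
    using N c by (intro mult_left_mono) auto
  also have "\<dots> \<le> real (card (coords m N)) - expect (\<lambda>x. slope (\<lambda>_. 0) x)" by (rule second_moment_le)
  also have "\<dots> \<le> (real N)\<^sup>2 * real m + (real N)\<^sup>2 * S1"
    using slope by (simp add: coords_def power2_eq_square)
  finally have "(real N)\<^sup>2 * (c * S2) \<le> (real N)\<^sup>2 * (real m + S1)" by (simp add: power2_eq_square algebra_simps)
  then have cS: "c * S2 \<le> real m + S1" using N by simp
  have "S1 \<le> (\<Sum>i<m. c / 2 * (mean i)\<^sup>2 + 1 / (2 * c))"
    unfolding S1_def
  proof (rule sum_mono)
    fix i
    have "0 \<le> (c * \<bar>mean i\<bar> - 1)\<^sup>2 / (2 * c)" using c by simp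
    also have "\<dots> = c / 2 * (mean i)\<^sup>2 + 1 / (2 * c) - \<bar>mean i\<bar>" using c by (simp add: power2_diff power_mult_distrib field_simps power2_eq_square)
    finally show "\<bar>mean i\<bar> \<le> c / 2 * (mean i)\<^sup>2 + 1 / (2 * c)" by simp
  qed
  also have "\<dots> = c / 2 * S2 + real m / (2 * c)" by (simp add: S2_def sum.distrib sum_distrib_left)
  also have "real m / (2 * c) = real m / c / 2" by simp
  finally have "c * S2 \<le> 2 * real m + real m / c" using cS by simp
  then have S2: "S2 \<le> (2 * real m + real m / c) / c" using c by (simp add: field_simps)
  have "\<bar>mean i\<bar> \<le> 1 + (mean i)\<^sup>2" using sum_squares_bound[of 1 "\<bar>mean i\<bar>"] by simp
  also have "(mean i)\<^sup>2 \<le> S2" unfolding S2_def using i by (intro member_le_sum) auto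
  finally show ?thesis using S2 by (simp add: mean_bound_def)
qed

text \<open>The mean matrix is scalar, so the form has mean at most
  \<open>4 * mean_bound m c\<close> for vectors of norm 2; the squared norm of its coefficients is
  at most \<open>4 * 2\<^sup>2 * 2\<^sup>2 = 64\<close>.\<close>

lemma expect_bform_power_le:
  assumes i: "i < m" and u: "vnorm N u \<le> 2" and v: "vnorm N v \<le> 2"
  shows "expect (\<lambda>x. \<bar>Re (bform N (hentry x i) u v)\<bar> ^ N) \<le> 2 * exp (real N * (4 * mean_bound m c + 64 / c))"
    and "integr (\<lambda>x. \<bar>Re (bform N (hentry x i) u v)\<bar> ^ N)"
proof -
  define \<theta> where "\<theta> = bform_coeff i u v"
  have lin: "(\<lambda>x. Re (bform N (hentry x i) u v)) = linear_form \<theta>"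
    using Re_bform[OF i] by (simp add: \<theta>_def linear_form_def fun_eq_iff)
  have lin': "(\<lambda>x. \<bar>Re (bform N (hentry x i) u v)\<bar> ^ N) = (\<lambda>x. \<bar>linear_form \<theta> x\<bar> ^ N)" by (simp add: lin[symmetric])
  show "integr (\<lambda>x. \<bar>Re (bform N (hentry x i) u v)\<bar> ^ N)" unfolding lin' by (rule integr_power_linear_form)
  have cp: "cpoly (coords m N) (\<lambda>x. u a * hentry x i a b * v b)" if "a < N" "b < N" for a b
    using i that by (intro cpoly.mult cpoly.const cpoly_hentry)
  have "expect (linear_form \<theta>) = Re (expect (\<lambda>x. bform N (hentry x i) u v))"
    unfolding lin[symmetric] bform_def using cp by (intro Re_expect[symmetric] integr_cpoly cpoly_sum) auto
  also have "expect (\<lambda>x. bform N (hentry x i) u v) = (\<Sum>a<N. \<Sum>b<N. expect (\<lambda>x. u a * hentry x i a b * v b))"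
    unfolding bform_def using cp by (intro expect_double_sum(1) integr_cpoly) auto
  also have "\<dots> = (\<Sum>a<N. \<Sum>b<N. if b = a then of_real (mean i) * (u a * v a) else 0)"
  proof (intro sum.cong refl)
    fix a b assume ab: "a \<in> {..<N}" "b \<in> {..<N}"
    have "expect (\<lambda>x. u a * hentry x i a b * v b) = expect (\<lambda>x. (u a * v b) * hentry x i a b)" by (simp add: mult_ac)
    also have "\<dots> = (u a * v b) * expect (\<lambda>x. hentry x i a b)"
      using ab i by (intro expect_cmult integr_cpoly cpoly_hentry) auto
    finally show "expect (\<lambda>x. u a * hentry x i a b * v b) = (if b = a then of_real (mean i) * (u a * v a) else 0)"
      using ab i by (simp add: expect_hentry)
  qed
  also have "\<dots> = of_real (mean i) * (\<Sum>a<N. u a * v a)" by (simp add: sum_distrib_left)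
  finally have "\<bar>expect (linear_form \<theta>)\<bar> \<le> cmod (of_real (mean i) * (\<Sum>a<N. u a * v a))"
    by (simp only: abs_Re_le_cmod)
  also have "\<dots> \<le> mean_bound m c * (2 * 2)"
    unfolding norm_mult
  proof (intro mult_mono)
    show "cmod (complex_of_real (mean i)) \<le> mean_bound m c" using mean_le[OF i] by simp
    then show "0 \<le> mean_bound m c" by (meson norm_ge_zero order_trans)
    have "cmod (\<Sum>a<N. u a * v a) \<le> (\<Sum>a<N. cmod (u a) * cmod (v a))" by (intro sum_norm_le) (simp add: norm_mult)
    also have "\<dots> \<le> vnorm N u * vnorm N v" by (rule sum_cmod_mult_le)
    also have "\<dots> \<le> 2 * 2" using u v by (intro mult_mono) auto
    finally show "cmod (\<Sum>a<N. u a * v a) \<le> 2 * 2" .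
  qed auto
  finally have mean: "\<bar>expect (linear_form \<theta>)\<bar> \<le> 4 * mean_bound m c" by simp
  have "sqnorm (coords m N) \<theta> \<le> 4 * (vnorm N u)\<^sup>2 * (vnorm N v)\<^sup>2" unfolding \<theta>_def by (rule sqnorm_bform_coeff[OF i])
  also have "\<dots> \<le> 4 * 2\<^sup>2 * 2\<^sup>2" using u v by (intro mult_mono power_mono) auto
  finally have sq: "sqnorm (coords m N) \<theta> \<le> 64" by simp
  have "(real N)\<^sup>2 * sqnorm (coords m N) \<theta> / (real N * c) \<le> (real N)\<^sup>2 * 64 / (real N * c)"
    using sq N c by (intro divide_right_mono mult_left_mono) auto
  also have "\<dots> = real N * (64 / c)" using N by (simp add: power2_eq_square)
  finally have "real N * \<bar>expect (linear_form \<theta>)\<bar> + (real N)\<^sup>2 * sqnorm (coords m N) \<theta> / (real N * c) \<le> real N * (4 * mean_bound m c + 64 / c)"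
    using mult_left_mono[OF mean, of "real N"] by (simp add: distrib_left)
  then show "expect (\<lambda>x. \<bar>Re (bform N (hentry x i) u v)\<bar> ^ N) \<le> 2 * exp (real N * (4 * mean_bound m c + 64 / c))"
    unfolding lin' by (intro order_trans[OF expect_power_linear_form_le]) simp
qed

text \<open>The union bound is taken in expectation: \<open>Y\<close> sums the \<open>N\<close>-th
  powers of all forms over the net, and its \<open>N\<close>-th root dominates each of them. Eight
  times that root bounds every matrix in operator norm, hence every normalized trace by the
  corresponding power.\<close>

theorem corr_bound:
  assumes ws: "ws \<in> forests {..<m}" "forest_length ws \<le> N"
  shows "cmod (corr ws) \<le> moment_radius m c ^ forest_length ws"
proof -
  define l where "l = forest_length ws"
  define E where "E = exp (4 * mean_bound m c + 64 / c)"
  define R where "R = 32 * real m * 2 ^ 208 * E"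
  have E: "E \<ge> 1" using c by (simp add: E_def mean_bound_def)
  obtain S :: "(nat \<Rightarrow> complex) set" where S: "finite S" "real (card S) \<le> (2 ^ 104) ^ N"
    "\<And>u. u \<in> S \<Longrightarrow> vnorm N u \<le> 2" "\<And>u. vnorm N u \<le> 1 \<Longrightarrow> \<exists>u'\<in>S. vnorm N (\<lambda>a. u a - u' a) \<le> 1/4"
    using exists_net by blast
  \<comment> \<open>Multiplying \<open>u\<close> by \<open>- \<i>\<close> exchanges the real part of
    the form for its imaginary part.\<close>
  define g where "g = (\<lambda>i u v x. \<bar>Re (bform N (hentry x i) u v)\<bar> ^ N + \<bar>Re (bform N (hentry x i) (\<lambda>a. (- \<i>) * u a) v)\<bar> ^ N)"
  define Y where "Y = (\<lambda>x. \<Sum>i<m. \<Sum>u\<in>S. \<Sum>v\<in>S. g i u v x)"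
  have vi: "vnorm N (\<lambda>a. (- \<i>) * u a) = vnorm N u" for u by (simp only: vnorm_scale) simp
  have g: "integr (g i u v)" "expect (g i u v) \<le> 4 * E ^ N" if "i < m" "u \<in> S" "v \<in> S" for i u v
  proof -
    have b: "vnorm N u \<le> 2" "vnorm N v \<le> 2" "vnorm N (\<lambda>a. (- \<i>) * u a) \<le> 2" using that S(3) vi by auto
    note 1 = expect_bform_power_le[OF that(1) b(1,2)] and 2 = expect_bform_power_le[OF that(1) b(3,2)]
    show "integr (g i u v)" unfolding g_def by (intro integr_add 1 2)
    have "expect (g i u v) \<le> 2 * exp (real N * (4 * mean_bound m c + 64 / c)) + 2 * exp (real N * (4 * mean_bound m c + 64 / c))"
      unfolding g_def by (subst expect_add[OF 1(2) 2(2)]) (intro add_mono 1 2)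
    then show "expect (g i u v) \<le> 4 * E ^ N" by (simp add: E_def exp_of_nat_mult[symmetric])
  qed
  have iY1: "integr (\<lambda>x. \<Sum>u\<in>S. \<Sum>v\<in>S. g i u v x)" if "i \<in> {..<m}" for i
    using that g(1) by (intro expect_double_sum(2)) auto
  then have iY: "integr Y" unfolding Y_def by (rule integr_sum)
  have "expect Y = (\<Sum>i<m. expect (\<lambda>x. \<Sum>u\<in>S. \<Sum>v\<in>S. g i u v x))"
    unfolding Y_def using iY1 by (rule expect_sum)
  also have "\<dots> = (\<Sum>i<m. \<Sum>u\<in>S. \<Sum>v\<in>S. expect (g i u v))"
    using g(1) by (intro sum.cong[OF refl] expect_double_sum(1)) auto
  also have "\<dots> \<le> (\<Sum>i<m. \<Sum>u\<in>S. \<Sum>v\<in>S. 4 * E ^ N)" using g(2) by (intro sum_mono) auto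
  also have "\<dots> = real m * (real (card S) * real (card S)) * (4 * E ^ N)" by simp
  also have "\<dots> \<le> real m * ((2 ^ 104) ^ N * (2 ^ 104) ^ N) * (4 * E ^ N)"
    using S(2) E by (intro mult_right_mono mult_left_mono mult_mono) auto
  also have "\<dots> = (4 * real m) * ((2 ^ 208) ^ N * E ^ N)"
  proof -
    have "(2 ^ 104 :: real) ^ N * (2 ^ 104) ^ N = (2 ^ 104 * 2 ^ 104) ^ N" by (rule power_mult_distrib[symmetric])
    also have "(2 ^ 104 * 2 ^ 104 :: real) = 2 ^ 208" by (simp only: power_add[symmetric]) simp
    finally show ?thesis by (simp only: mult_ac)
  qed
  also have "\<dots> \<le> (4 * real m) ^ N * ((2 ^ 208) ^ N * E ^ N)"
    using m N E power_increasing[of 1 N "4 * real m"] by (intro mult_right_mono) auto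
  finally have EY: "expect Y \<le> (4 * real m * (2 ^ 208 * E)) ^ N" by (simp only: power_mult_distrib)
  have Y0: "0 \<le> Y x" for x unfolding Y_def g_def by (intro sum_nonneg) auto
  have R: "R \<ge> 1"
  proof -
    have "1 * 1 * 1 \<le> (32 * real m) * 2 ^ 208 * E" using m E by (intro mult_mono) auto
    then show ?thesis by (simp add: R_def)
  qed
  \<comment> \<open>Where the norm bound \<open>8 * y\<close> exceeds \<open>R\<close>, the power
    \<open>l\<close> is traded for the power \<open>N\<close>, whose expectation is controlled; this
    is where \<open>l \<le> N\<close> matters.\<close>
  have point: "cmod (prod_list (map (\<lambda>w. wtrace N x w / of_nat N) ws)) \<le> R ^ l + 8 ^ N / R ^ (N - l) * Y x" for x
  proof -
    define y where "y = root N (Y x)"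
    have y: "y \<ge> 0" "y ^ N = Y x" using N Y0[of x] by (auto simp: y_def)
    have root: "a \<le> y" if "a ^ N \<le> y ^ N" for a
      using that N y(1) power_le_imp_le_base[of a "N - 1" y] by simp
    have "cmod (bform N (hentry x i) u v) \<le> 2 * y" if i: "i < m" and uv: "u \<in> S" "v \<in> S" for i u v
    proof -
      have g0: "0 \<le> g i u v x" for i u v by (simp add: g_def)
      have "g i u v x \<le> (\<Sum>v\<in>S. g i u v x)" using uv S(1) g0 by (intro member_le_sum) auto
      also have "\<dots> \<le> (\<Sum>u\<in>S. \<Sum>v\<in>S. g i u v x)" using uv S(1) g0 by (intro member_le_sum[of u S "\<lambda>u. \<Sum>v\<in>S. g i u v x"] sum_nonneg) auto
      also have "\<dots> \<le> Y x" unfolding Y_def using i g0 by (intro member_le_sum[of i "{..<m}" "\<lambda>i. \<Sum>u\<in>S. \<Sum>v\<in>S. g i u v x"] sum_nonneg) auto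
      finally have gy: "g i u v x \<le> y ^ N" by (simp add: y)
      have "\<bar>Re (bform N (hentry x i) u v)\<bar> ^ N \<le> y ^ N" "\<bar>Re (bform N (hentry x i) (\<lambda>a. (- \<i>) * u a) v)\<bar> ^ N \<le> y ^ N"
        by (rule order_trans[OF _ gy], simp add: g_def)+
      then have "\<bar>Re (bform N (hentry x i) u v)\<bar> \<le> y" "\<bar>Re (bform N (hentry x i) (\<lambda>a. (- \<i>) * u a) v)\<bar> \<le> y"
        using root by blast+
      moreover have "bform N (hentry x i) (\<lambda>a. (- \<i>) * u a) v = - \<i> * bform N (hentry x i) u v"
        using bform_scale[of N "hentry x i" "- \<i>" u 1 v] by (simp only: mult_1 mult_1_right)
      then have "Re (bform N (hentry x i) (\<lambda>a. (- \<i>) * u a) v) = Im (bform N (hentry x i) u v)"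
        by (simp only:) simp
      ultimately show ?thesis using cmod_le[of "bform N (hentry x i) u v"] by linarith
    qed
    then have "op_bounded N (hentry x i) (4 * (2 * y))" if "i < m" for i
      using that by (intro op_bounded_from_net[OF S(1,3,4)]) auto
    then have op: "op_bounded N (hentry x i) (8 * y)" if "i < m" for i using that by simp
    have tr: "cmod (wtrace N x w / of_nat N) \<le> (8 * y) ^ length w" if w: "set w \<subseteq> {..<m}" for w
    proof -
      have "cmod (wtrace N x w) \<le> (\<Sum>a<N. (8 * y) ^ length w)"
        unfolding wtrace_def using w op y by (intro sum_norm_le cmod_entry_diag_le) auto
      then show ?thesis using N by (simp add: norm_divide field_simps)
    qed
    have "cmod (prod_list (map (\<lambda>w. wtrace N x w / of_nat N) ws)) \<le> (8 * y) ^ l"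
      using ws(1) unfolding l_def
    proof (induction ws)
      case (Cons w ws)
      then have "cmod (wtrace N x w / of_nat N) * cmod (prod_list (map (\<lambda>w. wtrace N x w / of_nat N) ws)) \<le> (8 * y) ^ length w * (8 * y) ^ forest_length ws"
        using y by (intro mult_mono tr) auto
      then show ?case by (simp only: list.map prod_list.Cons norm_mult forest_length_simps power_add)
    qed simp
    also have "\<dots> \<le> R ^ l + (8 * y) ^ N / R ^ (N - l)"
    proof (cases "8 * y \<le> R")
      case True
      then have "(8 * y) ^ l \<le> R ^ l" using y by (intro power_mono) auto
      moreover have "0 \<le> (8 * y) ^ N / R ^ (N - l)" using y(1) R by simp
      ultimately show ?thesis by linarith
    next
      case False
      have "(8 * y) ^ l * R ^ (N - l) \<le> (8 * y) ^ l * (8 * y) ^ (N - l)"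
        using False R y(1) by (intro mult_left_mono power_mono) auto
      also have "\<dots> = (8 * y) ^ N" using ws(2) unfolding power_add[symmetric] l_def by (simp only: le_add_diff_inverse)
      finally have *: "(8 * y) ^ l * R ^ (N - l) \<le> (8 * y) ^ N" .
      have "0 < R ^ (N - l)" using R by simp
      from pos_le_divide_eq[OF this, THEN iffD2, OF *] show ?thesis using R zero_le_power[of R l] by linarith
    qed
    also have "(8 * y) ^ N = 8 ^ N * Y x" by (simp only: power_mult_distrib y(2))
    finally show ?thesis by simp
  qed
  have cp: "integr (\<lambda>x. prod_list (map (\<lambda>w. wtrace N x w / of_nat N) ws))"
  proof -
    have "integr (\<lambda>x. (1 / of_nat N ^ length ws) * prod_list (map (wtrace N x) ws))"
      using ws by (intro integr_cmult integr_cpoly cpoly_prod_wtrace) (auto simp: forests_def)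
    then show ?thesis by (simp add: prod_list_divide)
  qed
  have "cmod (corr ws) \<le> expect (\<lambda>x. cmod (prod_list (map (\<lambda>w. wtrace N x w / of_nat N) ws)))"
    unfolding corr_def using cp by (rule norm_expect_le)
  also have "\<dots> \<le> expect (\<lambda>x. R ^ l + 8 ^ N / R ^ (N - l) * Y x)"
    using point iY cp by (intro expect_mono integr_norm integr_add integr_const integr_cmult)
  also have "\<dots> = R ^ l + 8 ^ N / R ^ (N - l) * expect Y"
    by (simp only: expect_add[OF integr_const integr_cmult[OF iY]] expect_const expect_cmult[OF iY])
  also have "\<dots> \<le> R ^ l + 8 ^ N / R ^ (N - l) * (4 * real m * (2 ^ 208 * E)) ^ N"
    by (intro add_left_mono mult_left_mono EY) (use R in simp)
  also have "8 ^ N / R ^ (N - l) * (4 * real m * (2 ^ 208 * E)) ^ N = R ^ N / R ^ (N - l)"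
  proof -
    have "8 * (4 * real m * (2 ^ 208 * E)) = R" unfolding R_def by simp
    then have "8 ^ N * (4 * real m * (2 ^ 208 * E)) ^ N = R ^ N" by (simp only: power_mult_distrib[symmetric])
    then show ?thesis by (simp only: times_divide_eq_left)
  qed
  also have "\<dots> = R ^ l"
  proof -
    have "R ^ N = R ^ l * R ^ (N - l)" using ws(2) by (simp add: l_def power_add[symmetric])
    then show ?thesis using R by simp
  qed
  finally have main: "cmod (corr ws) \<le> 2 * R ^ l" by simp
  have rad: "moment_radius m c = 2 * R" by (simp add: moment_radius_def R_def E_def)
  show ?thesis
  \<comment> \<open>The factor 2 can be moved into the radius when there is at least one letter; for
    a forest of empty words the correlation is exactly 1.\<close>
  proof (cases "l = 0")
    case True
    have "ws' \<in> forests {..<m} \<Longrightarrow> forest_length ws' = 0 \<Longrightarrow> corr ws' = 1" for ws'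
      by (induction ws') auto
    then show ?thesis using True ws by (simp add: l_def)
  next
    case False
    have "2 * R ^ l \<le> 2 ^ l * R ^ l" using False R power_increasing[of 1 l "2::real"] by (intro mult_right_mono) auto
    then show ?thesis using main by (simp add: rad power_mult_distrib l_def)
  qed
qed

end

section \<open>Interpolation of the free energy\<close>

text \<open>The segment of potentials from \<open>U\<close> to \<open>D + U\<close>, with one
  convexity constant for all of them. \<open>drift\<close> will turn out to be minus the derivative
  of \<open>ln (Z s)\<close>.\<close>

locale gibbs_family =
  fixes I :: "'i set" and U D :: "('i \<Rightarrow> real) \<Rightarrow> complex" and \<kappa> :: real
  assumes gibbs: "\<And>s. s \<in> {0..1} \<Longrightarrow> gibbs_measure I (\<lambda>x. of_real s * D x + U x) \<kappa>"
    and cpoly_D: "cpoly I D" and real_D: "\<And>x. D x \<in> \<real>"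
begin

definition W :: "real \<Rightarrow> ('i \<Rightarrow> real) \<Rightarrow> complex" where
  "W s = (\<lambda>x. of_real s * D x + U x)"

definition Z :: "real \<Rightarrow> real" where
  "Z s = gibbs_measure.partition I (W s)"

definition drift :: "real \<Rightarrow> real" where
  "drift s = Re (gibbs_measure.expect I (W s) D)"

lemma gibbs_W: "s \<in> {0..1} \<Longrightarrow> gibbs_measure I (W s) \<kappa>"
  using gibbs by (simp add: W_def)

lemma weight_W: "s \<in> {0..1} \<Longrightarrow> gibbs_measure.weight (W s) x = exp (- (s * Re (D x) + Re (U x)))"
  unfolding gibbs_measure.weight_def[OF gibbs_W] by (simp add: W_def)

text \<open>As the exponent is affine in \<open>s\<close>, every weight on the segment is at most
  the sum of the two endpoint weights, which supplies the dominating function.\<close>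

lemma continuous_weighted_integral:
  fixes f :: "('i \<Rightarrow> real) \<Rightarrow> real"
  assumes f: "\<And>s. s \<in> {0..1} \<Longrightarrow> gibbs_measure.integr I (W s) f" and mf: "f \<in> borel_measurable (\<Pi>\<^sub>M p\<in>I. lborel)"
  shows "continuous_on {0..1} (\<lambda>s. \<integral>x. gibbs_measure.weight (W s) x * f x \<partial>(\<Pi>\<^sub>M p\<in>I. lborel))"
proof (rule continuous_on_sequentiallyI)
  fix u :: "nat \<Rightarrow> real" and a assume u: "\<forall>n. u n \<in> {0..1}" and a: "a \<in> {0..1}" and ua: "u \<longlonglongrightarrow> a"
  let ?w = "\<lambda>s. gibbs_measure.weight (W s)"
  have [measurable]: "?w s \<in> borel_measurable (\<Pi>\<^sub>M p\<in>I. lborel)" if "s \<in> {0..1}" for s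
    using gibbs_measure.weight_measurable[OF gibbs_W[OF that]] .
  have i: "integrable (\<Pi>\<^sub>M p\<in>I. lborel) (\<lambda>x. ?w s x * f x)" if "s \<in> {0..1}" for s
    using f[OF that] by (simp add: gibbs_measure.integr_def[OF gibbs_W[OF that]])
  show "(\<lambda>n. \<integral>x. ?w (u n) x * f x \<partial>(\<Pi>\<^sub>M p\<in>I. lborel)) \<longlonglongrightarrow> (\<integral>x. ?w a x * f x \<partial>(\<Pi>\<^sub>M p\<in>I. lborel))"
  proof (rule integral_dominated_convergence[where w = "\<lambda>x. norm (?w 0 x * f x) + norm (?w 1 x * f x)"])
    show "integrable (\<Pi>\<^sub>M p\<in>I. lborel) (\<lambda>x. norm (?w 0 x * f x) + norm (?w 1 x * f x))"
      by (intro Bochner_Integration.integrable_add integrable_norm i) auto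
    show "(\<lambda>x. ?w a x * f x) \<in> borel_measurable (\<Pi>\<^sub>M p\<in>I. lborel)" using i[OF a] by (rule borel_measurable_integrable)
    show "(\<lambda>x. ?w (u n) x * f x) \<in> borel_measurable (\<Pi>\<^sub>M p\<in>I. lborel)" for n
      using i u by (intro borel_measurable_integrable) auto
    show "AE x in (\<Pi>\<^sub>M p\<in>I. lborel). (\<lambda>n. ?w (u n) x * f x) \<longlonglongrightarrow> ?w a x * f x"
      using u a by (intro AE_I2) (auto simp: weight_W intro!: tendsto_intros ua)
    show "AE x in (\<Pi>\<^sub>M p\<in>I. lborel). norm (?w (u n) x * f x) \<le> norm (?w 0 x * f x) + norm (?w 1 x * f x)" for n
    proof (intro AE_I2)
      fix x
      define r where "r = Re (D x)"
      have un: "0 \<le> u n" "u n \<le> 1" using u by auto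
      have "- (u n * r) \<le> max 0 (- r)"
        using un mult_left_le_one_le[of "-r" "u n"] by (cases "r \<ge> 0") (auto simp: max_def mult_nonpos_nonneg mult_nonneg_nonpos not_le zero_le_mult_iff)
      then have "?w (u n) x \<le> ?w 0 x + ?w 1 x"
        using un by (cases "r \<ge> 0") (auto simp: weight_W r_def[symmetric] max_def intro: add_increasing add_increasing2)
      then have "?w (u n) x * \<bar>f x\<bar> \<le> (?w 0 x + ?w 1 x) * \<bar>f x\<bar>" by (rule mult_right_mono) simp
      then show "norm (?w (u n) x * f x) \<le> norm (?w 0 x * f x) + norm (?w 1 x * f x)"
        using un by (simp add: abs_mult weight_W distrib_right)
    qed
  qed
qed

lemma Z_pos: "s \<in> {0..1} \<Longrightarrow> 0 < Z s"
  unfolding Z_def by (rule gibbs_measure.partition_pos[OF gibbs_W])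

lemma measurable_Re_D: "(\<lambda>x. Re (D x)) \<in> borel_measurable (\<Pi>\<^sub>M p\<in>I. lborel)"
  using cpoly_measurable[OF cpoly_D] by simp

lemma continuous_Z: "continuous_on {0..1} Z"
proof -
  have "continuous_on {0..1} (\<lambda>s. \<integral>x. gibbs_measure.weight (W s) x * 1 \<partial>(\<Pi>\<^sub>M p\<in>I. lborel))"
    by (rule continuous_weighted_integral) (auto intro: gibbs_measure.integr_const[OF gibbs_W])
  then show ?thesis
    by (rule continuous_on_cong[THEN iffD1, rotated 2]) (auto simp: Z_def gibbs_measure.partition_def[OF gibbs_W])
qed

lemma drift_eq: "s \<in> {0..1} \<Longrightarrow> drift s = (\<integral>x. gibbs_measure.weight (W s) x * Re (D x) \<partial>(\<Pi>\<^sub>M p\<in>I. lborel)) / Z s"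
proof -
  assume s: "s \<in> {0..1}"
  interpret gibbs_measure I "W s" \<kappa> by (rule gibbs_W[OF s])
  have "drift s = expect (\<lambda>x. Re (D x))" unfolding drift_def by (intro Re_expect integr_cpoly cpoly_D)
  then show ?thesis by (simp add: expect_def Z_def divide_inverse mult.commute)
qed

lemma integr_Re_D: "s \<in> {0..1} \<Longrightarrow> gibbs_measure.integr I (W s) (\<lambda>x. Re (D x))"
  by (intro gibbs_measure.integr_Re[OF gibbs_W] gibbs_measure.integr_cpoly[OF gibbs_W] cpoly_D)

lemma continuous_drift: "continuous_on {0..1} drift"
proof -
  have "continuous_on {0..1} (\<lambda>s. (\<integral>x. gibbs_measure.weight (W s) x * Re (D x) \<partial>(\<Pi>\<^sub>M p\<in>I. lborel)) / Z s)"
    using Z_pos by (intro continuous_on_divide continuous_weighted_integral continuous_Z integr_Re_D measurable_Re_D) force+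
  then show ?thesis by (rule continuous_on_cong[THEN iffD1, rotated 2]) (auto simp: drift_eq)
qed

text \<open>\<open>Z r / Z s\<close> is the expectation of \<open>exp ((s - r) * Re (D x))\<close>
  at parameter \<open>s\<close>, and Jensen bounds it from below. Exchanging \<open>r\<close> and
  \<open>s\<close> gives the matching upper bound with \<open>drift r\<close>.\<close>

lemma ln_Z_lower:
  assumes s: "s \<in> {0..1}" and r: "r \<in> {0..1}"
  shows "(s - r) * drift s \<le> ln (Z r) - ln (Z s)"
proof -
  interpret S: gibbs_measure I "W s" \<kappa> by (rule gibbs_W[OF s])
  interpret R: gibbs_measure I "W r" \<kappa> by (rule gibbs_W[OF r])
  define h where "h = (s - r) * drift s"
  have w: "R.weight x = S.weight x * exp ((s - r) * Re (D x))" for x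
    using s r by (simp add: weight_W exp_add[symmetric] algebra_simps)
  have "exp h * (1 + ((s - r) * Re (D x) - h)) \<le> exp ((s - r) * Re (D x))" for x
  proof -
    have "exp h * (1 + ((s - r) * Re (D x) - h)) \<le> exp h * exp ((s - r) * Re (D x) - h)"
      by (intro mult_left_mono exp_ge_add_one_self) auto
    then show ?thesis by (simp add: exp_add[symmetric])
  qed
  moreover have i1: "S.integr (\<lambda>x. (s - r) * Re (D x) + (1 - h))"
    using integr_Re_D[OF s] by (intro S.integr_add S.integr_cmult S.integr_const)
  moreover have i2: "S.integr (\<lambda>x. exp ((s - r) * Re (D x)))"
    using R.integr_const[of "1::real"] by (simp add: S.integr_def R.integr_def w)
  ultimately have "S.expect (\<lambda>x. exp h * ((s - r) * Re (D x) + (1 - h))) \<le> S.expect (\<lambda>x. exp ((s - r) * Re (D x)))"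
    by (intro S.expect_mono S.integr_cmult) (auto simp: algebra_simps)
  moreover have "S.expect (\<lambda>x. exp ((s - r) * Re (D x))) = Z r / Z s"
    by (simp add: S.expect_def Z_def R.partition_def w divide_inverse mult.commute)
  moreover have "S.expect (\<lambda>x. exp h * ((s - r) * Re (D x) + (1 - h))) = exp h"
  proof -
    have d: "S.expect (\<lambda>x. Re (D x)) = drift s"
      unfolding drift_def by (intro S.Re_expect[symmetric] S.integr_cpoly cpoly_D)
    have "S.expect (\<lambda>x. exp h * ((s - r) * Re (D x) + (1 - h))) = exp h * S.expect (\<lambda>x. (s - r) * Re (D x) + (1 - h))"
      by (rule S.expect_cmult[OF i1])
    also have "S.expect (\<lambda>x. (s - r) * Re (D x) + (1 - h)) = (s - r) * S.expect (\<lambda>x. Re (D x)) + (1 - h)"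
      by (simp only: S.expect_add[OF S.integr_cmult[OF integr_Re_D[OF s]] S.integr_const] S.expect_cmult[OF integr_Re_D[OF s]] S.expect_const)
    also have "\<dots> = 1" by (simp add: d h_def)
    finally show ?thesis by simp
  qed
  ultimately have "exp h \<le> Z r / Z s" by simp
  then have "h \<le> ln (Z r / Z s)" using Z_pos[OF s] Z_pos[OF r] by (simp add: ln_ge_iff)
  then show ?thesis using Z_pos[OF s] Z_pos[OF r] by (simp add: h_def ln_div)
qed

text \<open>Difference quotients of \<open>ln (Z s)\<close> lie between \<open>- drift s\<close> and
  \<open>- drift r\<close>, so continuity of \<open>drift\<close> gives the derivative without
  differentiating under the integral.\<close>

theorem drift_has_integral: "(drift has_integral (ln (Z 0) - ln (Z 1))) {0..1}"
proof -
  have "((\<lambda>s. - drift s) has_integral (ln (Z 1) - ln (Z 0))) {0..1}"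
  proof (rule fundamental_theorem_of_calculus)
    fix s :: real assume s: "s \<in> {0..1}"
    have "((\<lambda>r. (ln (Z r) - ln (Z s)) / (r - s)) \<longlongrightarrow> - drift s) (at s within {0..1})"
    proof (rule tendstoI)
      fix e :: real assume e: "0 < e"
      have "(drift \<longlongrightarrow> drift s) (at s within {0..1})" using continuous_drift s by (simp add: continuous_on_def)
      then have "eventually (\<lambda>r. dist (drift r) (drift s) < e) (at s within {0..1})" using e by (rule tendstoD)
      moreover have "eventually (\<lambda>r. r \<in> {0..1} \<and> r \<noteq> s) (at s within {0..1})" by (simp add: eventually_at_filter)
      ultimately show "eventually (\<lambda>r. dist ((ln (Z r) - ln (Z s)) / (r - s)) (- drift s) < e) (at s within {0..1})"
      proof eventually_elim
        case (elim r)
        have lo: "(s - r) * drift s \<le> ln (Z r) - ln (Z s)" and hi: "ln (Z r) - ln (Z s) \<le> (s - r) * drift r"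
          using ln_Z_lower[OF s, of r] ln_Z_lower[of r s] s elim by (auto simp: algebra_simps)
        have "\<bar>(ln (Z r) - ln (Z s)) - (s - r) * drift s\<bar> \<le> \<bar>(s - r) * drift r - (s - r) * drift s\<bar>" using lo hi by linarith
        also have "\<dots> = \<bar>r - s\<bar> * \<bar>drift r - drift s\<bar>" by (simp add: right_diff_distrib[symmetric] abs_mult abs_minus_commute)
        finally have le: "\<bar>(ln (Z r) - ln (Z s)) - (s - r) * drift s\<bar> \<le> \<bar>r - s\<bar> * \<bar>drift r - drift s\<bar>" .
        have "(ln (Z r) - ln (Z s)) / (r - s) - (- drift s) = ((ln (Z r) - ln (Z s)) - (s - r) * drift s) / (r - s)"
          using elim by (simp add: field_simps)
        then have "dist ((ln (Z r) - ln (Z s)) / (r - s)) (- drift s) = \<bar>(ln (Z r) - ln (Z s)) - (s - r) * drift s\<bar> / \<bar>r - s\<bar>"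
          by (simp only: dist_real_def abs_divide)
        also have "\<dots> \<le> \<bar>drift r - drift s\<bar>" using le elim by (simp add: divide_le_eq mult.commute)
        also have "\<dots> < e" using elim by (simp add: dist_real_def)
        finally show ?case .
      qed
    qed
    then show "((\<lambda>s. ln (Z s)) has_vector_derivative - drift s) (at s within {0..1})"
      by (simp add: has_field_derivative_iff flip: has_real_derivative_iff_has_vector_derivative)
  qed simp
  from has_integral_neg[OF this] show ?thesis by simp
qed

end

section \<open>Traces of noncommutative polynomials in the real coordinates\<close>

lemma herm_carrier [simp]: "herm N x i \<in> carrier_mat N N"
  by (simp add: herm_def)

lemma herm_entry: "a < N \<Longrightarrow> b < N \<Longrightarrow> herm N x i $$ (a, b) = hentry x i a b"
  by (simp add: herm_def hentry_def)

lemma eval_monomial_carrier [simp]: "eval_monomial N (herm N x) w \<in> carrier_mat N N"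
proof (induction w)
  case (Cons i w)
  then show ?case unfolding eval_monomial_def by (simp only: foldr.simps o_apply) (rule mult_carrier_mat[OF herm_carrier])
qed (simp add: eval_monomial_def)

lemma eval_monomial_entry:
  "a < N \<Longrightarrow> b < N \<Longrightarrow> eval_monomial N (herm N x) w $$ (a, b) = entry N (hentry x) w a b"
proof (induction w arbitrary: a)
  case (Cons i w)
  have "eval_monomial N (herm N x) (i # w) $$ (a, b) = (\<Sum>k = 0..<N. herm N x i $$ (a, k) * eval_monomial N (herm N x) w $$ (k, b))"
    using Cons.prems herm_carrier[of N x i] eval_monomial_carrier[of N x w]
    by (simp add: eval_monomial_def scalar_prod_def del: herm_carrier eval_monomial_carrier)
  also have "\<dots> = (\<Sum>k<N. hentry x i a k * entry N (hentry x) w k b)"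
    unfolding atLeast0LessThan using Cons by (intro sum.cong refl) (auto simp: herm_entry)
  finally show ?case by simp
qed (simp add: eval_monomial_def)

lemma Tr_eval_poly:
  "Tr (eval_poly N (herm N x) P) = (\<Sum>w\<in>Poly_Mapping.keys P. Poly_Mapping.lookup P w * wtrace N x w)"
proof -
  have "Tr (eval_poly N (herm N x) P) = (\<Sum>a<N. \<Sum>w\<in>Poly_Mapping.keys P. Poly_Mapping.lookup P w * entry N (hentry x) w a a)"
    by (simp add: Tr_def eval_poly_def eval_monomial_entry)
  also have "\<dots> = (\<Sum>w\<in>Poly_Mapping.keys P. Poly_Mapping.lookup P w * wtrace N x w)"
    by (subst sum.swap) (simp add: wtrace_def sum_distrib_left)
  finally show ?thesis .
qed

text \<open>Keys may cancel in a sum of polynomials; a common superset of the keys makes the trace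
  visibly additive.\<close>

lemma sum_lookup_superset:
  assumes "finite S" "Poly_Mapping.keys P \<subseteq> S"
  shows "(\<Sum>w\<in>Poly_Mapping.keys P. Poly_Mapping.lookup P w * f w) = (\<Sum>w\<in>S. Poly_Mapping.lookup P w * (f w :: complex))"
  using assms by (intro sum.mono_neutral_left) (auto simp: in_keys_iff)

lemma Tr_eval_add: "Tr (eval_poly N (herm N x) (P + Q)) = Tr (eval_poly N (herm N x) P) + Tr (eval_poly N (herm N x) Q)"
proof -
  define S where "S = Poly_Mapping.keys P \<union> Poly_Mapping.keys Q"
  have S: "finite S" "Poly_Mapping.keys P \<subseteq> S" "Poly_Mapping.keys Q \<subseteq> S" "Poly_Mapping.keys (P + Q) \<subseteq> S"
    using keys_add[of P Q] by (auto simp: S_def)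
  show ?thesis
    unfolding Tr_eval_poly sum_lookup_superset[OF S(1,2)] sum_lookup_superset[OF S(1,3)] sum_lookup_superset[OF S(1,4)]
    by (simp add: lookup_add distrib_right sum.distrib)
qed

lemma Tr_eval_single: "Tr (eval_poly N (herm N x) (Poly_Mapping.single w c)) = c * wtrace N x w"
proof -
  have "Poly_Mapping.keys (Poly_Mapping.single w c) \<subseteq> {w}" by simp
  then show ?thesis unfolding Tr_eval_poly by (subst sum_lookup_superset[of "{w}"]) auto
qed

lemma Tr_eval_sum: "Tr (eval_poly N (herm N x) (\<Sum>j\<in>S. P j)) = (\<Sum>j\<in>S. Tr (eval_poly N (herm N x) (P j)))"
proof (induction S rule: infinite_finite_induct)
  case (insert j S)
  then show ?case by (simp add: Tr_eval_add)
qed (simp_all add: Tr_eval_poly)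

lemma Tr_potential: "Tr (eval_poly N (herm N x) (potential n q t)) = (\<Sum>j=1..n. t j * wtrace N x (q j))"
  unfolding potential_def Tr_eval_sum Tr_eval_single ..

lemma Tr_sum_squares: "Tr (eval_poly N (herm N x) (sum_squares m)) = (\<Sum>i<m. wtrace N x [i, i])"
  unfolding sum_squares_def Tr_eval_sum Tr_eval_single by simp

lemma Tr_half_sum_squares: "Tr (eval_poly N (herm N x) (half_sum_squares m)) = 1/2 * (\<Sum>i<m. wtrace N x [i, i])"
  unfolding half_sum_squares_def Tr_eval_sum Tr_eval_single by (simp add: sum_distrib_left)

lemma pot_alt: "pot m N n q t x = of_nat N * Tr (eval_poly N (herm N x) (potential n q t + half_sum_squares m))"
  by (simp only: pot_def Tr_eval_add Tr_potential Tr_half_sum_squares)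

section \<open>Strong convexity of the interpolated potentials\<close>

lemma convex_on_quadratic: "0 \<le> a \<Longrightarrow> convex_on UNIV (\<lambda>s::real. a * s\<^sup>2 + b * s + c)"
proof (rule f''_ge0_imp_convex)
  show "((\<lambda>s. a * s\<^sup>2 + b * s + c) has_real_derivative 2 * a * s + b) (at s)" for s
    by (auto intro!: derivative_eq_intros)
  show "((\<lambda>s. 2 * a * s + b) has_real_derivative 2 * a) (at s)" for s
    by (auto intro!: derivative_eq_intros)
qed auto

lemma strongly_convex_antimono:
  assumes "strongly_convex I \<kappa> f" "\<kappa>' \<le> \<kappa>"
  shows "strongly_convex I \<kappa>' f"
  unfolding strongly_convex_def
proof (intro allI)
  fix x v
  have "convex_on UNIV (\<lambda>s. (f (\<lambda>i. x i + s * v i) - \<kappa> / 2 * s\<^sup>2 * sqnorm I v) + ((\<kappa> - \<kappa>') / 2 * sqnorm I v * s\<^sup>2 + 0 * s + 0))"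
    using assms by (intro convex_on_add convex_on_quadratic) (auto simp: strongly_convex_def)
  moreover have "(f (\<lambda>i. x i + s * v i) - \<kappa> / 2 * s\<^sup>2 * sqnorm I v) + ((\<kappa> - \<kappa>') / 2 * sqnorm I v * s\<^sup>2 + 0 * s + 0)
      = f (\<lambda>i. x i + s * v i) - \<kappa>' / 2 * s\<^sup>2 * sqnorm I v" for s
    by (simp add: field_simps)
  ultimately show "convex_on UNIV (\<lambda>s. f (\<lambda>i. x i + s * v i) - \<kappa>' / 2 * s\<^sup>2 * sqnorm I v)"
    by (simp only:)
qed

lemma strongly_convex_combination:
  assumes "strongly_convex I \<kappa> f" "strongly_convex I \<kappa> g" "0 \<le> s" "s \<le> 1"
  shows "strongly_convex I \<kappa> (\<lambda>x. s * f x + (1 - s) * g x)"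
  unfolding strongly_convex_def
proof (intro allI)
  fix x v
  have "convex_on UNIV (\<lambda>r. s * (f (\<lambda>i. x i + r * v i) - \<kappa> / 2 * r\<^sup>2 * sqnorm I v) + (1 - s) * (g (\<lambda>i. x i + r * v i) - \<kappa> / 2 * r\<^sup>2 * sqnorm I v))"
    using assms by (intro convex_on_add convex_on_cmul) (auto simp: strongly_convex_def)
  moreover have "s * (f (\<lambda>i. x i + r * v i) - \<kappa> / 2 * r\<^sup>2 * sqnorm I v) + (1 - s) * (g (\<lambda>i. x i + r * v i) - \<kappa> / 2 * r\<^sup>2 * sqnorm I v)
      = (s * f (\<lambda>i. x i + r * v i) + (1 - s) * g (\<lambda>i. x i + r * v i)) - \<kappa> / 2 * r\<^sup>2 * sqnorm I v" for r
    by (simp add: field_simps)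
  ultimately show "convex_on UNIV (\<lambda>r. (s * f (\<lambda>i. x i + r * v i) + (1 - s) * g (\<lambda>i. x i + r * v i)) - \<kappa> / 2 * r\<^sup>2 * sqnorm I v)"
    by (simp only:)
qed

lemma strongly_convex_scale:
  assumes "strongly_convex I \<kappa> f" "0 \<le> a"
  shows "strongly_convex I (a * \<kappa>) (\<lambda>x. a * f x)"
  unfolding strongly_convex_def
proof (intro allI)
  fix x v
  have "convex_on UNIV (\<lambda>r. a * (f (\<lambda>i. x i + r * v i) - \<kappa> / 2 * r\<^sup>2 * sqnorm I v))"
    using assms by (intro convex_on_cmul) (auto simp: strongly_convex_def)
  then show "convex_on UNIV (\<lambda>r. a * f (\<lambda>i. x i + r * v i) - a * \<kappa> / 2 * r\<^sup>2 * sqnorm I v)"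
    by (simp add: algebra_simps)
qed

lemma partial_deriv_Re:
  assumes "finite I" "cpoly I F" "p \<in> I"
  shows "partial_deriv p (\<lambda>x. Re (F x)) = (\<lambda>x. Re (pd p F x))"
proof
  fix x
  have "((\<lambda>s. Re (F (x(p := s)))) has_real_derivative Re (pd p F (x(p := x p)))) (at (x p))"
    unfolding has_real_derivative_iff_has_vector_derivative
    by (rule bounded_linear.has_vector_derivative[OF bounded_linear_Re pd_coord[OF assms]])
  then show "partial_deriv p (\<lambda>x. Re (F x)) x = Re (pd p F x)"
    by (simp add: partial_deriv_def DERIV_imp_deriv)
qed

text \<open>The second derivative along a line of direction \<open>v\<close> is the Hessian form at
  \<open>v\<close>.\<close>

lemma hessian_imp_strongly_convex:
  assumes I: "finite I" and F: "cpoly I F" and hess: "hessian_bounded_below I c (\<lambda>x. Re (F x))"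
  shows "strongly_convex I c (\<lambda>x. Re (F x))"
  unfolding strongly_convex_def
proof (intro allI)
  fix x v :: "'a \<Rightarrow> real"
  let ?l = "\<lambda>s. \<lambda>i. x i + s * v i"
  show "convex_on UNIV (\<lambda>s. Re (F (?l s)) - c / 2 * s\<^sup>2 * sqnorm I v)"
  proof (rule f''_ge0_imp_convex)
    fix s
    have d: "((\<lambda>s. Re (G (?l s))) has_real_derivative (\<Sum>p\<in>I. v p * Re (pd p G (?l s)))) (at s)" if "cpoly I G" for G
      using bounded_linear.has_vector_derivative[OF bounded_linear_Re pd_line[OF I that]]
      by (simp add: has_real_derivative_iff_has_vector_derivative)
    have d2: "((\<lambda>s. c / 2 * s\<^sup>2 * sqnorm I v) has_real_derivative c * s * sqnorm I v) (at s)"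
      by (auto intro!: derivative_eq_intros)
    show "((\<lambda>s. Re (F (?l s)) - c / 2 * s\<^sup>2 * sqnorm I v) has_real_derivative (\<Sum>p\<in>I. v p * Re (pd p F (?l s))) - c * s * sqnorm I v) (at s)"
      by (intro DERIV_diff d F d2)
    have d3: "((\<lambda>s. c * s * sqnorm I v) has_real_derivative c * sqnorm I v) (at s)"
      by (auto intro!: derivative_eq_intros)
    have "((\<lambda>s. \<Sum>r\<in>I. v r * Re (pd r F (?l s))) has_real_derivative (\<Sum>r\<in>I. v r * (\<Sum>p\<in>I. v p * Re (pd p (pd r F) (?l s))))) (at s)"
      using I F by (intro DERIV_sum DERIV_cmult d cpoly_pd)
    from DERIV_diff[OF this d3]
    show "((\<lambda>s. (\<Sum>p\<in>I. v p * Re (pd p F (?l s))) - c * s * sqnorm I v) has_real_derivative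
       (\<Sum>r\<in>I. v r * (\<Sum>p\<in>I. v p * Re (pd p (pd r F) (?l s)))) - c * sqnorm I v) (at s)" .
    have "c * sqnorm I v \<le> (\<Sum>p\<in>I. \<Sum>r\<in>I. v p * partial_deriv p (partial_deriv r (\<lambda>x. Re (F x))) (?l s) * v r)"
      using hess by (auto simp: hessian_bounded_below_def sqnorm_def)
    also have "\<dots> = (\<Sum>p\<in>I. \<Sum>r\<in>I. v p * Re (pd p (pd r F) (?l s)) * v r)"
      using I F by (intro sum.cong refl) (simp add: partial_deriv_Re[OF I] cpoly_pd)
    also have "\<dots> = (\<Sum>r\<in>I. v r * (\<Sum>p\<in>I. v p * Re (pd p (pd r F) (?l s))))"
      by (subst sum.swap) (simp add: sum_distrib_left mult_ac)
    finally show "0 \<le> (\<Sum>r\<in>I. v r * (\<Sum>p\<in>I. v p * Re (pd p (pd r F) (?l s)))) - c * sqnorm I v" by simp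
  qed simp
qed

text \<open>The modulus of an off-diagonal entry is counted at \<open>(a, b)\<close> and at
  \<open>(b, a)\<close>, hence the weight 2. The smaller weight 1 on the diagonal gives the Gaussian
  part the convexity constant \<open>N\<close>.\<close>

lemma pot_zero: "pot m N n q (\<lambda>_. 0) x = of_real (real N / 2 * (\<Sum>(i, a, b)\<in>coords m N. (if a = b then 1 else 2) * (x (i, a, b))\<^sup>2))"
proof -
  have "wtrace N x [i, i] = of_real (\<Sum>a<N. \<Sum>b<N. (if a = b then 1 else 2) * (x (i, a, b))\<^sup>2)" for i
  proof -
    have "wtrace N x [i, i] = wtrace N x ([i] @ [i])" by simp
    also have "\<dots> = (\<Sum>a<N. \<Sum>b<N. entry N (hentry x) [i] a b * entry N (hentry x) [i] b a)" by (rule sum_entry_entry[symmetric])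
    also have "\<dots> = (\<Sum>a<N. \<Sum>b<N. of_real ((cmod (hentry x i a b))\<^sup>2))"
    proof (intro sum.cong refl)
      fix a b assume "a \<in> {..<N}" "b \<in> {..<N}"
      then have "entry N (hentry x) [i] a b * entry N (hentry x) [i] b a = hentry x i a b * hentry x i b a"
        by (simp add: if_distrib[of "\<lambda>z. _ * z"] cong: if_cong)
      also have "hentry x i b a = cnj (hentry x i a b)" by (simp add: hentry_def complex_eq_iff)
      finally show "entry N (hentry x) [i] a b * entry N (hentry x) [i] b a = of_real ((cmod (hentry x i a b))\<^sup>2)"
        by (simp only: complex_norm_square)
    qed
    also have "\<dots> = of_real (\<Sum>a<N. \<Sum>b<N. (cmod (hentry x i a b))\<^sup>2)" by simp
    also have "(\<Sum>a<N. \<Sum>b<N. (cmod (hentry x i a b))\<^sup>2) = (\<Sum>a<N. \<Sum>b<N. (if a = b then 1 else 2) * (x (i, a, b))\<^sup>2)"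
    proof (rule sum_symmetrize)
      fix a b :: nat
      consider "a = b" | "a < b" | "b < a" by linarith
      then show "(cmod (hentry x i a b))\<^sup>2 + (cmod (hentry x i b a))\<^sup>2 = (if a = b then 1 else 2) * (x (i, a, b))\<^sup>2 + (if b = a then 1 else 2) * (x (i, b, a))\<^sup>2"
        by cases (simp_all add: hentry_def cmod_power2)
    qed
    finally show ?thesis .
  qed
  then show ?thesis by (simp add: pot_def sum_coords case_prod_unfold)
qed

lemma strongly_convex_pot_zero: "strongly_convex (coords m N) (real N) (\<lambda>x. Re (pot m N n q (\<lambda>_. 0) x))"
proof -
  define k where "k = (\<lambda>(i::nat, a::nat, b::nat). if a = b then 1 else 2 :: real)"
  define g where "g = (\<lambda>x. \<Sum>p\<in>coords m N. k p * (x p)\<^sup>2)"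
  have "strongly_convex (coords m N) 1 (\<lambda>x. 1/2 * g x)"
    unfolding strongly_convex_def
  proof (intro allI)
    fix x v :: "nat \<times> nat \<times> nat \<Rightarrow> real"
    define A where "A = (\<Sum>p\<in>coords m N. (k p - 1) * (v p)\<^sup>2)"
    have "0 \<le> A" unfolding A_def by (intro sum_nonneg) (auto simp: k_def)
    then have "convex_on UNIV (\<lambda>s. A / 2 * s\<^sup>2 + (\<Sum>p\<in>coords m N. k p * x p * v p) * s + 1/2 * g x)"
      by (intro convex_on_quadratic) simp
    moreover have "1/2 * g (\<lambda>i. x i + s * v i) - 1 / 2 * s\<^sup>2 * sqnorm (coords m N) v = A / 2 * s\<^sup>2 + (\<Sum>p\<in>coords m N. k p * x p * v p) * s + 1/2 * g x" for s
      unfolding A_def g_def sqnorm_def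
      by (simp add: sum_distrib_left sum_distrib_right sum_divide_distrib sum.distrib[symmetric] sum_subtractf[symmetric])
         (intro sum.cong refl, simp add: power2_eq_square field_simps)
    ultimately show "convex_on UNIV (\<lambda>s. 1/2 * g (\<lambda>i. x i + s * v i) - 1 / 2 * s\<^sup>2 * sqnorm (coords m N) v)" by simp
  qed
  from strongly_convex_scale[OF this, of "real N"]
  show ?thesis by (simp add: pot_zero g_def k_def case_prod_unfold)
qed

lemma pot_affine: "pot m N n q (\<lambda>j. of_real s * t j) x = of_real s * (of_nat N * (\<Sum>j=1..n. t j * wtrace N x (q j))) + pot m N n q (\<lambda>_. 0) x"
  by (simp add: pot_def sum_distrib_left mult.assoc distrib_left mult.left_commute)

section \<open>The asymptotic expansion\<close>

lemma Re_of_real_mult: "Re (of_real r * z) = r * Re z"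
  by simp

lemma pot_combination:
  "pot m N n q (\<lambda>j. of_real s * t j) x = of_real s * pot m N n q t x + of_real (1 - s) * pot m N n q (\<lambda>_. 0) x"
  using pot_affine[of m N n q s t x] pot_affine[of m N n q 1 t x] by (simp add: algebra_simps)

lemma pot_zero_real: "pot m N n q (\<lambda>_. 0) x \<in> \<real>"
  unfolding pot_zero by (rule Reals_of_real)

text \<open>The interpolated potential is a convex combination of the full one, with constant
  \<open>N * c\<close>, and the Gaussian one, with constant \<open>N\<close>; both are strongly
  convex with \<open>N * min c 1\<close>.\<close>

lemma matrix_gibbs_interpolation:
  assumes "1 \<le> m" "1 \<le> N" "0 < c" "0 \<le> \<eta>" "real n * real d * \<eta> \<le> 1"
    and t: "\<And>j. j \<in> {1..n} \<Longrightarrow> cmod (t j) \<le> \<eta>"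
    and q: "\<And>j. j \<in> {1..n} \<Longrightarrow> set (q j) \<subseteq> {..<m} \<and> length (q j) \<le> d"
    and conv: "c_convex m c (potential n q t)" and s: "s \<in> {0..1}"
  shows "matrix_gibbs m N n d q (\<lambda>j. of_real s * t j) (min c 1) \<eta>"
proof
  define F where "F = (\<lambda>x. Tr (eval_poly N (herm N x) (potential n q t + half_sum_squares m)))"
  have F: "F x \<in> \<real>" "hessian_bounded_below (coords m N) c (\<lambda>x. Re (F x))" for x
    using conv by (auto simp: c_convex_def F_def Let_def)
  have pot: "pot m N n q t x = of_nat N * F x" for x by (simp add: pot_alt F_def)
  have real_t: "pot m N n q t x \<in> \<real>" for x unfolding pot using F(1) by simp
  have cF: "cpoly (coords m N) F"
  proof -
    have "cpoly (coords m N) (\<lambda>x. (1 / of_nat N) * pot m N n q t x)" using q by (intro cpoly_cmult cpoly_pot) auto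
    then show ?thesis using \<open>1 \<le> N\<close> by (simp add: pot)
  qed
  have "strongly_convex (coords m N) (real N * c) (\<lambda>x. real N * Re (F x))"
    by (rule strongly_convex_scale[OF hessian_imp_strongly_convex[OF finite_coords cF F(2)]]) simp
  moreover have "real N * min c 1 \<le> real N * c" by (intro mult_left_mono) auto
  ultimately have "strongly_convex (coords m N) (real N * min c 1) (\<lambda>x. real N * Re (F x))"
    by (rule strongly_convex_antimono)
  then have "strongly_convex (coords m N) (real N * min c 1) (\<lambda>x. Re (pot m N n q t x))" by (simp add: pot)
  moreover have "strongly_convex (coords m N) (real N * min c 1) (\<lambda>x. Re (pot m N n q (\<lambda>_. 0) x))"
    by (rule strongly_convex_antimono[OF strongly_convex_pot_zero]) (simp add: mult_left_le)
  ultimately have "strongly_convex (coords m N) (real N * min c 1) (\<lambda>x. s * Re (pot m N n q t x) + (1 - s) * Re (pot m N n q (\<lambda>_. 0) x))"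
    by (rule strongly_convex_combination) (use s in auto)
  then show "strongly_convex (coords m N) (real N * min c 1) (\<lambda>x. Re (pot m N n q (\<lambda>j. of_real s * t j) x))"
    by (simp add: pot_combination)
  show "pot m N n q (\<lambda>j. of_real s * t j) x \<in> \<real>" for x
    unfolding pot_combination using real_t pot_zero_real by (intro Reals_add Reals_mult Reals_of_real)
  show "cmod (of_real s * t j) \<le> \<eta>" if "j \<in> {1..n}" for j
    using t[OF that] s mult_left_le_one_le[of "cmod (t j)" s] by (simp add: norm_mult)
  show "0 < min c 1" using \<open>0 < c\<close> by simp
qed (use assms in auto)

text \<open>\<open>corr\<close> belongs to a locale that fixes \<open>N\<close> and the
  coefficients; here it becomes a function of \<open>N\<close> and \<open>s\<close>, to which limits
  can be applied.\<close>

definition interpolated_corr :: "nat \<Rightarrow> nat \<Rightarrow> (nat \<Rightarrow> nat list) \<Rightarrow> (nat \<Rightarrow> complex) \<Rightarrow> nat \<Rightarrow> real \<Rightarrow> nat list list \<Rightarrow> complex" where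
  "interpolated_corr m n q t N s = matrix_gibbs.corr m N n q (\<lambda>j. of_real s * t j)"

text \<open>The normalization of the Gaussian law is \<open>Z 0\<close>, so the partition function
  is \<open>Z 1 / Z 0\<close>, a positive real, and \<open>Ln\<close> is the ordinary logarithm. In
  the drift, one factor \<open>N\<close> is that of the potential and the other undoes the
  normalization of the trace.\<close>

lemma partition_function_interpolation:
  assumes N: "1 \<le> N" and letters: "\<And>j. j \<in> {1..n} \<Longrightarrow> set (q j) \<subseteq> {..<m}"
    and mg: "\<And>s. s \<in> {0..1} \<Longrightarrow> matrix_gibbs m N n d q (\<lambda>j. of_real s * t j) c \<eta>"
  defines "g \<equiv> \<lambda>s. (real N)\<^sup>2 * Re (\<Sum>j=1..n. t j * interpolated_corr m n q t N s [q j])"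
  shows "continuous_on {0..1} g"
    and "Ln (partition_function m N (potential n q t)) = of_real (- integral {0..1} g)"
proof -
  let ?I = "coords m N"
  let ?L = "\<Pi>\<^sub>M p\<in>?I. (lborel :: real measure)"
  define D where "D = (\<lambda>x. of_nat N * (\<Sum>j=1..n. t j * wtrace N x (q j)))"
  define U where "U = pot m N n q (\<lambda>_. 0)"
  have pot: "(\<lambda>x. of_real s * D x + U x) = pot m N n q (\<lambda>j. of_real s * t j)" for s
    by (simp add: D_def U_def pot_affine fun_eq_iff)
  have gm: "gibbs_measure ?I (\<lambda>x. of_real s * D x + U x) (real N * c)" if s: "s \<in> {0..1}" for s
  proof -
    interpret matrix_gibbs m N n d q "\<lambda>j. of_real s * t j" c \<eta> by (rule mg[OF s])
    show ?thesis unfolding pot by (rule gibbs_measure_axioms)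
  qed
  have realU: "U x \<in> \<real>" for x unfolding U_def by (rule pot_zero_real)
  have realD: "D x \<in> \<real>" for x
    using gibbs_measure.real_W[OF gm[of 1], of x] realU[of x] Reals_diff[of "D x + U x" "U x"] by simp
  have cD: "cpoly ?I D" unfolding D_def using letters by (intro cpoly_cmult cpoly_sum cpoly_wtrace) auto
  interpret gibbs_family ?I U D "real N * c"
    by unfold_locales (use gm cD realD in \<open>auto simp: gibbs_measure_def\<close>)
  have Wpot: "W s = pot m N n q (\<lambda>j. of_real s * t j)" for s unfolding W_def by (rule pot)
  have drift: "drift s = g s" if s: "s \<in> {0..1}" for s
  proof -
    interpret matrix_gibbs m N n d q "\<lambda>j. of_real s * t j" c \<eta> by (rule mg[OF s])
    have qF: "[q j] \<in> forests {..<m}" if "j \<in> {1..n}" for j using letters[OF that] by auto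
    have i: "integr (\<lambda>x. wtrace N x (q j))" if "j \<in> {1..n}" for j using letters[OF that] by (intro integr_cpoly cpoly_wtrace)
    have e: "expect (\<lambda>x. wtrace N x (q j)) = of_nat N * corr [q j]" if "j \<in> {1..n}" for j
      using expect_prod_wtrace[OF qF[OF that]] by simp
    have "expect D = of_nat N * expect (\<lambda>x. \<Sum>j=1..n. t j * wtrace N x (q j))"
      unfolding D_def using i by (intro expect_cmult integr_sum integr_cmult)
    also have "expect (\<lambda>x. \<Sum>j=1..n. t j * wtrace N x (q j)) = (\<Sum>j=1..n. expect (\<lambda>x. t j * wtrace N x (q j)))"
      using i by (intro expect_sum integr_cmult)
    also have "\<dots> = (\<Sum>j=1..n. t j * (of_nat N * corr [q j]))"
      using i e by (intro sum.cong refl) (simp add: expect_cmult)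
    also have "of_nat N * \<dots> = of_real ((real N)\<^sup>2) * (\<Sum>j=1..n. t j * corr [q j])"
      by (simp add: sum_distrib_left power2_eq_square mult_ac)
    finally have "Re (expect D) = (real N)\<^sup>2 * Re (\<Sum>j=1..n. t j * corr [q j])"
      by (simp only: Re_of_real_mult)
    then show ?thesis by (simp add: drift_def Wpot g_def interpolated_corr_def)
  qed
  show "continuous_on {0..1} g"
    using continuous_drift by (rule continuous_on_cong[THEN iffD1, rotated 2]) (auto simp: drift)
  have "(g has_integral (ln (Z 0) - ln (Z 1))) {0..1}"
    using drift_has_integral by (rule has_integral_eq[rotated]) (simp add: drift)
  then have int: "integral {0..1} g = ln (Z 0) - ln (Z 1)" by (rule integral_unique)
  have e0: "gibbs_measure.weight (W 0) x = exp (- Re (U x))" for x by (subst weight_W) auto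
  have e1: "gibbs_measure.weight (W 1) x = exp (- Re (D x)) * exp (- Re (U x))" for x
    by (subst weight_W) (auto simp: exp_add[symmetric])
  have w0: "gue_weight m N x = gibbs_measure.weight (W 0) x" for x
    unfolding e0 by (simp add: gue_weight_def Tr_sum_squares U_def pot_def)
  have w1: "exp (- of_nat N * Tr (eval_poly N (herm N x) (potential n q t))) * of_real (gue_weight m N x) = complex_of_real (gibbs_measure.weight (W 1) x)" for x
  proof -
    have "exp (- of_nat N * Tr (eval_poly N (herm N x) (potential n q t))) = exp (- D x)"
      by (simp add: Tr_potential D_def)
    also have "\<dots> = exp (of_real (- Re (D x)))" using realD[of x] by (simp add: complex_is_Real_iff complex_eq_iff)
    also have "\<dots> = of_real (exp (- Re (D x)))" by (rule exp_of_real)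
    finally have "exp (- of_nat N * Tr (eval_poly N (herm N x) (potential n q t))) = of_real (exp (- Re (D x)))" .
    then show ?thesis by (simp only: w0 e0 e1 of_real_mult)
  qed
  have Z0: "(LINT x|?L. gue_weight m N x) = Z 0"
    by (simp add: w0 Z_def gibbs_measure.partition_def[OF gibbs_W])
  have Zp: "Z 0 > 0" "Z 1 > 0" using Z_pos by auto
  have mw: "gue_weight m N \<in> borel_measurable ?L"
    using gibbs_measure.weight_measurable[OF gibbs_W[of 0]] by (simp add: w0 cong: measurable_cong)
  have mD: "(\<lambda>x. exp (- of_nat N * Tr (eval_poly N (herm N x) (potential n q t)))) \<in> borel_measurable ?L"
  proof -
    have [measurable]: "D \<in> borel_measurable ?L" using cD by (rule cpoly_measurable)
    have "(\<lambda>x. exp (- D x)) \<in> borel_measurable ?L" by measurable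
    then show ?thesis by (simp add: Tr_potential D_def)
  qed
  have "partition_function m N (potential n q t)
     = (LINT x|?L. (gue_weight m N x / Z 0) *\<^sub>R exp (- of_nat N * Tr (eval_poly N (herm N x) (potential n q t))))"
    unfolding partition_function_def gue_def Let_def Z0
  proof (rule integral_density[OF mD])
    show "(\<lambda>x. gue_weight m N x / Z 0) \<in> borel_measurable ?L" using mw by measurable
    show "AE x in ?L. 0 \<le> gue_weight m N x / Z 0" using Zp by (simp add: gue_weight_def)
  qed
  also have "\<dots> = (LINT x|?L. of_real (gibbs_measure.weight (W 1) x / Z 0))"
    by (intro Bochner_Integration.integral_cong refl) (simp add: w1[symmetric] scaleR_conv_of_real mult.commute)
  also have "\<dots> = of_real (Z 1 / Z 0)"
    by (simp add: Z_def gibbs_measure.partition_def[OF gibbs_W])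
  finally have "Ln (partition_function m N (potential n q t)) = of_real (ln (Z 1 / Z 0))"
    using Zp by (simp add: Ln_of_real del: of_real_divide)
  then show "Ln (partition_function m N (potential n q t)) = of_real (- integral {0..1} g)"
    using Zp by (simp add: int ln_div)
qed

text \<open>The limits \<open>a\<close> and \<open>b\<close> come pointwise, without regularity in
  \<open>s\<close>. Integrability of \<open>a\<close> follows from its being the limit of
  \<open>g N s / N\<^sup>2\<close>, dominated by means of the single function \<open>g K\<close>;
  the shift by \<open>K\<close> starts the sequences where the bounds hold.\<close>

lemma integral_expansion:
  fixes g :: "nat \<Rightarrow> real \<Rightarrow> real" and a b :: "real \<Rightarrow> real"
  assumes K: "1 \<le> K" and g: "\<And>N. K \<le> N \<Longrightarrow> continuous_on {0..1} (g N)"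
    and bound: "\<And>N s. K \<le> N \<Longrightarrow> s \<in> {0..1} \<Longrightarrow> \<bar>g N s - (real N)\<^sup>2 * a s\<bar> \<le> B"
    and lim: "\<And>s. s \<in> {0..1} \<Longrightarrow> (\<lambda>N. g N s - (real N)\<^sup>2 * a s) \<longlonglongrightarrow> b s"
  shows "(\<lambda>N. integral {0..1} (g N) - (real N)\<^sup>2 * integral {0..1} a) \<longlonglongrightarrow> integral {0..1} b"
proof -
  have B: "0 \<le> B" using bound[of K 0] by simp
  have gi: "g N integrable_on {0..1}" if "K \<le> N" for N using g[OF that] by (rule integrable_continuous_real)
  define h where "h = (\<lambda>s. \<bar>g K s\<bar> + 2 * B)"
  have hi: "h integrable_on {0..1}" unfolding h_def
    by (intro integrable_continuous_real continuous_intros g) simp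
  have N1: "1 \<le> (real N)\<^sup>2" if "K \<le> N" for N using that K by (intro one_le_power) auto
  have ab: "\<bar>a s\<bar> \<le> \<bar>g K s\<bar> + B" if s: "s \<in> {0..1}" for s
  proof -
    have "1 * \<bar>a s\<bar> \<le> (real K)\<^sup>2 * \<bar>a s\<bar>" by (intro mult_right_mono N1) auto
    also have "\<dots> = \<bar>(real K)\<^sup>2 * a s\<bar>" by (simp add: abs_mult)
    also have "\<dots> \<le> \<bar>g K s\<bar> + B" using bound[of K s] s by linarith
    finally show ?thesis by simp
  qed
  define f where "f = (\<lambda>k s. g (k + K) s / (real (k + K))\<^sup>2)"
  have fa: "\<bar>f k s - a s\<bar> \<le> B / (real (k + K))\<^sup>2" if s: "s \<in> {0..1}" for k s
  proof -
    have p: "0 < (real (k + K))\<^sup>2" using K by simp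
    have "f k s - a s = (g (k + K) s - (real (k + K))\<^sup>2 * a s) / (real (k + K))\<^sup>2" using p unfolding f_def by (simp add: diff_divide_distrib)
    then show ?thesis using bound[of "k + K" s] s p by (simp add: abs_divide divide_right_mono)
  qed
  have a_int: "a integrable_on {0..1}"
  proof (rule dominated_convergence(1)[where f = f and h = h])
    show "f k integrable_on {0..1}" for k unfolding f_def by (intro integrable_on_divide gi) simp
    show "h integrable_on {0..1}" by (rule hi)
    show "norm (f k s) \<le> h s" if s: "s \<in> {0..1}" for k s
    proof -
      have "B / (real (k + K))\<^sup>2 \<le> B / 1" using B N1[of "k + K"] by (intro divide_left_mono) auto
      then show ?thesis using fa[OF s, of k] ab[OF s] by (simp add: h_def)
    qed
    show "(\<lambda>k. f k s) \<longlonglongrightarrow> a s" if s: "s \<in> {0..1}" for s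
    proof -
      have "(\<lambda>k. B / (real (k + K))\<^sup>2) \<longlonglongrightarrow> 0" by real_asymp
      then have "(\<lambda>k. f k s - a s) \<longlonglongrightarrow> 0"
        by (rule Lim_null_comparison[rotated]) (use fa[OF s] in simp)
      then show ?thesis by (simp add: LIM_zero_iff)
    qed
  qed
  have ai: "(\<lambda>s. c * a s) integrable_on {0..1}" for c
    using integrable_on_cmult_left[OF a_int, of c] by simp
  have "(\<lambda>k. integral {0..1} (\<lambda>s. g (k + K) s - (real (k + K))\<^sup>2 * a s)) \<longlonglongrightarrow> integral {0..1} b"
  proof (rule dominated_convergence(2)[where h = "\<lambda>_. B"])
    show "(\<lambda>s. g (k + K) s - (real (k + K))\<^sup>2 * a s) integrable_on {0..1}" for k
      by (intro integrable_diff gi ai) simp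
    show "norm (g (k + K) s - (real (k + K))\<^sup>2 * a s) \<le> B" if "s \<in> {0..1}" for k s
      using bound[of "k + K" s] that by simp
    show "(\<lambda>k. g (k + K) s - (real (k + K))\<^sup>2 * a s) \<longlonglongrightarrow> b s" if "s \<in> {0..1}" for s
      using LIMSEQ_ignore_initial_segment[OF lim[OF that], of K] .
  qed (simp add: integrable_const_ivl)
  moreover have "integral {0..1} (\<lambda>s. g (k + K) s - (real (k + K))\<^sup>2 * a s) = integral {0..1} (g (k + K)) - (real (k + K))\<^sup>2 * integral {0..1} a" for k
    by (subst Henstock_Kurzweil_Integration.integral_diff) (auto intro!: gi ai)
  ultimately have "(\<lambda>k. integral {0..1} (g (k + K)) - (real (k + K))\<^sup>2 * integral {0..1} a) \<longlonglongrightarrow> integral {0..1} b"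
    by simp
  then show ?thesis by (rule LIMSEQ_offset)
qed

lemma moment_radius_ge_2: "1 \<le> m \<Longrightarrow> 0 < c \<Longrightarrow> 2 \<le> moment_radius m c"
proof -
  assume m: "1 \<le> m" and c: "0 < c"
  have "0 \<le> 4 * mean_bound m c + 64 / c" using c by (simp add: mean_bound_def)
  then have "1 \<le> exp (4 * mean_bound m c + 64 / c)" by simp
  then have "(1 * 1) * 1 * 1 \<le> (32 * real m) * 2 ^ 208 * exp (4 * mean_bound m c + 64 / c)"
    using m by (intro mult_mono) auto
  then show ?thesis by (simp add: moment_radius_def)
qed

theorem theorem1p1:
  fixes m n :: nat and q :: "nat \<Rightarrow> nc_monomial"
  assumes "m \<ge> 1"
    and "\<forall>j\<in>{1..n}. set (q j) \<subseteq> {..<m}"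
  shows "\<forall>c>0. \<exists>\<eta>>0. \<forall>t :: nat \<Rightarrow> complex.
    max_norm n t \<le> \<eta> \<and> c_convex m c (potential n q t) \<longrightarrow>
    (\<exists>F0 F1 :: real.
      (\<lambda>N. Ln (partition_function m N (potential n q t))
            - (of_nat N ^ 2 * of_real F0 + of_real F1)) \<in> o(\<lambda>_. 1))"
proof (intro allI impI)
  fix c :: real assume c: "0 < c"
  \<comment> \<open>The constant common to all interpolated potentials, including the Gaussian one
    at \<open>s = 0\<close>.\<close>
  define c' where "c' = min c 1"
  have c': "0 < c'" using c by (simp add: c'_def)
  define R where "R = moment_radius m c'"
  have R: "2 \<le> R" unfolding R_def using assms(1) c' by (rule moment_radius_ge_2)
  \<comment> \<open>The element 1 keeps the set nonempty for \<open>n = 0\<close> and makes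
    \<open>d\<close> positive, as the count of iterations requires.\<close>
  define d where "d = Max (insert 1 ((\<lambda>j. length (q j)) ` {1..n}))"
  have d_ge: "1 \<le> d" "\<And>j. j \<in> {1..n} \<Longrightarrow> length (q j) \<le> d" unfolding d_def by (rule Max_ge; simp)+
  have letters: "set (q j) \<subseteq> {..<m} \<and> length (q j) \<le> d" if "j \<in> {1..n}" for j using assms(2) d_ge(2) that by auto
  define X where "X = (64 * R) ^ d"
  have X: "1 \<le> X" unfolding X_def using R by (intro one_le_power) simp
  \<comment> \<open>The summand 1 keeps the denominator positive for \<open>n = 0\<close>. Only
    \<open>m\<close>, \<open>n\<close>, \<open>q\<close> and \<open>c\<close> enter, so the
    threshold precedes the choice of \<open>t\<close>.\<close>
  define \<eta> where "\<eta> = 1 / (16 * (real n + 1) * real d * X)"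
  have \<eta>_pos: "0 < \<eta>" using d_ge X by (simp add: \<eta>_def)
  have small: "16 * real n * real d * \<eta> * X \<le> 1"
    using d_ge X by (simp add: \<eta>_def divide_simps)
  have nd: "real n * real d * \<eta> \<le> 1"
  proof -
    have "real n * real d * \<eta> * 1 \<le> real n * real d * \<eta> * (16 * X)" using X \<eta>_pos by (intro mult_left_mono) auto
    then show ?thesis using small by (simp add: mult_ac)
  qed
  show "\<exists>\<eta>>0. \<forall>t :: nat \<Rightarrow> complex. max_norm n t \<le> \<eta> \<and> c_convex m c (potential n q t) \<longrightarrow>
    (\<exists>F0 F1 :: real. (\<lambda>N. Ln (partition_function m N (potential n q t)) - (of_nat N ^ 2 * of_real F0 + of_real F1)) \<in> o(\<lambda>_. 1))"
  proof (rule exI[of _ \<eta>], intro conjI allI impI \<eta>_pos)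
    fix t :: "nat \<Rightarrow> complex"
    assume asm: "max_norm n t \<le> \<eta> \<and> c_convex m c (potential n q t)"
    have t_le: "cmod (t j) \<le> \<eta>" if "j \<in> {1..n}" for j
    proof -
      have "cmod (t j) \<le> max_norm n t" unfolding max_norm_def using that by (intro Max_ge) auto
      then show ?thesis using asm by simp
    qed
    have mg: "matrix_gibbs m N n d q (\<lambda>j. of_real s * t j) c' \<eta>" if "1 \<le> N" "s \<in> {0..1}" for N s
      unfolding c'_def using assms(1) that c \<eta>_pos nd t_le letters asm by (intro matrix_gibbs_interpolation) auto
    let ?C = "interpolated_corr m n q t"
    define g where "g = (\<lambda>N s. (real N)\<^sup>2 * Re (\<Sum>j=1..n. t j * ?C N s [q j]))"
    \<comment> \<open>Independent of \<open>N\<close> and \<open>s\<close>; it is valid from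
      \<open>N = 2 * d\<close> on, when every word of the potential has at most half the length
      \<open>N\<close>.\<close>
    define B where "B = (\<Sum>j=1..n. \<eta> * ((2 + 32 * (real d)\<^sup>2) * forest_weight (8 * R) [q j]))"
    have qF: "[q j] \<in> forests {..<m}" if "j \<in> {1..n}" for j using letters[OF that] by auto
    have "\<exists>a b. (\<lambda>N. g N s - (real N)\<^sup>2 * a) \<longlonglongrightarrow> b \<and> (\<forall>N\<ge>2 * d. \<bar>g N s - (real N)\<^sup>2 * a\<bar> \<le> B)" if s: "s \<in> {0..1}" for s
    proof -
      interpret loop_contraction n d q "\<lambda>j. of_real s * t j" "{..<m}" \<eta> R
      proof
        show "cmod (of_real s * t j) \<le> \<eta>" if "j \<in> {1..n}" for j
          using matrix_gibbs.t[OF mg[OF order_refl s] that] .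
      qed (use R d_ge \<eta>_pos small letters in \<open>auto simp: X_def\<close>)
      obtain \<phi>0 \<phi>1 where
        lim: "\<And>ws. ws \<in> forests {..<m} \<Longrightarrow> (\<lambda>N. (of_nat N)\<^sup>2 * (?C N s ws - \<phi>0 ws)) \<longlonglongrightarrow> \<phi>1 ws"
        and bd: "\<And>N ws. 1 \<le> N \<Longrightarrow> ws \<in> forests {..<m} \<Longrightarrow> 2 * forest_length ws \<le> N \<Longrightarrow>
          cmod ((of_nat N)\<^sup>2 * (?C N s ws - \<phi>0 ws)) \<le> (2 + 32 * (real d)\<^sup>2) * forest_weight (8 * R) ws"
      proof (rule expansion[of "\<lambda>N. ?C N s"])
        fix N :: nat assume N: "1 \<le> N"
        interpret M: matrix_gibbs m N n d q "\<lambda>j. of_real s * t j" c' \<eta> by (rule mg[OF N s])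
        show "?C N s [] = 1" "?C N s ([] # ws) = ?C N s ws" for ws by (simp_all add: interpolated_corr_def)
        show "cmod (?C N s ws) \<le> R ^ forest_length ws" if "ws \<in> forests {..<m}" "forest_length ws \<le> N" for ws
          using M.corr_bound[OF that] by (simp add: interpolated_corr_def R_def)
        show "?C N s ((i # w) # vs) = loop_main n q (\<lambda>j. of_real s * t j) (?C N s) i w vs + loop_merge (?C N s) i w vs / (of_nat N)\<^sup>2"
          if "(i # w) # vs \<in> forests {..<m}" for i w vs
          using M.loop_equation[OF that] by (simp add: interpolated_corr_def)
      qed blast
      define a where "a = Re (\<Sum>j=1..n. t j * \<phi>0 [q j])"
      have eq: "g N s - (real N)\<^sup>2 * a = Re (\<Sum>j=1..n. t j * ((of_nat N)\<^sup>2 * (?C N s [q j] - \<phi>0 [q j])))" for N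
      proof -
        have "g N s - (real N)\<^sup>2 * a = Re (of_real ((real N)\<^sup>2) * ((\<Sum>j=1..n. t j * ?C N s [q j]) - (\<Sum>j=1..n. t j * \<phi>0 [q j])))"
          unfolding g_def a_def Re_of_real_mult by (simp add: right_diff_distrib)
        also have "of_real ((real N)\<^sup>2) * ((\<Sum>j=1..n. t j * ?C N s [q j]) - (\<Sum>j=1..n. t j * \<phi>0 [q j])) = (\<Sum>j=1..n. t j * ((of_nat N)\<^sup>2 * (?C N s [q j] - \<phi>0 [q j])))"
          by (simp add: sum_subtractf[symmetric] sum_distrib_left algebra_simps)
        finally show ?thesis .
      qed
      have "(\<lambda>N. g N s - (real N)\<^sup>2 * a) \<longlonglongrightarrow> Re (\<Sum>j=1..n. t j * \<phi>1 [q j])"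
        unfolding eq by (intro tendsto_intros lim qF)
      moreover have "\<bar>g N s - (real N)\<^sup>2 * a\<bar> \<le> B" if N: "2 * d \<le> N" for N
      proof -
        have "\<bar>g N s - (real N)\<^sup>2 * a\<bar> \<le> cmod (\<Sum>j=1..n. t j * ((of_nat N)\<^sup>2 * (?C N s [q j] - \<phi>0 [q j])))"
          unfolding eq by (rule abs_Re_le_cmod)
        also have "\<dots> \<le> B" unfolding B_def
        proof (rule sum_norm_le)
          fix j assume j: "j \<in> {1..n}"
          have "cmod ((of_nat N)\<^sup>2 * (?C N s [q j] - \<phi>0 [q j])) \<le> (2 + 32 * (real d)\<^sup>2) * forest_weight (8 * R) [q j]"
            using N d_ge(1) d_ge(2)[OF j] by (intro bd qF j) auto
          then show "cmod (t j * ((of_nat N)\<^sup>2 * (?C N s [q j] - \<phi>0 [q j]))) \<le> \<eta> * ((2 + 32 * (real d)\<^sup>2) * forest_weight (8 * R) [q j])"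
            unfolding norm_mult[of "t j"] using t_le[OF j] \<eta>_pos by (intro mult_mono) auto
        qed
        finally show ?thesis .
      qed
      ultimately show ?thesis by blast
    qed
    \<comment> \<open>The expansion is obtained for each \<open>s\<close> separately; choice
      collects the limits into functions of \<open>s\<close>.\<close>
    then have "\<exists>a. \<forall>s\<in>{0..1}. \<exists>b. (\<lambda>N. g N s - (real N)\<^sup>2 * a s) \<longlonglongrightarrow> b \<and> (\<forall>N\<ge>2 * d. \<bar>g N s - (real N)\<^sup>2 * a s\<bar> \<le> B)"
      by (intro bchoice) blast
    then obtain a where "\<forall>s\<in>{0..1}. \<exists>b. (\<lambda>N. g N s - (real N)\<^sup>2 * a s) \<longlonglongrightarrow> b \<and> (\<forall>N\<ge>2 * d. \<bar>g N s - (real N)\<^sup>2 * a s\<bar> \<le> B)"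
      by blast
    then have "\<exists>b. \<forall>s\<in>{0..1}. (\<lambda>N. g N s - (real N)\<^sup>2 * a s) \<longlonglongrightarrow> b s \<and> (\<forall>N\<ge>2 * d. \<bar>g N s - (real N)\<^sup>2 * a s\<bar> \<le> B)"
      by (rule bchoice)
    then obtain b where ab: "\<And>s. s \<in> {0..1} \<Longrightarrow> (\<lambda>N. g N s - (real N)\<^sup>2 * a s) \<longlonglongrightarrow> b s"
      "\<And>s N. s \<in> {0..1} \<Longrightarrow> 2 * d \<le> N \<Longrightarrow> \<bar>g N s - (real N)\<^sup>2 * a s\<bar> \<le> B" by blast
    have cont: "continuous_on {0..1} (g N)"
      and Ln: "Ln (partition_function m N (potential n q t)) = of_real (- integral {0..1} (g N))" if N: "1 \<le> N" for N
      unfolding g_def using letters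
      by (intro partition_function_interpolation[OF N _ mg[OF N]]; blast)+
    have "(\<lambda>N. integral {0..1} (g N) - (real N)\<^sup>2 * integral {0..1} a) \<longlonglongrightarrow> integral {0..1} b"
    proof (rule integral_expansion[where K = "2 * d" and B = B])
      show "1 \<le> 2 * d" using d_ge(1) by simp
      then show "continuous_on {0..1} (g N)" if "2 * d \<le> N" for N using that by (intro cont) simp
      show "\<bar>g N s - (real N)\<^sup>2 * a s\<bar> \<le> B" if "2 * d \<le> N" "s \<in> {0..1}" for N s using ab(2) that by blast
      show "(\<lambda>N. g N s - (real N)\<^sup>2 * a s) \<longlonglongrightarrow> b s" if "s \<in> {0..1}" for s using ab(1) that by blast
    qed
    then have "(\<lambda>N. integral {0..1} b - (integral {0..1} (g N) - (real N)\<^sup>2 * integral {0..1} a)) \<longlonglongrightarrow> integral {0..1} b - integral {0..1} b"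
      by (intro tendsto_intros)
    then have "(\<lambda>N. complex_of_real (integral {0..1} b - (integral {0..1} (g N) - (real N)\<^sup>2 * integral {0..1} a))) \<longlonglongrightarrow> of_real (integral {0..1} b - integral {0..1} b)"
      by (rule tendsto_of_real)
    then have "(\<lambda>N. complex_of_real (integral {0..1} b - (integral {0..1} (g N) - (real N)\<^sup>2 * integral {0..1} a))) \<longlonglongrightarrow> 0"
      by (simp only: diff_self of_real_0)
    \<comment> \<open>Since the drift is minus the derivative of the logarithm, both coefficients
      are minus the integrals of the limits.\<close>
    moreover have "eventually (\<lambda>N. complex_of_real (integral {0..1} b - (integral {0..1} (g N) - (real N)\<^sup>2 * integral {0..1} a))
       = Ln (partition_function m N (potential n q t)) - (of_nat N ^ 2 * of_real (- integral {0..1} a) + of_real (- integral {0..1} b))) sequentially"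
      using eventually_ge_at_top[of 1] by eventually_elim (simp add: Ln)
    ultimately have "(\<lambda>N. Ln (partition_function m N (potential n q t)) - (of_nat N ^ 2 * of_real (- integral {0..1} a) + of_real (- integral {0..1} b))) \<longlonglongrightarrow> 0"
      by (rule Lim_transform_eventually)
    then have "(\<lambda>N. Ln (partition_function m N (potential n q t)) - (of_nat N ^ 2 * of_real (- integral {0..1} a) + of_real (- integral {0..1} b))) \<in> o(\<lambda>_. 1)"
      by (intro smalloI_tendsto) auto
    then show "\<exists>F0 F1 :: real. (\<lambda>N. Ln (partition_function m N (potential n q t)) - (of_nat N ^ 2 * of_real F0 + of_real F1)) \<in> o(\<lambda>_. 1)"
      by blast
  qed
qed

end
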